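(* Let $\dot y\in\mathcal P^{++}(\mathcal N)$ be such that $\pi_y$ is equivalent to $\pi$ on $\mathcal N_\infty$. Then $\mathbf Y^\#\pi$, the law of $Y(t)=N(y^*(N,t))$ under $\pi$, is equivalent to $\pi$ on $\mathcal N_\infty$.
   Context: $\mathfrak N$ denotes the set of locally finite simple configurations on $(0,\infty)$, identified with counting paths $N(t)=\omega([0,t])$; $N$ is the canonical process, $\mathcal N_t=\sigma(N(s),s\le t)$, $\mathcal N_\infty=\bigvee_t\mathcal N_t$. For a non-decreasing, right-continuous, $\mathcal N$-predictable process $y$ null at $0$, $\pi_y$ is the unique probability on $(\mathfrak N,\mathcal N_\infty)$ under which $N-y$ is an $\mathcal N$-local martingale; $\pi=\pi_{\mathrm{Id}}$ is the unit rate Poisson law. $\mathcal P^{++}(\mathcal N)$ is the set of positive $\mathcal N$-predictable processes $\dot y$ such that, $\pi$-a.s., $y(t):=\int_0^t\dot y(s)ds<\infty$ for all $t$ and $y(t)\to\infty$; $y^*(N,t)=\inf\{s:y(N,s)>t\}$. $\mathbf Y:\mathfrak N\to\mathfrak N$ is $N\mapsto Y$, and $\mathbf Y^\#\mu$ denotes the image of a measure $\mu$ under $\mathbf Y$. *)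

theory Defs
  imports "HOL-Probability.Probability"
begin

text \<open>Locally finite simple configurations on (0,inf), as point sets.\<close>
definition Nsp :: "real set set" where
  "Nsp = {w. w \<subseteq> {0<..} \<and> (\<forall>t. finite (w \<inter> {0..t}))}"

definition Ncnt :: "real set \<Rightarrow> real \<Rightarrow> real" where
  "Ncnt w t = real (card (w \<inter> {0..t}))"

definition Nfilt :: "real \<Rightarrow> real set measure" where
  "Nfilt t = sigma Nsp {(\<lambda>w. Ncnt w s) -` B \<inter> Nsp | s B. s \<le> t \<and> B \<in> sets borel}"

definition Nfinf :: "real set measure" where
  "Nfinf = sigma Nsp {(\<lambda>w. Ncnt w s) -` B \<inter> Nsp | s B. B \<in> sets borel}"

definition Npred :: "(real set \<times> real) measure" where
  "Npred = sigma (Nsp \<times> {0..})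
     ({A \<times> {0} | A. A \<in> sets (Nfilt 0)} \<union>
      {A \<times> {s<..t} | A s t. 0 \<le> s \<and> s \<le> t \<and> A \<in> sets (Nfilt s)})"

definition is_Nmart :: "real set measure \<Rightarrow> (real set \<Rightarrow> real \<Rightarrow> real) \<Rightarrow> bool" where
  "is_Nmart M X \<longleftrightarrow>
     (\<forall>t\<ge>0. integrable M (\<lambda>w. X w t) \<and> (\<lambda>w. X w t) \<in> borel_measurable (Nfilt t) \<and>
        (\<forall>s. 0 \<le> s \<and> s \<le> t \<longrightarrow>
           (\<forall>A\<in>sets (Nfilt s). (LINT w:A|M. X w t) = (LINT w:A|M. X w s))))"

definition is_Nstopping :: "(real set \<Rightarrow> ereal) \<Rightarrow> bool" where
  "is_Nstopping \<tau> \<longleftrightarrow> (\<forall>w\<in>Nsp. 0 \<le> \<tau> w) \<and>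
     (\<forall>t\<ge>0. {w \<in> Nsp. \<tau> w \<le> ereal t} \<in> sets (Nfilt t))"

definition stopped :: "(real set \<Rightarrow> real \<Rightarrow> real) \<Rightarrow> (real set \<Rightarrow> ereal) \<Rightarrow> real set \<Rightarrow> real \<Rightarrow> real" where
  "stopped X \<tau> w t = (if \<tau> w \<le> ereal t then X w (real_of_ereal (\<tau> w)) else X w t)"

definition is_Nlocmart :: "real set measure \<Rightarrow> (real set \<Rightarrow> real \<Rightarrow> real) \<Rightarrow> bool" where
  "is_Nlocmart M X \<longleftrightarrow>
     (\<exists>\<tau> :: nat \<Rightarrow> real set \<Rightarrow> ereal.
        (\<forall>n. is_Nstopping (\<tau> n)) \<and> (\<forall>n. \<forall>w\<in>Nsp. \<tau> n w \<le> \<tau> (Suc n) w) \<and>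
        (AE w in M. (\<lambda>n. \<tau> n w) \<longlonglongrightarrow> \<infinity>) \<and>
        (\<forall>n. is_Nmart M (stopped X (\<tau> n))))"

definition is_pi_law :: "(real set \<Rightarrow> real \<Rightarrow> real) \<Rightarrow> real set measure \<Rightarrow> bool" where
  "is_pi_law y M \<longleftrightarrow> prob_space M \<and> sets M = sets Nfinf \<and>
     is_Nlocmart M (\<lambda>w t. Ncnt w t - y w t)"

definition equiv_measures :: "'a measure \<Rightarrow> 'a measure \<Rightarrow> bool" where
  "equiv_measures M N \<longleftrightarrow> sets M = sets N \<and> absolutely_continuous M N \<and> absolutely_continuous N M"

definition ypath :: "(real set \<Rightarrow> real \<Rightarrow> real) \<Rightarrow> real set \<Rightarrow> real \<Rightarrow> real" where
  "ypath ydot w t = enn2real (\<integral>\<^sup>+ s\<in>{0..t}. ennreal (ydot w s) \<partial>lborel)"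

definition ygood :: "(real set \<Rightarrow> real \<Rightarrow> real) \<Rightarrow> real set \<Rightarrow> bool" where
  "ygood ydot w \<longleftrightarrow> (\<forall>t\<ge>0. (\<integral>\<^sup>+ s\<in>{0..t}. ennreal (ydot w s) \<partial>lborel) < \<infinity>) \<and>
     filterlim (ypath ydot w) at_top at_top"

definition Ppp :: "real set measure \<Rightarrow> (real set \<Rightarrow> real \<Rightarrow> real) \<Rightarrow> bool" where
  "Ppp Q ydot \<longleftrightarrow> (\<forall>w\<in>Nsp. \<forall>t\<ge>0. 0 < ydot w t) \<and>
     (\<lambda>(w, t). ydot w t) \<in> borel_measurable Npred \<and>
     (AE w in Q. ygood ydot w)"

definition ystar :: "(real set \<Rightarrow> real \<Rightarrow> real) \<Rightarrow> real set \<Rightarrow> real \<Rightarrow> real" where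
  "ystar ydot w t = Inf {s. ypath ydot w s > t}"

text \<open>The map N |-> Y with Y(t) = N(y*(N,t)); the configuration of Y is the set of jump
  times of its counting path (defined on the pi-a.s. event where y is finite and tends to infinity).\<close>
definition Ymap :: "(real set \<Rightarrow> real \<Rightarrow> real) \<Rightarrow> real set \<Rightarrow> real set" where
  "Ymap ydot w = (if w \<in> Nsp \<and> ygood ydot w then
      {t. 0 < t \<and> (\<forall>s\<in>{0..<t}. Ncnt w (ystar ydot w s) < Ncnt w (ystar ydot w t))}
    else {})"

end

theory Submission
  imports Defs
begin

text \<open>Under \<open>P = \<pi>\<^sub>y\<close> the time-changed process \<open>Y\<close> is a unit rate Poisson process, so \<open>Y\<^sup># P = \<pi>\<close>;
  as \<open>P\<close> and \<open>\<pi>\<close> have the same null sets, so do \<open>Y\<^sup># \<pi>\<close> and \<open>Y\<^sup># P = \<pi>\<close>.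

  The law of a simple point process is determined by its void probabilities
  \<open>p(b) = P(Y \<inter> U \<inter> [0, b) = {})\<close>, \<open>U\<close> open. The compensator of \<open>N\<close> applied to the predictable set
  \<open>{(w, u). y(u) \<in> U, y(u) < b, no point x < u of N has y(x) \<in> U}\<close>, which contains at most one point of
  \<open>N\<close>, gives the Volterra equation \<open>1 - p(b) = \<integral>\<^bsub>[0,b) \<inter> U\<^esub> p(v) dv\<close>, whose solution is unique. The same
  equation with \<open>y = Id\<close> holds for \<open>\<pi>\<close>. The compensator formula itself follows from the
  local martingale property by optional stopping at the jump times of \<open>N\<close>, which makes the two terms of
  \<open>N - y\<close> separately integrable.\<close>

section \<open>Configurations and the predictable sigma-algebra\<close>

text \<open>Running the level b is what closes the equation: a point of Y at level v is the first
  one in U exactly when U has no point of Y in [0,v), so p(v) itself reappears under the integral.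
  The integral is a Lebesgue one because y carries the measure dy to Lebesgue measure on the
  half-line.

  The obstacle is measurability. The filtration is the raw one, not completed by null sets, and
  \<open>ypath\<close> passes through \<open>enn2real\<close>, so it is monotone only where the
  integral stays finite. Rather than through a debut time, "Y has visited U before time u" is
  expressed by a countable union of rational certificates, each an event of some
  \<open>Nfilt r\<close> used only at times after r. The resulting set is predictable on all
  configurations and has its intended meaning on good paths.

  The other obstacle is optional stopping in continuous time for a martingale known only through
  integrals over events. Rounding stopping times up to a grid leaves finitely many times, and the
  tails of all rounded values are controlled by one terminal value, which permits the passage to the
  limit.\<close>

lemma NspD: "w \<in> Nsp \<Longrightarrow> x \<in> w \<Longrightarrow> 0 < x"
  by (auto simp: Nsp_def)

lemma Nsp_finite: "w \<in> Nsp \<Longrightarrow> finite (w \<inter> {0..t})"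
  by (auto simp: Nsp_def)

lemma space_Nfilt [simp]: "space (Nfilt t) = Nsp"
  unfolding Nfilt_def by (rule space_measure_of) auto

lemma space_Nfinf [simp]: "space Nfinf = Nsp"
  unfolding Nfinf_def by (rule space_measure_of) auto

lemma sets_Nfilt: "sets (Nfilt t) =
    sigma_sets Nsp {(\<lambda>w. Ncnt w s) -` B \<inter> Nsp | s B. s \<le> t \<and> B \<in> sets borel}"
  unfolding Nfilt_def by (rule sets_measure_of) auto

lemma sets_Nfinf: "sets Nfinf = sigma_sets Nsp {(\<lambda>w. Ncnt w s) -` B \<inter> Nsp | s B. B \<in> sets borel}"
  unfolding Nfinf_def by (rule sets_measure_of) auto

lemma Nfilt_sets_subset: "A \<in> sets (Nfilt t) \<Longrightarrow> A \<subseteq> Nsp"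
  using sets.sets_into_space[of A "Nfilt t"] by simp

abbreviation pred_rects :: "(real set \<times> real) set set" where
  "pred_rects \<equiv> {A \<times> {0} | A. A \<in> sets (Nfilt 0)} \<union>
      {A \<times> {s<..t} | A s t. 0 \<le> s \<and> s \<le> t \<and> A \<in> sets (Nfilt s)}"

lemma pred_rects_subset: "pred_rects \<subseteq> Pow (Nsp \<times> {0..})"
  using Nfilt_sets_subset by fastforce

lemma space_Npred [simp]: "space Npred = Nsp \<times> {0..}"
  unfolding Npred_def by (rule space_measure_of[OF pred_rects_subset])

lemma sets_Npred: "sets Npred = sigma_sets (Nsp \<times> {0..}) pred_rects"
  unfolding Npred_def by (rule sets_measure_of[OF pred_rects_subset])

lemma Ncnt_measurable_Nfilt: "s \<le> t \<Longrightarrow> (\<lambda>w. Ncnt w s) \<in> borel_measurable (Nfilt t)"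
  by (rule measurableI) (auto simp: sets_Nfilt intro!: sigma_sets.Basic)

lemma Ncnt_measurable_Nfinf [measurable]: "(\<lambda>w. Ncnt w s) \<in> borel_measurable Nfinf"
  by (rule measurableI) (auto simp: sets_Nfinf intro!: sigma_sets.Basic)

lemma Nfilt_mono: "s \<le> t \<Longrightarrow> sets (Nfilt s) \<subseteq> sets (Nfilt t)"
  unfolding sets_Nfilt by (rule sigma_sets_mono') force

lemma Nfilt_subset_Nfinf: "sets (Nfilt s) \<subseteq> sets Nfinf"
  unfolding sets_Nfilt sets_Nfinf by (rule sigma_sets_mono') force

lemma measurable_Nfilt_mono:
  "f \<in> measurable (Nfilt s) X \<Longrightarrow> s \<le> t \<Longrightarrow> f \<in> measurable (Nfilt t) X"
  using Nfilt_mono[of s t] by (auto simp: measurable_def)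

lemma measurable_Nfilt_Nfinf: "f \<in> measurable (Nfilt s) X \<Longrightarrow> f \<in> measurable Nfinf X"
  using Nfilt_subset_Nfinf[of s] by (auto simp: measurable_def)

lemma Ncnt_mono: "w \<in> Nsp \<Longrightarrow> s \<le> t \<Longrightarrow> Ncnt w s \<le> Ncnt w t"
  unfolding Ncnt_def by (auto intro!: card_mono Nsp_finite)

lemma Ncnt_diff:
  assumes "w \<in> Nsp" "s \<le> t"
  shows "Ncnt w t - Ncnt w s = real (card (w \<inter> {s<..t}))"
proof -
  have "w \<inter> {0..t} = (w \<inter> {0..s}) \<union> (w \<inter> {s<..t})"
    using assms NspD[of w] by (force intro: less_imp_le)
  moreover have "finite (w \<inter> {s<..t})"
    using assms NspD[of w] by (intro finite_subset[OF _ Nsp_finite[of w t]]) (force intro: less_imp_le)+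
  ultimately have "card (w \<inter> {0..t}) = card (w \<inter> {0..s}) + card (w \<inter> {s<..t})"
    using Nsp_finite[OF assms(1), of s] by (simp add: card_Un_disjoint disjoint_iff)
  then show ?thesis by (simp add: Ncnt_def)
qed

lemma Nsp_finite_Ioc: "w \<in> Nsp \<Longrightarrow> finite (w \<inter> {s<..t})"
  using NspD[of w] by (intro finite_subset[OF _ Nsp_finite[of w t]]) (force intro: less_imp_le)+

lemma Ncnt_less_iff:
  assumes "w \<in> Nsp" "s \<le> t"
  shows "Ncnt w s < Ncnt w t \<longleftrightarrow> (\<exists>x\<in>w. s < x \<and> x \<le> t)"
proof -
  have "Ncnt w s < Ncnt w t \<longleftrightarrow> 0 < card (w \<inter> {s<..t})"
    using Ncnt_diff[OF assms] by linarith
  then show ?thesis using Nsp_finite_Ioc[OF assms(1), of s t] by (auto simp: card_gt_0_iff)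
qed

lemma Nsp_gap_right:
  assumes "w \<in> Nsp"
  obtains e where "0 < e" "w \<inter> {t<..t+e} = {}"
proof -
  have "\<exists>e>0. \<forall>x\<in>w \<inter> {t<..t+1} - {t}. e \<le> dist t x"
    using finite_set_avoid[OF Nsp_finite_Ioc[OF assms, of t "t+1"], of t] by auto
  then obtain e where e: "e > 0" "\<And>x. x \<in> w \<Longrightarrow> t < x \<Longrightarrow> x \<le> t+1 \<Longrightarrow> e \<le> x - t"
    by (force simp: dist_real_def)
  show ?thesis
  proof (rule that[of "min (e/2) 1"])
    show "w \<inter> {t<..t + min (e / 2) 1} = {}" using e by force
  qed (use e in auto)
qed

lemma Nsp_gap_left:
  assumes "w \<in> Nsp"
  obtains e where "0 < e" "w \<inter> {t-e..<t} = {}"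
proof -
  \<comment> \<open>The left end t-2 makes up for the half-open interval, which has to contain all
    of [t-1,t].\<close>
  have "\<exists>e>0. \<forall>x\<in>w \<inter> {t-1-1<..t} - {t}. e \<le> dist t x"
    using finite_set_avoid[OF Nsp_finite_Ioc[OF assms, of "t-1-1" t], of t] by auto
  then obtain e where e: "e > 0" "\<And>x. x \<in> w \<Longrightarrow> x < t \<Longrightarrow> x \<ge> t-1 \<Longrightarrow> e \<le> t - x"
    by (force simp: dist_real_def)
  show ?thesis
  proof (rule that[of "min (e/2) 1"])
    show "w \<inter> {t - min (e / 2) 1..<t} = {}" using e by force
  qed (use e in auto)
qed

section \<open>Void events of bounded open sets generate the sigma-algebra\<close>

definition void :: "real set \<Rightarrow> real set set" where
  "void U = {w \<in> Nsp. w \<inter> U = {}}"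

text \<open>An open set leaves room for rationals q < x < r around a point x of the configuration.
  The whole closed interval is kept inside U while the increment sees (q,r], so hitting U becomes a
  countable condition on counts.\<close>

lemma hits_open_iff:
  fixes U :: "real set"
  assumes w: "w \<in> Nsp" and U: "open U"
  shows "w \<inter> U \<noteq> {} \<longleftrightarrow> (\<exists>q\<in>\<rat>. \<exists>r\<in>\<rat>. q \<le> r \<and> {q..r} \<subseteq> U \<and> Ncnt w q < Ncnt w r)"
proof
  assume "w \<inter> U \<noteq> {}"
  then obtain x where x: "x \<in> w" "x \<in> U" by auto
  obtain e where e: "0 < e" "ball x e \<subseteq> U" using U x open_contains_ball by blast
  obtain q where q: "q \<in> \<rat>" "x - e < q" "q < x" using Rats_dense_in_real[of "x-e" x] e by auto
  obtain r where r: "r \<in> \<rat>" "x < r" "r < x + e" using Rats_dense_in_real[of x "x+e"] e by auto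
  have "{q..r} \<subseteq> ball x e" using q r by (auto simp: dist_real_def)
  then have "{q..r} \<subseteq> U" using e(2) by (rule subset_trans)
  moreover have "q \<le> r" "Ncnt w q < Ncnt w r" using q r x(1) Ncnt_less_iff[OF w, of q r]
    by (meson less_imp_le order.trans)+
  ultimately show "\<exists>q\<in>\<rat>. \<exists>r\<in>\<rat>. q \<le> r \<and> {q..r} \<subseteq> U \<and> Ncnt w q < Ncnt w r"
    using q(1) r(1) by blast
next
  assume "\<exists>q\<in>\<rat>. \<exists>r\<in>\<rat>. q \<le> r \<and> {q..r} \<subseteq> U \<and> Ncnt w q < Ncnt w r"
  then show "w \<inter> U \<noteq> {}" using Ncnt_less_iff[OF w] by fastforce
qed

lemma void_measurable:
  assumes "open U" shows "void U \<in> sets Nfinf"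
proof -
  have "void U = Nsp - (\<Union>q\<in>\<rat>. \<Union>r\<in>{r\<in>\<rat>. q \<le> r \<and> {q..r} \<subseteq> U}. {w\<in>space Nfinf. Ncnt w q < Ncnt w r})"
    using hits_open_iff[OF _ assms] unfolding void_def by auto
  moreover have "Nsp - (\<Union>q\<in>\<rat>. \<Union>r\<in>{r\<in>\<rat>. q \<le> r \<and> {q..r} \<subseteq> U}. {w\<in>space Nfinf. Ncnt w q < Ncnt w r}) \<in> sets Nfinf"
  proof (intro sets.Diff sets.countable_UN'[OF countable_rat] image_subsetI)
    show "Nsp \<in> sets Nfinf" using sets.top[of Nfinf] by simp
    show "(\<Union>r\<in>{r\<in>\<rat>. q \<le> r \<and> {q..r} \<subseteq> U}. {w\<in>space Nfinf. Ncnt w q < Ncnt w r}) \<in> sets Nfinf" for q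
    proof (intro sets.countable_UN' image_subsetI)
      show "countable {r\<in>\<rat>. q \<le> r \<and> {q..r} \<subseteq> U}"
        by (rule countable_subset[OF _ countable_rat]) auto
    qed measurable
  qed
  ultimately show ?thesis by simp
qed

text \<open>Counts are recovered from void events by induction on k: at least k+1 points up to t
  means at least k points up to some rational q < t and a further one in (q,t]. Bounded U are
  singled out because the hitting equation sees U only below a finite level b.\<close>

lemma sets_Nfinf_void: "sets Nfinf = sigma_sets Nsp {void U | U. open U \<and> bdd_above U}" (is "_ = sigma_sets _ ?V")
proof
  define S where "S = sigma Nsp ?V"
  have V: "?V \<subseteq> Pow Nsp" by (auto simp: void_def)
  have setsS: "sets S = sigma_sets Nsp ?V" and spS: "space S = Nsp" using V by (auto simp: S_def)
  have basic: "open U \<Longrightarrow> bdd_above U \<Longrightarrow> void U \<in> sets S" for U unfolding setsS by (rule sigma_sets.Basic) auto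
  have Ioc: "{w\<in>Nsp. w \<inter> {q<..t} = {}} \<in> sets S" for q t :: real
  proof -
    \<comment> \<open>The interval (q,t] is not open. Widening it on the right is harmless for large
      n, since no point of the configuration lies just after t.\<close>
    have "{w\<in>Nsp. w \<inter> {q<..t} = {}} = (\<Union>n. void {q<..<t + inverse (Suc n)})"
    proof (intro set_eqI iffI)
      fix w assume w: "w \<in> {w\<in>Nsp. w \<inter> {q<..t} = {}}"
      then obtain e where e: "0 < e" "w \<inter> {t<..t+e} = {}" using Nsp_gap_right by blast
      obtain n where n: "inverse (Suc n) < e" using e reals_Archimedean by blast
      have "w \<inter> {q<..<t+inverse (Suc n)} \<subseteq> (w \<inter> {q<..t}) \<union> (w \<inter> {t<..t+e})" using n by auto
      then have "w \<in> void {q<..<t+inverse (Suc n)}" using w e by (auto simp: void_def)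
      then show "w \<in> (\<Union>n. void {q<..<t + inverse (Suc n)})" by blast
    next
      fix w assume "w \<in> (\<Union>n. void {q<..<t + inverse (Suc n)})"
      then obtain n where n: "w \<in> Nsp" "w \<inter> {q<..<t + inverse (Suc n)} = {}" by (auto simp: void_def)
      have "t < t + inverse (real (Suc n))" by simp
      then have "{q<..t} \<subseteq> {q<..<t + inverse (real (Suc n))}"
        by (intro subsetI) (metis greaterThanAtMost_iff greaterThanLessThan_iff order.strict_trans1)
      then show "w \<in> {w\<in>Nsp. w \<inter> {q<..t} = {}}" using n by blast
    qed
    then show ?thesis by (auto intro!: sets.countable_UN basic)
  qed
  have ge: "{w\<in>Nsp. Ncnt w t \<ge> real k} \<in> sets S" for t and k :: nat
  proof (induction k arbitrary: t)
    case 0 then show ?case using sets.top[of S] by (simp add: spS Ncnt_def)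
  next
    case (Suc k)
    have eq: "{w\<in>Nsp. Ncnt w t \<ge> real (Suc k)} =
      (\<Union>q\<in>{q\<in>\<rat>. q < t}. {w\<in>Nsp. Ncnt w q \<ge> real k} - {w\<in>Nsp. w \<inter> {q<..t} = {}})"
    proof (intro set_eqI iffI)
      fix w assume a: "w \<in> {w\<in>Nsp. Ncnt w t \<ge> real (Suc k)}"
      then have w: "w \<in> Nsp" by simp
      let ?F = "w \<inter> {0..t}"
      have ne: "?F \<noteq> {}" using a by (auto simp: Ncnt_def)
      define x where "x = Max ?F"
      have x: "x \<in> w" "0 \<le> x" "x \<le> t" using Max_in[OF Nsp_finite[OF w] ne] by (auto simp: x_def)
      have xm: "z \<in> w \<Longrightarrow> z \<le> t \<Longrightarrow> z \<le> x" for z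
        using NspD[OF w, of z] Max_ge[OF Nsp_finite[OF w, of t], of z] by (auto simp: x_def)
      obtain e where e: "0 < e" "w \<inter> {x-e..<x} = {}" using Nsp_gap_left[OF w] by blast
      \<comment> \<open>x is the last point up to t and q lies in the gap before it, so exactly one
        point is lost in passing from t to q.\<close>
      obtain q where q: "q \<in> \<rat>" "x - e < q" "q < x" using Rats_dense_in_real[of "x-e" x] e by auto
      have "w \<inter> {q<..t} = {x}" using q x xm e(2) by force
      then have "Ncnt w t - Ncnt w q = 1" using Ncnt_diff[OF w, of q t] q x by simp
      then have "Ncnt w q \<ge> real k" using a by simp
      then show "w \<in> (\<Union>q\<in>{q\<in>\<rat>. q < t}. {w\<in>Nsp. Ncnt w q \<ge> real k} - {w\<in>Nsp. w \<inter> {q<..t} = {}})"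
        using q x w by (intro UN_I[of q]) auto
    next
      fix w assume "w \<in> (\<Union>q\<in>{q\<in>\<rat>. q < t}. {w\<in>Nsp. Ncnt w q \<ge> real k} - {w\<in>Nsp. w \<inter> {q<..t} = {}})"
      then obtain q where q: "q < t" "w \<in> Nsp" "Ncnt w q \<ge> real k" "w \<inter> {q<..t} \<noteq> {}" by auto
      have "Ncnt w t - Ncnt w q \<ge> 1"
        using Ncnt_diff[of w q t] q Nsp_finite_Ioc[of w q t] by (simp add: Suc_le_eq card_gt_0_iff)
      then show "w \<in> {w\<in>Nsp. Ncnt w t \<ge> real (Suc k)}" using q by simp
    qed
    show ?case unfolding eq
      by (intro sets.countable_UN' image_subsetI sets.Diff Suc Ioc countable_subset[OF _ countable_rat]) auto
  qed
  have meas: "(\<lambda>w. Ncnt w t) \<in> borel_measurable S" for t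
  proof (rule borel_measurableI_ge)
    fix y :: real
    have "{w \<in> space S. y \<le> Ncnt w t} = {w\<in>Nsp. Ncnt w t \<ge> real (nat \<lceil>y\<rceil>)}"
      by (auto simp: spS Ncnt_def nat_ceiling_le_eq)
    then show "{w \<in> space S. y \<le> Ncnt w t} \<in> sets S" using ge by simp
  qed
  have "sigma_sets (space S) {(\<lambda>w. Ncnt w s) -` B \<inter> Nsp | s B. B \<in> sets borel} \<subseteq> sets S"
    by (rule sets.sigma_sets_subset) (use measurable_sets[OF meas] in \<open>auto simp: spS\<close>)
  then show "sets Nfinf \<subseteq> sigma_sets Nsp ?V"
    by (simp only: sets_Nfinf setsS spS)
  show "sigma_sets Nsp ?V \<subseteq> sets Nfinf"
    using sets.sigma_sets_subset[of ?V Nfinf] void_measurable by auto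
qed

section \<open>Predictable sets and measurable maps into \<open>Npred\<close>\<close>

lemma rect_in_Npred: "A \<in> sets (Nfilt s) \<Longrightarrow> 0 \<le> s \<Longrightarrow> A \<times> {s<..t} \<in> sets Npred"
proof (cases "s \<le> t")
  case False then have "A \<times> {s<..t} = {}" by auto
  then show ?thesis by (simp only: sets.empty_sets)
next
  case True
  assume "A \<in> sets (Nfilt s)" "0 \<le> s"
  with True have "A \<times> {s<..t} \<in> pred_rects" by blast
  then show ?thesis unfolding sets_Npred by (rule sigma_sets.Basic)
qed

text \<open>An event known at time s may be used at any time strictly after s. Such rays are the
  building blocks of the predictable sets constructed later.\<close>

lemma ray_in_Npred:
  assumes "A \<in> sets (Nfilt s)" "0 \<le> s" shows "A \<times> {s<..} \<in> sets Npred"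
proof -
  have "A \<times> {s<..} = (\<Union>n::nat. A \<times> {s<..real n})" using real_arch_simple by (auto, blast)
  then show ?thesis using rect_in_Npred[OF assms] by auto
qed

lemma Int_stable_pred_rects: "Int_stable pred_rects"
proof (rule Int_stableI)
  have E: "{} \<in> pred_rects" by auto
  fix a b assume a: "a \<in> pred_rects" and b: "b \<in> pred_rects"
  consider A B where "a = A \<times> {0}" "b = B \<times> {0}" "A \<in> sets (Nfilt 0)" "B \<in> sets (Nfilt 0)"
    | "a \<inter> b = {}"
    | A s t B s' t' where "a = A \<times> {s<..t}" "b = B \<times> {s'<..t'}" "0 \<le> s" "s \<le> t" "0 \<le> s'" "s' \<le> t'"
      "A \<in> sets (Nfilt s)" "B \<in> sets (Nfilt s')"
    using a b by fastforce
  then show "a \<inter> b \<in> pred_rects"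
  proof cases
    case 1
    then have "a \<inter> b = (A \<inter> B) \<times> {0}" "A \<inter> B \<in> sets (Nfilt 0)" by auto
    then show ?thesis by blast
  next
    case 2 then show ?thesis using E by simp
  next
    case 3
    have eq: "a \<inter> b = (A \<inter> B) \<times> {max s s'<..min t t'}" using 3 by auto
    show ?thesis
    proof (cases "max s s' \<le> min t t'")
      case True
      have "A \<in> sets (Nfilt (max s s'))" "B \<in> sets (Nfilt (max s s'))"
        using 3 Nfilt_mono[of s "max s s'"] Nfilt_mono[of s' "max s s'"] by auto
      then have "A \<inter> B \<in> sets (Nfilt (max s s'))" by blast
      then show ?thesis unfolding eq using True 3 by (intro UnI2 CollectI exI[of _ "A \<inter> B"] exI[of _ "max s s'"] exI[of _ "min t t'"]) auto
    next
      case False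
      then have "a \<inter> b = {}" unfolding eq by auto
      then show ?thesis using E by simp
    qed
  qed
qed

text \<open>A rectangle starting at s matters only if g exceeds s somewhere. When g is bounded by t,
  the map f therefore needs to be measurable only for the filtration up to t; this is how
  predictable processes become progressive.\<close>

lemma measurable_into_Npred:
  assumes f: "f \<in> space M \<rightarrow> Nsp" and g: "g \<in> borel_measurable M" and g0: "\<And>x. x \<in> space M \<Longrightarrow> 0 \<le> g x"
    and 0: "\<And>A. A \<in> sets (Nfilt 0) \<Longrightarrow> f -` A \<inter> space M \<in> sets M"
    and s: "\<And>A s. 0 \<le> s \<Longrightarrow> A \<in> sets (Nfilt s) \<Longrightarrow> (\<exists>x\<in>space M. s < g x) \<Longrightarrow> f -` A \<inter> space M \<in> sets M"
  shows "(\<lambda>x. (f x, g x)) \<in> measurable M Npred"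
proof (rule measurable_sigma_sets[OF sets_Npred pred_rects_subset])
  show "(\<lambda>x. (f x, g x)) \<in> space M \<rightarrow> Nsp \<times> {0..}" using f g0 by auto
  fix R assume "R \<in> pred_rects"
  then consider A where "R = A \<times> {0}" "A \<in> sets (Nfilt 0)"
    | A s t where "R = A \<times> {s<..t}" "0 \<le> s" "A \<in> sets (Nfilt s)" by blast
  then show "(\<lambda>x. (f x, g x)) -` R \<inter> space M \<in> sets M"
  proof cases
    case 1
    then have "(\<lambda>x. (f x, g x)) -` R \<inter> space M = (f -` A \<inter> space M) \<inter> (g -` {0} \<inter> space M)" by auto
    then show ?thesis using 0[OF 1(2)] measurable_sets[OF g, of "{0}"] by auto
  next
    case 2
    have eq: "(\<lambda>x. (f x, g x)) -` R \<inter> space M = (f -` A \<inter> space M) \<inter> (g -` {s<..t} \<inter> space M)"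
      using 2 by auto
    show ?thesis
    proof (cases "\<exists>x\<in>space M. s < g x")
      case True
      then show ?thesis unfolding eq using s[OF 2(2,3)] measurable_sets[OF g, of "{s<..t}"] by auto
    next
      case False
      then have "(\<lambda>x. (f x, g x)) -` R \<inter> space M = {}" using 2 by auto
      then show ?thesis by simp
    qed
  qed
qed

text \<open>Clamping makes the time a total real variable, as \<open>Npred\<close> has nonnegative
  times only, and keeps it at most t. Composition with a predictable process gives the joint
  measurability that makes integrals over [0,t] adapted.\<close>

lemma Npred_progressive:
  assumes "0 \<le> t"
  shows "(\<lambda>(w, u). (w, min (max 0 u) t)) \<in> measurable (Nfilt t \<Otimes>\<^sub>M borel) Npred"
proof -
  have *: "fst -` A \<inter> space (Nfilt t \<Otimes>\<^sub>M (borel :: real measure)) \<in> sets (Nfilt t \<Otimes>\<^sub>M borel)"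
    if "A \<in> sets (Nfilt s)" "s \<le> t" for A s
    using that Nfilt_mono[OF that(2)] by (intro measurable_sets[OF measurable_fst]) auto
  have "(\<lambda>x. (fst x, min (max 0 (snd x)) t)) \<in> measurable (Nfilt t \<Otimes>\<^sub>M borel) Npred"
  proof (rule measurable_into_Npred)
    show "fst \<in> space (Nfilt t \<Otimes>\<^sub>M (borel :: real measure)) \<rightarrow> Nsp" by (auto simp: space_pair_measure)
    show "fst -` A \<inter> space (Nfilt t \<Otimes>\<^sub>M (borel :: real measure)) \<in> sets (Nfilt t \<Otimes>\<^sub>M borel)"
      if "A \<in> sets (Nfilt 0)" for A using *[OF that assms] by simp
    show "fst -` A \<inter> space (Nfilt t \<Otimes>\<^sub>M (borel :: real measure)) \<in> sets (Nfilt t \<Otimes>\<^sub>M borel)"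
      if "A \<in> sets (Nfilt s)" "\<exists>x\<in>space (Nfilt t \<Otimes>\<^sub>M (borel :: real measure)). s < min (max 0 (snd x)) t" for A s
      using *[OF that(1)] that(2) by auto
  qed (use assms in simp_all)
  then show ?thesis by (simp add: case_prod_beta')
qed

lemma Npred_jointly: "(\<lambda>(w, u). (w, max 0 u)) \<in> measurable (Nfinf \<Otimes>\<^sub>M borel) Npred"
proof -
  have *: "fst -` A \<inter> space (Nfinf \<Otimes>\<^sub>M (borel :: real measure)) \<in> sets (Nfinf \<Otimes>\<^sub>M borel)"
    if "A \<in> sets (Nfilt s)" for A s
    using that Nfilt_subset_Nfinf by (intro measurable_sets[OF measurable_fst]) auto
  have "(\<lambda>x. (fst x, max 0 (snd x))) \<in> measurable (Nfinf \<Otimes>\<^sub>M borel) Npred"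
  proof (rule measurable_into_Npred)
    show "fst \<in> space (Nfinf \<Otimes>\<^sub>M (borel :: real measure)) \<rightarrow> Nsp" by (auto simp: space_pair_measure)
  qed (use * in simp_all)
  then show ?thesis by (simp add: case_prod_beta')
qed

lemma Npred_sets_jointly:
  assumes "B \<in> sets Npred"
  shows "B \<in> sets (Nfinf \<Otimes>\<^sub>M borel)"
proof -
  have sub: "B \<subseteq> Nsp \<times> {0..}" using sets.sets_into_space[OF assms] by simp
  have "(\<lambda>(w, u). (w, max 0 u)) -` B \<inter> space (Nfinf \<Otimes>\<^sub>M borel) \<in> sets (Nfinf \<Otimes>\<^sub>M borel)"
    by (rule measurable_sets[OF Npred_jointly assms])
  moreover have "Nsp \<times> {0::real..} \<in> sets (Nfinf \<Otimes>\<^sub>M borel)"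
    using sets.top[of Nfinf] by (intro pair_measureI) auto
  moreover have "B = ((\<lambda>(w, u). (w, max 0 u)) -` B \<inter> space (Nfinf \<Otimes>\<^sub>M borel)) \<inter> (Nsp \<times> {0..})"
    using sub by (auto simp: space_pair_measure)
  ultimately show ?thesis by (metis sets.Int)
qed

section \<open>The compensator path and the time change\<close>

text \<open>The value in [0,\<infinity>] is kept because \<open>ypath\<close> sends an infinite
  integral to 0 and so loses monotonicity on bad paths. Measurability is proved for
  \<open>ycum\<close> and passed on to \<open>ypath\<close>.\<close>

definition ycum :: "(real set \<Rightarrow> real \<Rightarrow> real) \<Rightarrow> real set \<Rightarrow> real \<Rightarrow> ennreal" where
  "ycum ydot w t = (\<integral>\<^sup>+ s\<in>{0..t}. ennreal (ydot w s) \<partial>lborel)"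

text \<open>Cutting at 0 turns \<open>ydot\<close>, whose values at negative times are arbitrary,
  into a density on the whole line.\<close>

definition ydens :: "(real set \<Rightarrow> real \<Rightarrow> real) \<Rightarrow> real set \<Rightarrow> real \<Rightarrow> ennreal" where
  "ydens ydot w s = ennreal (ydot w s) * indicator {0..} s"

definition ymeas :: "(real set \<Rightarrow> real \<Rightarrow> real) \<Rightarrow> real set \<Rightarrow> real measure" where
  "ymeas ydot w = density lborel (ydens ydot w)"

lemma ypath_ycum: "ypath ydot w t = enn2real (ycum ydot w t)"
  by (simp add: ypath_def ycum_def)

lemma ygood_finite: "ygood ydot w \<Longrightarrow> ycum ydot w t < \<infinity>"
  by (cases "0 \<le> t") (auto simp: ygood_def ycum_def)

lemma ennreal_ypath: "ygood ydot w \<Longrightarrow> ennreal (ypath ydot w t) = ycum ydot w t"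
  using ygood_finite[of ydot w t] by (simp add: ypath_ycum)

lemma ycum_mono: "s \<le> t \<Longrightarrow> ycum ydot w s \<le> ycum ydot w t"
  unfolding ycum_def by (intro nn_integral_mono) (auto split: split_indicator)

lemma ypath_mono: "ygood ydot w \<Longrightarrow> s \<le> t \<Longrightarrow> ypath ydot w s \<le> ypath ydot w t"
  using ycum_mono[of s t ydot w] ygood_finite[of ydot w t] by (simp add: ypath_ycum enn2real_mono)

lemma ypath_nonneg: "0 \<le> ypath ydot w t"
  by (simp add: ypath_ycum)

lemma ycum_nonpos: "t \<le> 0 \<Longrightarrow> ycum ydot w t = 0"
proof -
  assume "t \<le> 0"
  then have "AE s in lborel. ennreal (ydot w s) * indicator {0..t} s = 0"
    by (intro eventually_mono[OF AE_lborel_singleton[of "0::real"]]) (auto split: split_indicator)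
  then have "ycum ydot w t = (\<integral>\<^sup>+ s. 0 \<partial>(lborel :: real measure))" unfolding ycum_def by (rule nn_integral_cong_AE)
  then show ?thesis by simp
qed

lemma ypath_nonpos: "t \<le> 0 \<Longrightarrow> ypath ydot w t = 0"
  by (simp add: ypath_ycum ycum_nonpos)

text \<open>The part of \<open>Ppp\<close> that holds on every configuration. Goodness holds only
  almost surely; keeping it apart lets measurability be shown for the uncompleted filtration without
  exceptional sets.\<close>

locale rate =
  fixes ydot :: "real set \<Rightarrow> real \<Rightarrow> real"
  assumes ydot_pos: "w \<in> Nsp \<Longrightarrow> 0 \<le> t \<Longrightarrow> 0 < ydot w t"
    and ydot_meas: "(\<lambda>(w, t). ydot w t) \<in> borel_measurable Npred"
begin

lemma ydens_jointly [measurable]: "(\<lambda>(w, s). ydens ydot w s) \<in> borel_measurable (Nfinf \<Otimes>\<^sub>M borel)"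
proof -
  have [measurable]: "(\<lambda>p. ydot (fst p) (max 0 (snd p))) \<in> borel_measurable (Nfinf \<Otimes>\<^sub>M borel)"
    using measurable_compose[OF Npred_jointly ydot_meas] by (simp add: case_prod_beta')
  have "(\<lambda>p. ennreal (ydot (fst p) (max 0 (snd p))) * indicator {0..} (snd p)) \<in> borel_measurable (Nfinf \<Otimes>\<^sub>M borel)"
    by measurable
  moreover have "ennreal (ydot (fst p) (max 0 (snd p))) * indicator {0..} (snd p) = ydens ydot (fst p) (snd p)" for p
    by (auto simp: ydens_def split: split_indicator)
  ultimately show ?thesis by (simp add: case_prod_beta')
qed

lemma ydens_measurable: "w \<in> Nsp \<Longrightarrow> ydens ydot w \<in> borel_measurable borel"
  using measurable_Pair2[OF ydens_jointly, of w] by simp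

lemma sets_ymeas [simp]: "sets (ymeas ydot w) = sets borel"
  by (simp add: ymeas_def)

lemma space_ymeas [simp]: "space (ymeas ydot w) = UNIV"
  by (simp add: ymeas_def)

lemma emeasure_ymeas:
  "w \<in> Nsp \<Longrightarrow> A \<in> sets borel \<Longrightarrow> emeasure (ymeas ydot w) A = (\<integral>\<^sup>+ s\<in>A. ydens ydot w s \<partial>lborel)"
  unfolding ymeas_def by (rule emeasure_density) (auto intro: ydens_measurable)

lemma emeasure_ymeas_Iic: "w \<in> Nsp \<Longrightarrow> emeasure (ymeas ydot w) {..t} = ycum ydot w t"
  unfolding ycum_def by (subst emeasure_ymeas) (auto simp: ydens_def intro!: nn_integral_cong split: split_indicator)

lemma emeasure_ymeas_sing: "w \<in> Nsp \<Longrightarrow> emeasure (ymeas ydot w) {t} = 0"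
proof -
  assume w: "w \<in> Nsp"
  have "AE s in lborel. ydens ydot w s * indicator {t} s = 0"
    by (intro eventually_mono[OF AE_lborel_singleton[of t]]) auto
  then have "(\<integral>\<^sup>+ s\<in>{t}. ydens ydot w s \<partial>lborel) = (\<integral>\<^sup>+ s. 0 \<partial>(lborel :: real measure))" by (rule nn_integral_cong_AE)
  then show ?thesis by (simp add: emeasure_ymeas[OF w])
qed

lemma emeasure_ymeas_Ioc:
  assumes "w \<in> Nsp" "s \<le> t"
  shows "ycum ydot w t = ycum ydot w s + emeasure (ymeas ydot w) {s<..t}"
proof -
  have "{..t} = {..s} \<union> {s<..t}" using assms by auto
  then have "emeasure (ymeas ydot w) {..t} = emeasure (ymeas ydot w) {..s} + emeasure (ymeas ydot w) {s<..t}"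
    by (simp add: plus_emeasure disjoint_iff)
  then show ?thesis by (simp add: emeasure_ymeas_Iic assms)
qed

text \<open>Left-continuity, valid also where the integral becomes infinite: the single time t
  carries no mass, so the mass up to t is exhausted by earlier times. A level exceeded at t was
  already exceeded at a rational time before it, and superlevel sets of \<open>ycum\<close> become
  countable unions of predictable rays.\<close>

lemma ycum_gt_iff:
  assumes "w \<in> Nsp" "0 < t"
  shows "\<alpha> < ycum ydot w t \<longleftrightarrow> (\<exists>q\<in>\<rat>. 0 \<le> q \<and> q < t \<and> \<alpha> < ycum ydot w q)"
proof
  assume a: "\<alpha> < ycum ydot w t"
  have "{..t} = {..<t} \<union> {t}" by auto
  then have "emeasure (ymeas ydot w) {..t} = emeasure (ymeas ydot w) {..<t} + emeasure (ymeas ydot w) {t}"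
    by (subst plus_emeasure) (auto simp: ivl_disj_un)
  then have "ycum ydot w t = emeasure (ymeas ydot w) {..<t}"
    by (simp add: emeasure_ymeas_Iic assms emeasure_ymeas_sing)
  also have "{..<t} = (\<Union>n::nat. {..t - inverse (Suc n)})"
  proof (intro set_eqI iffI)
    fix x assume "x \<in> {..<t}"
    then obtain n where "inverse (Suc n) < t - x" using reals_Archimedean[of "t - x"] by auto
    then show "x \<in> (\<Union>n::nat. {..t - inverse (Suc n)})" by (intro UN_I[of n]) auto
  next
    fix x assume "x \<in> (\<Union>n::nat. {..t - inverse (Suc n)})"
    then obtain n :: nat where "x \<le> t - inverse (Suc n)" by auto
    moreover have "0 < inverse (real (Suc n))" by simp
    ultimately have "x < t" by linarith
    then show "x \<in> {..<t}" by simp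
  qed
  also have "emeasure (ymeas ydot w) \<dots> = (SUP n. emeasure (ymeas ydot w) {..t - inverse (real (Suc n))})"
    by (subst SUP_emeasure_incseq) (auto simp: incseq_def field_simps le_imp_inverse_le)
  finally obtain n :: nat where n: "\<alpha> < ycum ydot w (t - inverse (Suc n))"
    using a by (auto simp: less_SUP_iff emeasure_ymeas_Iic assms)
  have "0 < inverse (real (Suc n))" by simp
  then obtain q where q: "q \<in> \<rat>" "max 0 (t - inverse (Suc n)) < q" "q < t"
    using Rats_dense_in_real[of "max 0 (t - inverse (Suc n))" t] assms by auto
  then show "\<exists>q\<in>\<rat>. 0 \<le> q \<and> q < t \<and> \<alpha> < ycum ydot w q"
    using n ycum_mono[of "t - inverse (Suc n)" q ydot w] by (intro bexI[of _ q]) (auto intro: less_le_trans)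
next
  assume "\<exists>q\<in>\<rat>. 0 \<le> q \<and> q < t \<and> \<alpha> < ycum ydot w q"
  then show "\<alpha> < ycum ydot w t" using ycum_mono[of _ t ydot w] by (auto intro: less_le_trans)
qed

lemma ycum_adapted:
  assumes "0 \<le> t"
  shows "(\<lambda>w. ycum ydot w t) \<in> borel_measurable (Nfilt t)"
proof -
  have [measurable]: "(\<lambda>p. ydot (fst p) (min (max 0 (snd p)) t)) \<in> borel_measurable (Nfilt t \<Otimes>\<^sub>M borel)"
    using measurable_compose[OF Npred_progressive[OF assms] ydot_meas] by (simp add: case_prod_beta')
  have "(\<lambda>p. ennreal (ydot (fst p) (min (max 0 (snd p)) t)) * indicator {0..t} (snd p)) \<in> borel_measurable (Nfilt t \<Otimes>\<^sub>M borel)"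
    by measurable
  moreover have "sets (Nfilt t \<Otimes>\<^sub>M borel) = sets (Nfilt t \<Otimes>\<^sub>M lborel)"
    by (rule sets_pair_measure_cong) auto
  ultimately have "(\<lambda>(w, s). ennreal (ydot w (min (max 0 s) t)) * indicator {0..t} s) \<in> borel_measurable (Nfilt t \<Otimes>\<^sub>M lborel)"
    by (simp add: case_prod_beta' cong: measurable_cong_sets)
  then have "(\<lambda>w. \<integral>\<^sup>+s. ennreal (ydot w (min (max 0 s) t)) * indicator {0..t} s \<partial>lborel) \<in> borel_measurable (Nfilt t)"
    by (rule lborel.borel_measurable_nn_integral)
  moreover have "(\<integral>\<^sup>+s. ennreal (ydot w (min (max 0 s) t)) * indicator {0..t} s \<partial>lborel) = ycum ydot w t" for w
    unfolding ycum_def by (intro nn_integral_cong) (auto split: split_indicator simp: min_absorb1)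
  ultimately show ?thesis by simp
qed

lemma ycum_predictable: "(\<lambda>(w, u). ycum ydot w u) \<in> borel_measurable Npred"
proof (rule borel_measurableI_greater)
  fix \<alpha> :: ennreal
  have "{x \<in> space Npred. \<alpha> < (case x of (w, u) \<Rightarrow> ycum ydot w u)} =
      (\<Union>q\<in>{q\<in>\<rat>. 0 \<le> q}. {w\<in>space (Nfilt q). \<alpha> < ycum ydot w q} \<times> {q<..})" (is "?l = ?r")
  proof (intro set_eqI iffI)
    fix x assume "x \<in> ?l"
    then obtain w u where x: "x = (w, u)" "w \<in> Nsp" "0 \<le> u" "\<alpha> < ycum ydot w u" by auto
    then have "0 < u" using ycum_nonpos[of u ydot w] by (cases "u = 0") auto
    then show "x \<in> ?r" using x ycum_gt_iff[of w u \<alpha>] by auto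
  next
    fix x assume "x \<in> ?r"
    then obtain q w u where x: "x = (w, u)" "w \<in> Nsp" "0 \<le> q" "q < u" "\<alpha> < ycum ydot w q" by auto
    then show "x \<in> ?l" using ycum_mono[of q u ydot w] by (auto intro: less_le_trans)
  qed
  also have "\<dots> \<in> sets Npred"
  proof (intro sets.countable_UN' image_subsetI ray_in_Npred)
    show "countable {q\<in>\<rat>. (0::real) \<le> q}" by (rule countable_subset[OF _ countable_rat]) auto
    show "{w\<in>space (Nfilt q). \<alpha> < ycum ydot w q} \<in> sets (Nfilt q)" if "q \<in> {q\<in>\<rat>. 0 \<le> q}" for q
    proof -
      have [measurable]: "(\<lambda>w. ycum ydot w q) \<in> borel_measurable (Nfilt q)"
        using ycum_adapted[of q] that by simp
      show ?thesis by measurable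
    qed
    show "0 \<le> q" if "q \<in> {q\<in>\<rat>. 0 \<le> q}" for q :: real using that by simp
  qed
  finally show "{x \<in> space Npred. \<alpha> < (case x of (w, u) \<Rightarrow> ycum ydot w u)} \<in> sets Npred" .
qed

lemma ypath_predictable: "(\<lambda>(w, u). ypath ydot w u) \<in> borel_measurable Npred"
  using borel_measurable_enn2real[OF ycum_predictable] by (simp add: ypath_ycum case_prod_beta')

lemma ypath_adapted: "0 \<le> t \<Longrightarrow> (\<lambda>w. ypath ydot w t) \<in> borel_measurable (Nfilt t)"
  using ycum_adapted[of t] by (simp add: ypath_ycum)

lemma ycum_measurable [measurable]: "(\<lambda>w. ycum ydot w t) \<in> borel_measurable Nfinf"
  using measurable_Nfilt_Nfinf[OF ycum_adapted[of t]] by (cases "0 \<le> t") (auto simp: ycum_nonpos)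

lemma ypath_measurable [measurable]: "(\<lambda>w. ypath ydot w t) \<in> borel_measurable Nfinf"
  by (simp add: ypath_ycum)

text \<open>Monotonicity of the integral reduces both finiteness and divergence to integer times and
  integer levels.\<close>

lemma ygood_measurable [measurable]: "{w\<in>space Nfinf. ygood ydot w} \<in> sets Nfinf"
proof -
  have "ygood ydot w \<longleftrightarrow> (\<forall>n::nat. ycum ydot w n < \<infinity>) \<and> (\<forall>k::nat. \<exists>n::nat. real k \<le> ypath ydot w n)" for w
  proof
    assume g: "ygood ydot w"
    then have "\<forall>\<^sub>F t in at_top. real k \<le> ypath ydot w t" for k
      by (auto simp: ygood_def filterlim_at_top)
    then have "\<exists>n::nat. real k \<le> ypath ydot w n" for k
      unfolding eventually_at_top_linorder using real_arch_simple by blast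
    then show "(\<forall>n::nat. ycum ydot w n < \<infinity>) \<and> (\<forall>k::nat. \<exists>n::nat. real k \<le> ypath ydot w n)"
      using ygood_finite[OF g] by auto
  next
    assume a: "(\<forall>n::nat. ycum ydot w n < \<infinity>) \<and> (\<forall>k::nat. \<exists>n::nat. real k \<le> ypath ydot w n)"
    have fin: "ycum ydot w t < \<infinity>" for t
      using a real_arch_simple[of t] ycum_mono[of t _ ydot w] by (meson le_less_trans)
    have mono: "ypath ydot w s \<le> ypath ydot w t" if "s \<le> t" for s t
      using ycum_mono[OF that, of ydot w] fin[of t] by (simp add: ypath_ycum enn2real_mono)
    have "filterlim (ypath ydot w) at_top at_top"
      unfolding filterlim_at_top
    proof
      fix Z :: real
      obtain k :: nat where "Z \<le> real k" using real_arch_simple by blast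
      moreover obtain n :: nat where "real k \<le> ypath ydot w n" using a by blast
      ultimately show "\<forall>\<^sub>F t in at_top. Z \<le> ypath ydot w t"
        unfolding eventually_at_top_linorder using mono by (meson order.trans)
    qed
    then show "ygood ydot w" using fin by (auto simp: ygood_def ycum_def)
  qed
  then have "{w\<in>space Nfinf. ygood ydot w} = {w\<in>space Nfinf. (\<forall>n::nat. ycum ydot w n < \<infinity>) \<and> (\<forall>k::nat. \<exists>n::nat. real k \<le> ypath ydot w n)}"
    by blast
  also have "\<dots> \<in> sets Nfinf" by measurable
  finally show ?thesis .
qed

text \<open>A certificate that Y meets [a,c]: N has a point in (q,r], and on a good path
  monotonicity of y squeezes the level of that point between a and c. It can be checked at time r,
  hence is adapted.\<close>

definition hitbox :: "real \<times> real \<times> real \<times> real \<Rightarrow> real set set" where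
  "hitbox = (\<lambda>(q, r, a, c). {w\<in>Nsp. Ncnt w q < Ncnt w r \<and> a \<le> ypath ydot w q \<and> ypath ydot w r \<le> c})"

text \<open>Rational certificates that guarantee a visit to U; being countable, they keep unions
  measurable.\<close>

definition hitidx :: "real set \<Rightarrow> (real \<times> real \<times> real \<times> real) set" where
  "hitidx U = {(q, r, a, c). q \<in> \<rat> \<and> r \<in> \<rat> \<and> a \<in> \<rat> \<and> c \<in> \<rat> \<and> 0 \<le> q \<and> q < r \<and> {a..c} \<subseteq> U}"

lemma countable_hitidx: "countable (hitidx U)"
  by (rule countable_subset[of _ "\<rat> \<times> \<rat> \<times> \<rat> \<times> \<rat>"]) (auto simp: hitidx_def intro!: countable_SIGMA countable_rat)

lemma hitbox_Nfilt:
  assumes "0 \<le> q" "q < r" shows "hitbox (q, r, a, c) \<in> sets (Nfilt r)"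
proof -
  have [measurable]: "(\<lambda>w. ypath ydot w q) \<in> borel_measurable (Nfilt r)" "(\<lambda>w. ypath ydot w r) \<in> borel_measurable (Nfilt r)"
    "(\<lambda>w. Ncnt w q) \<in> borel_measurable (Nfilt r)" "(\<lambda>w. Ncnt w r) \<in> borel_measurable (Nfilt r)"
    using ypath_adapted[of r] measurable_Nfilt_mono[OF ypath_adapted[of q], of r] assms
    by (auto intro: Ncnt_measurable_Nfilt)
  have "{w\<in>space (Nfilt r). Ncnt w q < Ncnt w r \<and> a \<le> ypath ydot w q \<and> ypath ydot w r \<le> c} \<in> sets (Nfilt r)"
    by measurable
  then show ?thesis by (simp add: hitbox_def)
qed

end

section \<open>A single good path: y as an increasing homeomorphism of the half-line\<close>

locale rate_path = rate +
  fixes w :: "real set"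
  assumes wN: "w \<in> Nsp" and wgood: "ygood ydot w"
begin

abbreviation y :: "real \<Rightarrow> real" where "y \<equiv> ypath ydot w"

text \<open>As \<open>ydot\<close> is strictly positive, an interval of positive length cannot have
  zero dy-mass.\<close>

lemma y_strict: assumes "0 \<le> s" "s < t" shows "y s < y t"
proof (rule ccontr)
  assume "\<not> y s < y t"
  then have "y s = y t" using ypath_mono[OF wgood, of s t] assms by simp
  then have "ycum ydot w s = ycum ydot w t" using ennreal_ypath[OF wgood] by metis
  then have "emeasure (ymeas ydot w) {s<..t} = 0"
    using emeasure_ymeas_Ioc[OF wN, of s t] assms ygood_finite[OF wgood, of t]
    by (metis add.right_neutral ennreal_add_left_cancel infinity_ennreal_def less_imp_le less_irrefl)
  then have "AE u in lborel. ydens ydot w u * indicator {s<..t} u = 0"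
    using ydens_measurable[OF wN] by (simp add: emeasure_ymeas[OF wN] nn_integral_0_iff_AE)
  moreover have "ydens ydot w u * indicator {s<..t} u = 0 \<longleftrightarrow> u \<notin> {s<..t}" for u
    using ydot_pos[OF wN, of u] assms by (auto simp: ydens_def split: split_indicator)
  ultimately have "AE u in lborel. u \<notin> {s<..t}" by simp
  then have "emeasure lborel {s<..t} = 0"
    by (subst (asm) AE_iff_measurable[where N="{s<..t}"]) auto
  then show False using assms by simp
qed

lemma y_less_iff: "0 \<le> s \<Longrightarrow> 0 \<le> t \<Longrightarrow> y s < y t \<longleftrightarrow> s < t"
  using y_strict[of s t] y_strict[of t s] by (cases s t rule: linorder_cases) auto

lemma y_cont: "isCont y x"
proof -
  \<comment> \<open>Distribution functions of finite measures are continuous off their atoms. The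
    measure dy is infinite, hence the restriction to times up to x + 1, which changes nothing near
    x.\<close>
  define T where "T = x + 1"
  define M where "M = density (ymeas ydot w) (indicator {..T})"
  have eM: "emeasure M A = emeasure (ymeas ydot w) ({..T} \<inter> A)" if "A \<in> sets borel" for A
    unfolding M_def using that by (intro emeasure_restricted) auto
  have fin: "emeasure (ymeas ydot w) {..t} < \<infinity>" for t
    using ygood_finite[OF wgood] by (simp add: emeasure_ymeas_Iic wN)
  have "emeasure M (space M) \<noteq> \<infinity>" using fin[of T] eM[of UNIV] by (simp add: M_def)
  then interpret finite_measure M by (rule finite_measureI)
  interpret finite_borel_measure M by unfold_locales (simp add: M_def)
  have "emeasure M {x} \<le> emeasure (ymeas ydot w) {x}" by (subst eM) (auto intro!: emeasure_mono)
  then have "measure M {x} = 0" by (simp add: measure_def emeasure_ymeas_sing[OF wN])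
  then have "isCont (cdf M) x" by (simp add: isCont_cdf)
  moreover have "cdf M t = y t" if "t \<le> T" for t
  proof -
    have "{..T} \<inter> {..t} = {..t}" using that by auto
    then show ?thesis by (simp add: cdf_def measure_def eM emeasure_ymeas_Iic wN ypath_ycum)
  qed
  then have "\<forall>\<^sub>F t in nhds x. cdf M t = y t"
    using eventually_nhds_in_open[of "{..<T}" x] by (auto simp: T_def elim!: eventually_mono)
  ultimately show ?thesis by (simp add: isCont_cong)
qed

lemma y_surj: assumes "0 \<le> a" obtains s where "0 \<le> s" "y s = a"
proof -
  obtain T where T: "0 \<le> T" "a \<le> y T"
    using wgood unfolding ygood_def filterlim_at_top eventually_at_top_linorder by (metis max.cobounded1 max.cobounded2)
  have "\<exists>s\<ge>0. s \<le> T \<and> y s = a"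
    by (rule IVT) (use T assms y_cont ypath_nonpos[of 0] in auto)
  then show ?thesis using that by auto
qed

text \<open>Levels up to a are attained on the times up to s, where y s = a, and these have dy-mass
  y s = a. This is the change of variables v = y(u), carried out on half-lines and without
  differentiation.\<close>

lemma distr_ymeas: "distr (ymeas ydot w) borel y = density lborel (indicator {0..})"
proof (rule measure_eqI_generator_eq[where \<Omega>=UNIV and E="range atMost" and A="\<lambda>n::nat. {..real n}"])
  have ym: "y \<in> borel_measurable (ymeas ydot w)"
    using borel_measurable_mono[of y] ypath_mono[OF wgood] by (simp add: mono_def cong: measurable_cong_sets)
  have L: "emeasure (distr (ymeas ydot w) borel y) {..a} = ennreal (max 0 a)" for a
  proof (cases "0 \<le> a")
    case True
    then obtain s where s: "0 \<le> s" "y s = a" using y_surj by blast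
    have "y u \<le> a \<longleftrightarrow> u \<le> s" for u
      using s y_less_iff[of s u] ypath_nonpos[of u ydot w] True by (cases "0 \<le> u") auto
    then have "y -` {..a} = {..s}" by auto
    then have "emeasure (distr (ymeas ydot w) borel y) {..a} = ycum ydot w s"
      by (subst emeasure_distr[OF ym]) (auto simp: emeasure_ymeas_Iic wN)
    then show ?thesis using s True ennreal_ypath[OF wgood, of s] by simp
  next
    case False
    then have "y -` {..a} = {}" using ypath_nonneg[of ydot w] by (auto intro: order.trans)
    then show ?thesis using False by (subst emeasure_distr[OF ym]) auto
  qed
  have R: "emeasure (density lborel (indicator {0..})) {..a} = ennreal (max 0 a)" for a :: real
  proof -
    have "indicator {0..} x * indicator {..a} x = (indicator {0..a} x :: ennreal)" for x
      by (auto split: split_indicator)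
    then have "emeasure (density lborel (indicator {0..})) {..a} = emeasure lborel {0..a}"
      by (subst emeasure_density) auto
    then show ?thesis by (auto simp: emeasure_lborel_Icc_eq max_def)
  qed
  show "emeasure (distr (ymeas ydot w) borel y) X = emeasure (density lborel (indicator {0..})) X"
    if "X \<in> range atMost" for X using that L R by auto
  show "emeasure (distr (ymeas ydot w) borel y) {..real n} \<noteq> \<infinity>" for n using L by simp
  show "Int_stable (range (atMost :: real \<Rightarrow> real set))"
    by (auto simp: Int_stable_def)
  show "sets (distr (ymeas ydot w) borel y) = sigma_sets UNIV (range atMost)"
    "sets (density lborel (indicator {0..})) = sigma_sets UNIV (range (atMost :: real \<Rightarrow> real set))"
    by (simp_all add: borel_eq_atMost)
  show "(\<Union>n. {..real n}) = UNIV" using real_arch_simple by auto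
qed auto

lemma emeasure_ymeas_vimage:
  assumes "V \<in> sets borel"
  shows "emeasure (ymeas ydot w) (y -` V) = emeasure lborel ({0..} \<inter> V)"
proof -
  have ym: "y \<in> borel_measurable (ymeas ydot w)"
    using borel_measurable_mono[of y] ypath_mono[OF wgood] by (simp add: mono_def cong: measurable_cong_sets)
  have "emeasure (ymeas ydot w) (y -` V) = emeasure (density lborel (indicator {0..})) V"
    unfolding distr_ymeas[symmetric] using assms by (subst emeasure_distr[OF ym]) auto
  also have "\<dots> = emeasure lborel ({0..} \<inter> V)"
    using assms by (intro emeasure_restricted) auto
  finally show ?thesis .
qed

lemma ystar_y: assumes "0 \<le> s" shows "ystar ydot w (y s) = s"
proof -
  have "y s < y u \<longleftrightarrow> s < u" for u
    using y_less_iff[of s u] ypath_nonpos[of u ydot w] ypath_nonneg[of ydot w s] assms by (cases "0 \<le> u") auto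
  then have "{u. y s < y u} = {s<..}" by auto
  then show ?thesis by (simp add: ystar_def)
qed

text \<open>On a good path \<open>ystar\<close> inverts y, so reparametrising the counting path
  merely moves each point x to y x. Later arguments use this image and no longer the jump times of a
  composed path.\<close>

lemma Ymap_image: "Ymap ydot w = y ` w"
proof -
  have "t \<in> y ` w \<longleftrightarrow> 0 < t \<and> (\<forall>s\<in>{0..<t}. Ncnt w (ystar ydot w s) < Ncnt w (ystar ydot w t))" for t
  proof
    assume "t \<in> y ` w"
    then obtain u where u: "u \<in> w" "t = y u" by auto
    have u0: "0 < u" using NspD[OF wN u(1)] .
    have "Ncnt w (ystar ydot w s) < Ncnt w (ystar ydot w t)" if s: "0 \<le> s" "s < t" for s
    proof -
      obtain v where v: "0 \<le> v" "y v = s" using y_surj s by blast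
      have "v < u" using y_less_iff[of v u] v u0 u s by auto
      then show ?thesis using v u u0 Ncnt_less_iff[OF wN, of v u] ystar_y[of v] ystar_y[of u] by auto
    qed
    moreover have "0 < t" using y_strict[of 0 u] u u0 ypath_nonpos[of 0 ydot w] by simp
    ultimately show "0 < t \<and> (\<forall>s\<in>{0..<t}. Ncnt w (ystar ydot w s) < Ncnt w (ystar ydot w t))" by auto
  next
    assume a: "0 < t \<and> (\<forall>s\<in>{0..<t}. Ncnt w (ystar ydot w s) < Ncnt w (ystar ydot w t))"
    obtain u where u: "0 \<le> u" "y u = t" using y_surj[of t] a by auto
    have u0: "0 < u" using u a ypath_nonpos[of u ydot w] by (cases "u = 0") auto
    obtain e where e: "0 < e" "w \<inter> {u-e..<u} = {}" using Nsp_gap_left[OF wN] by blast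
    \<comment> \<open>No points lie in [v,u), so an increase of the count between v and u can only
      come from a point at u itself.\<close>
    define v where "v = max 0 (u - e)"
    have v: "0 \<le> v" "v < u" "w \<inter> {v..<u} = {}" using e u0 by (auto simp: v_def)
    have "y v \<in> {0..<t}" using v u y_less_iff[of v u] ypath_nonneg by auto
    then have "Ncnt w (ystar ydot w (y v)) < Ncnt w (ystar ydot w t)" using a by blast
    then have "Ncnt w v < Ncnt w u" using ystar_y[OF v(1)] ystar_y[OF u(1)] u(2) by simp
    then obtain x where "x \<in> w" "v < x" "x \<le> u" using Ncnt_less_iff[OF wN, of v u] v by auto
    then have "x = u" using v(3) by (cases "x = u") auto
    then show "t \<in> y ` w" using \<open>x \<in> w\<close> u by auto
  qed
  then show ?thesis using wN wgood by (auto simp: Ymap_def)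
qed

lemma Ymap_Nsp: "Ymap ydot w \<in> Nsp"
proof -
  have "y ` w \<subseteq> {0<..}"
    using y_strict[of 0] NspD[OF wN] ypath_nonpos[of 0 ydot w] by auto
  moreover have "finite (y ` w \<inter> {0..t})" for t
  proof (cases "0 \<le> t")
    case True
    then obtain u where u: "0 \<le> u" "y u = t" using y_surj by blast
    have "y ` w \<inter> {0..t} \<subseteq> y ` (w \<inter> {0..u})"
    proof
      fix z assume "z \<in> y ` w \<inter> {0..t}"
      then obtain x where x: "x \<in> w" "z = y x" "y x \<le> t" by auto
      have "x \<le> u" using y_less_iff[of u x] x u NspD[OF wN x(1)] by auto
      then show "z \<in> y ` (w \<inter> {0..u})" using x NspD[OF wN x(1)] by auto
    qed
    then show ?thesis using Nsp_finite[OF wN] by (meson finite_imageI finite_subset)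
  qed auto
  ultimately show ?thesis unfolding Ymap_image by (auto simp: Nsp_def)
qed

text \<open>Forward, continuity of y supplies rational levels a < y x < c with [a,c] inside U, and
  rational times q < x < r < u so close to x that y stays between these levels. Backward,
  monotonicity puts the level of any point in (q,r] into [a,c]. The right-hand side is a countable
  union of events decided before u.\<close>

lemma hits_before_iff:
  assumes U: "open U"
  shows "(\<exists>x\<in>w. x < u \<and> y x \<in> U) \<longleftrightarrow> (\<exists>i\<in>hitidx U. w \<in> hitbox i \<and> fst (snd i) < u)"
proof
  assume "\<exists>x\<in>w. x < u \<and> y x \<in> U"
  then obtain x where x: "x \<in> w" "x < u" "y x \<in> U" by auto
  obtain e where e: "0 < e" "ball (y x) e \<subseteq> U" using U x open_contains_ball by blast
  obtain a where a: "a \<in> \<rat>" "y x - e < a" "a < y x" using Rats_dense_in_real[of "y x-e" "y x"] e by auto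
  obtain c where c: "c \<in> \<rat>" "y x < c" "c < y x + e" using Rats_dense_in_real[of "y x" "y x+e"] e by auto
  have "{a..c} \<subseteq> ball (y x) e" using a c by (auto simp: dist_real_def)
  then have ac: "{a..c} \<subseteq> U" using e(2) by (rule subset_trans)
  have "open (y -` {a<..<c})"
    using y_cont by (intro continuous_open_vimage) (auto simp: continuous_on_eq_continuous_at)
  moreover have "x \<in> y -` {a<..<c}" using a c by simp
  ultimately obtain d where d: "0 < d" "ball x d \<subseteq> y -` {a<..<c}"
    unfolding open_contains_ball by blast
  have x0: "0 < x" using NspD[OF wN x(1)] .
  obtain q where q: "q \<in> \<rat>" "max 0 (x - d) < q" "q < x" using Rats_dense_in_real[of "max 0 (x-d)" x] d x0 by auto
  obtain r where r: "r \<in> \<rat>" "x < r" "r < min u (x + d)" using Rats_dense_in_real[of x "min u (x+d)"] d x by auto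
  have "q \<in> ball x d" "r \<in> ball x d" using q r by (auto simp: dist_real_def)
  then have 1: "a \<le> y q" "y r \<le> c" using d(2) by force+
  have "\<exists>x\<in>w. q < x \<and> x \<le> r" using q r x(1) by (intro bexI[of _ x]) auto
  then have 2: "Ncnt w q < Ncnt w r" using Ncnt_less_iff[OF wN, of q r] q r by simp
  have "(q, r, a, c) \<in> hitidx U" unfolding hitidx_def using q r a(1) c(1) ac by simp
  moreover have "w \<in> hitbox (q, r, a, c)" using 1 2 wN by (simp add: hitbox_def)
  ultimately show "\<exists>i\<in>hitidx U. w \<in> hitbox i \<and> fst (snd i) < u"
    using r by (intro bexI[of _ "(q, r, a, c)"]) auto
next
  assume "\<exists>i\<in>hitidx U. w \<in> hitbox i \<and> fst (snd i) < u"
  then obtain q r a c where *: "(q, r, a, c) \<in> hitidx U" "w \<in> hitbox (q, r, a, c)" "r < u" by auto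
  have **: "q < r" "{a..c} \<subseteq> U" using *(1) unfolding hitidx_def by simp_all
  have ***: "Ncnt w q < Ncnt w r" "a \<le> y q" "y r \<le> c" using *(2) by (simp_all add: hitbox_def)
  obtain x where x: "x \<in> w" "q < x" "x \<le> r" using Ncnt_less_iff[OF wN, of q r] ** *** by auto
  have "y q \<le> y x" "y x \<le> y r" using ypath_mono[OF wgood] x by auto
  then have "y x \<in> {a..c}" using *** by auto
  then have "y x \<in> U" using **(2) by (rule rev_subsetD)
  then show "\<exists>x\<in>w. x < u \<and> y x \<in> U" using x * by (intro bexI[of _ x]) auto
qed

lemma hits_iff:
  assumes U: "open U"
  shows "y ` w \<inter> U \<noteq> {} \<longleftrightarrow> w \<in> (\<Union>i\<in>hitidx U. hitbox i)"
proof
  assume "y ` w \<inter> U \<noteq> {}"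
  then obtain x where "x \<in> w" "y x \<in> U" by blast
  then have "\<exists>z\<in>w. z < x + 1 \<and> y z \<in> U" by (intro bexI[of _ x]) auto
  then show "w \<in> (\<Union>i\<in>hitidx U. hitbox i)" unfolding hits_before_iff[OF U] by blast
next
  assume "w \<in> (\<Union>i\<in>hitidx U. hitbox i)"
  then obtain i where "i \<in> hitidx U" "w \<in> hitbox i" by blast
  then have "\<exists>x\<in>w. x < fst (snd i) + 1 \<and> y x \<in> U"
    unfolding hits_before_iff[OF U] by (intro bexI[of _ i]) auto
  then show "y ` w \<inter> U \<noteq> {}" by blast
qed

end

section \<open>Measurability of the time change and the first-entry set\<close>

context rate
begin

lemma Ymap_measurable: "Ymap ydot \<in> measurable Nfinf Nfinf"
proof (rule measurable_sigma_sets[OF sets_Nfinf_void])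
  show "{void U | U. open U \<and> bdd_above U} \<subseteq> Pow Nsp" by (auto simp: void_def)
  show "Ymap ydot \<in> space Nfinf \<rightarrow> Nsp"
  proof
    fix w assume w: "w \<in> space Nfinf"
    show "Ymap ydot w \<in> Nsp"
    proof (cases "ygood ydot w")
      case True
      then interpret rate_path ydot w using w by unfold_locales auto
      show ?thesis by (rule Ymap_Nsp)
    qed (auto simp: Ymap_def Nsp_def)
  qed
  fix V assume "V \<in> {void U | U. open U \<and> bdd_above U}"
  then obtain U where V: "V = void U" and U: "open U" by auto
  \<comment> \<open>On bad configurations \<open>Ymap\<close> is the empty configuration, which
    belongs to every void event; hence the extra piece.\<close>
  have "Ymap ydot -` V \<inter> space Nfinf = {w\<in>space Nfinf. \<not> ygood ydot w} \<union> ({w\<in>space Nfinf. ygood ydot w} - (\<Union>i\<in>hitidx U. hitbox i))"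
  proof (intro set_eqI)
    fix w
    show "w \<in> Ymap ydot -` V \<inter> space Nfinf \<longleftrightarrow> w \<in> {w\<in>space Nfinf. \<not> ygood ydot w} \<union> ({w\<in>space Nfinf. ygood ydot w} - (\<Union>i\<in>hitidx U. hitbox i))"
    proof (cases "w \<in> Nsp \<and> ygood ydot w")
      case True
      then interpret rate_path ydot w by unfold_locales auto
      have "Ymap ydot w \<in> V \<longleftrightarrow> w \<notin> (\<Union>i\<in>hitidx U. hitbox i)"
        using hits_iff[OF U] Ymap_Nsp by (simp add: V void_def Ymap_image) blast
      then show ?thesis using True by simp
    next
      case False
      then show ?thesis by (auto simp: Ymap_def V void_def) (auto simp: Nsp_def)
    qed
  qed
  moreover have "hitbox i \<in> sets Nfinf" if "i \<in> hitidx U" for i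
    using that by (auto simp: hitidx_def intro!: subsetD[OF Nfilt_subset_Nfinf hitbox_Nfilt])
  then have "(\<Union>i\<in>hitidx U. hitbox i) \<in> sets Nfinf"
    by (intro sets.countable_UN' countable_hitidx) auto
  moreover have "{w\<in>space Nfinf. \<not> ygood ydot w} \<in> sets Nfinf"
    by (intro sets.sets_Collect_neg ygood_measurable)
  ultimately show "Ymap ydot -` V \<inter> space Nfinf \<in> sets Nfinf"
    by (simp only: sets.Un sets.Diff ygood_measurable)
qed

text \<open>The predictable set of times at which \<open>Y\<close>, run in the time scale of \<open>N\<close>, may enter
  \<open>U \<inter> {..<b}\<close> without having visited \<open>U\<close> before; on \<open>\<not> ygood\<close> it is arbitrary.\<close>

definition first_entry :: "real set \<Rightarrow> real \<Rightarrow> (real set \<times> real) set" where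
  "first_entry U b = {(w, u) \<in> space Npred. ypath ydot w u \<in> U \<and> ypath ydot w u < b} -
     (\<Union>i\<in>hitidx U. hitbox i \<times> {fst (snd i)<..})"

text \<open>A certificate completed at time r removes only times strictly after r. This strict delay
  makes the removed rays predictable.\<close>

lemma first_entry_Npred: assumes "open U" shows "first_entry U b \<in> sets Npred"
proof -
  have "{(w, u) \<in> space Npred. ypath ydot w u \<in> U \<and> ypath ydot w u < b} =
      (\<lambda>(w, u). ypath ydot w u) -` (U \<inter> {..<b}) \<inter> space Npred" by auto
  moreover have "\<dots> \<in> sets Npred"
    using assms by (intro measurable_sets[OF ypath_predictable]) auto
  moreover have "hitbox i \<times> {fst (snd i)<..} \<in> sets Npred" if "i \<in> hitidx U" for i
    using that by (auto simp: hitidx_def intro!: ray_in_Npred hitbox_Nfilt)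
  then have "(\<Union>i\<in>hitidx U. hitbox i \<times> {fst (snd i)<..}) \<in> sets Npred"
    by (intro sets.countable_UN' countable_hitidx) auto
  ultimately show ?thesis unfolding first_entry_def by (intro sets.Diff) simp_all
qed

end

lemma (in rate_path) first_entry_iff:
  assumes "open U"
  shows "(w, u) \<in> first_entry U b \<longleftrightarrow> 0 \<le> u \<and> y u \<in> U \<and> y u < b \<and> \<not> (\<exists>x\<in>w. x < u \<and> y x \<in> U)"
  unfolding hits_before_iff[OF assms] using wN by (auto simp: first_entry_def)

section \<open>Optional stopping\<close>

text \<open>Uniform integrability without conditional expectations: on each event |g k| \<ge> K the
  mean of |g k| is dominated by that of one integrable Z, as it would be for conditional
  expectations of Z. The case K = 0 bounds the means of |g k|, so Fatou's lemma makes h integrable.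
  Truncation at height K splits the error into a bounded part, which vanishes as k grows, and two
  tails, which vanish as K grows.\<close>

lemma (in prob_space) uniformly_integrable_limit:
  fixes g :: "nat \<Rightarrow> 'a \<Rightarrow> real" and h Z :: "'a \<Rightarrow> real"
  assumes Z: "integrable M Z" and g: "\<And>k. integrable M (g k)" and h [measurable]: "h \<in> borel_measurable M"
    and lim: "AE x in M. (\<lambda>k. g k x) \<longlonglongrightarrow> h x"
    and dom: "\<And>k K. 0 \<le> K \<Longrightarrow>
      (\<integral>x. indicator {x. K \<le> \<bar>g k x\<bar>} x * \<bar>g k x\<bar> \<partial>M) \<le> (\<integral>x. indicator {x. K \<le> \<bar>g k x\<bar>} x * \<bar>Z x\<bar> \<partial>M)"
    and A [measurable]: "A \<in> sets M" and c: "\<And>k. (\<integral>x. indicator A x * g k x \<partial>M) = c"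
  shows "integrable M h" "(\<integral>x. indicator A x * h x \<partial>M) = c"
proof -
  have gm [measurable]: "g k \<in> borel_measurable M" for k using g by auto
  have [measurable]: "Z \<in> borel_measurable M" using Z by auto
  show hint: "integrable M h"
  proof (rule integrableI_bounded)
    have "(\<integral>\<^sup>+x. norm (h x) \<partial>M) = (\<integral>\<^sup>+x. liminf (\<lambda>k. ennreal (norm (g k x))) \<partial>M)"
    proof (rule nn_integral_cong_AE, use lim in eventually_elim)
      fix x assume "(\<lambda>k. g k x) \<longlonglongrightarrow> h x"
      then have "(\<lambda>k. ennreal (norm (g k x))) \<longlonglongrightarrow> ennreal (norm (h x))"
        by (intro tendsto_ennrealI tendsto_norm)
      then show "ennreal (norm (h x)) = liminf (\<lambda>k. ennreal (norm (g k x)))"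
        by (rule lim_imp_Liminf[OF sequentially_bot, symmetric])
    qed
    also have "\<dots> \<le> liminf (\<lambda>k. \<integral>\<^sup>+x. norm (g k x) \<partial>M)"
      by (rule nn_integral_liminf) simp
    also have "\<dots> \<le> ennreal (\<integral>x. \<bar>Z x\<bar> \<partial>M)"
    proof -
      have "(\<integral>\<^sup>+x. norm (g k x) \<partial>M) \<le> ennreal (\<integral>x. \<bar>Z x\<bar> \<partial>M)" for k
        using dom[of 0 k] integrable_norm[OF g[of k]] by (subst nn_integral_eq_integral) auto
      then show ?thesis by (intro Liminf_le) auto
    qed
    also have "\<dots> < \<infinity>" by simp
    finally show "(\<integral>\<^sup>+x. norm (h x) \<partial>M) < \<infinity>" .
  qed simp
  define \<phi> :: "real \<Rightarrow> real \<Rightarrow> real" where "\<phi> K x = max (-K) (min K x)" for K x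
  \<comment> \<open>A continuous substitute for the indicator of |x| \<ge> K, equal to 0 for |x|
    \<le> K - 1. The indicator itself need not converge along g k where |h| = K.\<close>
  define \<psi> :: "real \<Rightarrow> real \<Rightarrow> real" where "\<psi> K x = max 0 (min 1 (\<bar>x\<bar> - K + 1))" for K x
  have [measurable]: "\<phi> K \<in> borel_measurable borel" "\<psi> K \<in> borel_measurable borel" for K
    unfolding \<phi>_def \<psi>_def by measurable
  have \<phi>b: "\<bar>\<phi> K x\<bar> \<le> \<bar>K\<bar>" for K x by (auto simp: \<phi>_def)
  have \<psi>b: "0 \<le> \<psi> K x" "\<psi> K x \<le> 1" for K x by (auto simp: \<psi>_def)
  have \<psi>i: "indicator {z. K \<le> \<bar>f z\<bar>} x \<le> \<psi> K (f x)" for K and f :: "'a \<Rightarrow> real" and x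
    by (auto simp: \<psi>_def split: split_indicator)
  have tr: "\<bar>f x - \<phi> K (f x)\<bar> \<le> indicator {z. K \<le> \<bar>f z\<bar>} x * \<bar>f x\<bar>" if "0 \<le> K" for K f and x :: 'a
    using that by (auto simp: \<phi>_def split: split_indicator)
  have iZ: "integrable M (\<lambda>x. \<psi> K (f x) * \<bar>Z x\<bar>)" if [measurable]: "f \<in> borel_measurable M" for K f
    by (rule Bochner_Integration.integrable_bound[OF Z]) (use \<psi>b in \<open>auto simp: abs_mult mult_left_le_one_le\<close>)
  have i\<phi>: "integrable M (\<lambda>x. \<phi> K (f x))" if [measurable]: "f \<in> borel_measurable M" for K f
    by (rule integrable_const_bound[of _ "\<bar>K\<bar>"]) (use \<phi>b in auto)
  have itail: "integrable M (\<lambda>x. indicator {z. K \<le> \<bar>f z\<bar>} x * \<bar>f x\<bar>)" if "integrable M f" for K and f :: "'a \<Rightarrow> real"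
  proof -
    have [measurable]: "f \<in> borel_measurable M" using that by auto
    show ?thesis by (rule Bochner_Integration.integrable_bound[OF that]) (auto split: split_indicator)
  qed
  have bound: "\<bar>(\<integral>x. indicator A x * h x \<partial>M) - c\<bar> \<le>
      (\<integral>x. \<bar>\<phi> K (g k x) - \<phi> K (h x)\<bar> \<partial>M) + (\<integral>x. \<psi> K (g k x) * \<bar>Z x\<bar> \<partial>M) + (\<integral>x. \<psi> K (h x) * \<bar>h x\<bar> \<partial>M)"
    (is "_ \<le> ?rhs K k") if K: "0 \<le> K" for k K
  proof -
    have ih: "integrable M (\<lambda>x. indicator A x * h x)" "integrable M (\<lambda>x. indicator A x * g k x)"
      using integrable_mult_indicator[OF A hint] integrable_mult_indicator[OF A g] by simp_all
    have "\<bar>(\<integral>x. indicator A x * h x \<partial>M) - c\<bar> = \<bar>\<integral>x. indicator A x * h x - indicator A x * g k x \<partial>M\<bar>"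
      using c[of k] ih by simp
    also have "\<dots> \<le> (\<integral>x. \<bar>indicator A x * h x - indicator A x * g k x\<bar> \<partial>M)"
      using integral_norm_bound[of M "\<lambda>x. indicator A x * h x - indicator A x * g k x"] by simp
    also have "\<dots> \<le> (\<integral>x. \<bar>\<phi> K (g k x) - \<phi> K (h x)\<bar> + indicator {z. K \<le> \<bar>g k z\<bar>} x * \<bar>g k x\<bar>
         + indicator {z. K \<le> \<bar>h z\<bar>} x * \<bar>h x\<bar> \<partial>M)"
    proof (rule integral_mono)
      fix x
      have "\<bar>indicator A x * h x - indicator A x * g k x\<bar> \<le> \<bar>h x - g k x\<bar>"
        by (auto split: split_indicator)
      also have "\<dots> \<le> \<bar>\<phi> K (g k x) - \<phi> K (h x)\<bar> + \<bar>g k x - \<phi> K (g k x)\<bar> + \<bar>h x - \<phi> K (h x)\<bar>" by linarith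
      finally show "\<bar>indicator A x * h x - indicator A x * g k x\<bar> \<le> \<bar>\<phi> K (g k x) - \<phi> K (h x)\<bar> +
          indicator {z. K \<le> \<bar>g k z\<bar>} x * \<bar>g k x\<bar> + indicator {z. K \<le> \<bar>h z\<bar>} x * \<bar>h x\<bar>"
        using tr[OF K, of "g k" x] tr[OF K, of h x] by linarith
    qed (use ih i\<phi> itail[OF hint] itail[OF g] in auto)
    also have "\<dots> = (\<integral>x. \<bar>\<phi> K (g k x) - \<phi> K (h x)\<bar> \<partial>M) + (\<integral>x. indicator {z. K \<le> \<bar>g k z\<bar>} x * \<bar>g k x\<bar> \<partial>M)
         + (\<integral>x. indicator {z. K \<le> \<bar>h z\<bar>} x * \<bar>h x\<bar> \<partial>M)"
      using i\<phi> itail[OF hint] itail[OF g] by simp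
    also have "\<dots> \<le> ?rhs K k"
    proof (intro add_mono order.refl)
      have "(\<integral>x. indicator {z. K \<le> \<bar>g k z\<bar>} x * \<bar>g k x\<bar> \<partial>M) \<le> (\<integral>x. indicator {z. K \<le> \<bar>g k z\<bar>} x * \<bar>Z x\<bar> \<partial>M)"
        by (rule dom[OF K])
      also have "\<dots> \<le> (\<integral>x. \<psi> K (g k x) * \<bar>Z x\<bar> \<partial>M)"
      proof (rule integral_mono)
        show "integrable M (\<lambda>x. indicator {z. K \<le> \<bar>g k z\<bar>} x * \<bar>Z x\<bar>)"
          by (rule Bochner_Integration.integrable_bound[OF Z]) (auto split: split_indicator)
      qed (use iZ \<psi>i in \<open>auto intro!: mult_right_mono\<close>)
      finally show "(\<integral>x. indicator {z. K \<le> \<bar>g k z\<bar>} x * \<bar>g k x\<bar> \<partial>M) \<le> (\<integral>x. \<psi> K (g k x) * \<bar>Z x\<bar> \<partial>M)" .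
      show "(\<integral>x. indicator {z. K \<le> \<bar>h z\<bar>} x * \<bar>h x\<bar> \<partial>M) \<le> (\<integral>x. \<psi> K (h x) * \<bar>h x\<bar> \<partial>M)"
      proof (rule integral_mono)
        show "integrable M (\<lambda>x. \<psi> K (h x) * \<bar>h x\<bar>)"
          by (rule Bochner_Integration.integrable_bound[OF hint]) (use \<psi>b in \<open>auto simp: abs_mult mult_left_le_one_le\<close>)
      qed (use itail[OF hint] \<psi>i in \<open>auto intro!: mult_right_mono\<close>)
    qed
    finally show ?thesis .
  qed
  \<comment> \<open>Here k tends to infinity with K fixed; K grows only afterwards.\<close>
  have bound2: "\<bar>(\<integral>x. indicator A x * h x \<partial>M) - c\<bar> \<le> 0 + (\<integral>x. \<psi> K (h x) * \<bar>Z x\<bar> \<partial>M) + (\<integral>x. \<psi> K (h x) * \<bar>h x\<bar> \<partial>M)"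
    if K: "0 \<le> K" for K
  proof (rule LIMSEQ_le_const)
    have cont: "isCont (\<phi> K) z" "isCont (\<psi> K) z" for z unfolding \<phi>_def \<psi>_def by (auto intro!: continuous_intros)
    have "(\<lambda>k. \<integral>x. \<bar>\<phi> K (g k x) - \<phi> K (h x)\<bar> \<partial>M) \<longlonglongrightarrow> (\<integral>x. 0 \<partial>M)"
    proof (rule integral_dominated_convergence[where w="\<lambda>_. 2 * \<bar>K\<bar>"])
      show "AE x in M. (\<lambda>k. \<bar>\<phi> K (g k x) - \<phi> K (h x)\<bar>) \<longlonglongrightarrow> 0"
        using lim
      proof eventually_elim
        case (elim x)
        from isCont_tendsto_compose[OF cont(1) elim] show ?case
          using LIM_zero tendsto_rabs_zero by blast
      qed
      show "AE x in M. norm \<bar>\<phi> K (g k x) - \<phi> K (h x)\<bar> \<le> 2 * \<bar>K\<bar>" for k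
      proof (intro AE_I2)
        fix x
        show "norm \<bar>\<phi> K (g k x) - \<phi> K (h x)\<bar> \<le> 2 * \<bar>K\<bar>"
          using \<phi>b[of K "g k x"] \<phi>b[of K "h x"] abs_triangle_ineq4[of "\<phi> K (g k x)" "\<phi> K (h x)"]
          unfolding real_norm_def abs_abs by linarith
      qed
    qed auto
    moreover have "(\<lambda>k. \<integral>x. \<psi> K (g k x) * \<bar>Z x\<bar> \<partial>M) \<longlonglongrightarrow> (\<integral>x. \<psi> K (h x) * \<bar>Z x\<bar> \<partial>M)"
    proof (rule integral_dominated_convergence[where w="\<lambda>x. \<bar>Z x\<bar>"])
      show "AE x in M. (\<lambda>k. \<psi> K (g k x) * \<bar>Z x\<bar>) \<longlonglongrightarrow> \<psi> K (h x) * \<bar>Z x\<bar>"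
        using lim by eventually_elim (intro tendsto_intros isCont_tendsto_compose[OF cont(2)])
    qed (use Z \<psi>b in \<open>auto simp: abs_mult mult_left_le_one_le\<close>)
    ultimately show "?rhs K \<longlonglongrightarrow> 0 + (\<integral>x. \<psi> K (h x) * \<bar>Z x\<bar> \<partial>M) + (\<integral>x. \<psi> K (h x) * \<bar>h x\<bar> \<partial>M)"
      by (intro tendsto_add tendsto_const) auto
  qed (use bound[OF K] in auto)
  have tail0: "(\<lambda>K::nat. \<integral>x. \<psi> (real K) (h x) * \<bar>f x\<bar> \<partial>M) \<longlonglongrightarrow> (\<integral>x. 0 \<partial>M)" if "integrable M f" for f :: "'a \<Rightarrow> real"
  proof (rule integral_dominated_convergence[where w="\<lambda>x. \<bar>f x\<bar>"])
    have [measurable]: "f \<in> borel_measurable M" using that by auto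
    show "(\<lambda>x. \<psi> (real K) (h x) * \<bar>f x\<bar>) \<in> borel_measurable M" for K by measurable
    show "AE x in M. (\<lambda>K. \<psi> (real K) (h x) * \<bar>f x\<bar>) \<longlonglongrightarrow> 0"
    proof (intro AE_I2 tendsto_eventually)
      fix x
      obtain n :: nat where "\<bar>h x\<bar> + 1 \<le> real n" using real_arch_simple by blast
      then show "\<forall>\<^sub>F K in sequentially. \<psi> (real K) (h x) * \<bar>f x\<bar> = 0"
        by (intro eventually_sequentiallyI[of n]) (auto simp: \<psi>_def)
    qed
    show "AE x in M. norm (\<psi> (real K) (h x) * \<bar>f x\<bar>) \<le> \<bar>f x\<bar>" for K
      using \<psi>b by (auto simp: abs_mult mult_left_le_one_le)
  qed (use that in auto)
  have "\<bar>(\<integral>x. indicator A x * h x \<partial>M) - c\<bar> \<le> 0"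
  proof (rule LIMSEQ_le_const)
    show "(\<lambda>K::nat. 0 + (\<integral>x. \<psi> (real K) (h x) * \<bar>Z x\<bar> \<partial>M) + (\<integral>x. \<psi> (real K) (h x) * \<bar>h x\<bar> \<partial>M)) \<longlonglongrightarrow> 0"
      using tendsto_add[OF tail0[OF Z] tail0[OF hint]] by simp
  qed (use bound2 in auto)
  then show "(\<integral>x. indicator A x * h x \<partial>M) = c" by simp
qed

text \<open>Rounding \<open>\<rho>\<close> up to a grid on [s,t] leaves finitely many values, on
  each of which the martingale property applies, and right-continuity identifies the limit.
  Measurability of the stopped value is a hypothesis because that limit is known only almost surely
  and M may be incomplete.\<close>

lemma optional_stopping:
  fixes X :: "real set \<Rightarrow> real \<Rightarrow> real" and \<rho> :: "real set \<Rightarrow> real"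
  assumes P: "prob_space M" and setsM: "sets M = sets Nfinf" and mart: "is_Nmart M X"
    and rc: "AE w in M. \<forall>u\<ge>0. ((\<lambda>v. X w v) \<longlongrightarrow> X w u) (at_right u)"
    and st: "0 \<le> s" "s \<le> t"
    and \<rho>: "\<And>w. w \<in> Nsp \<Longrightarrow> s \<le> \<rho> w \<and> \<rho> w \<le> t"
    and stop: "\<And>u. s \<le> u \<Longrightarrow> u \<le> t \<Longrightarrow> {w\<in>Nsp. \<rho> w \<le> u} \<in> sets (Nfilt u)"
    and A: "A \<in> sets (Nfilt s)"
    and m\<rho>: "(\<lambda>w. X w (\<rho> w)) \<in> borel_measurable M"
  shows "integrable M (\<lambda>w. X w (\<rho> w))"
    "(\<integral>w. indicator A w * X w (\<rho> w) \<partial>M) = (\<integral>w. indicator A w * X w s \<partial>M)"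
proof -
  interpret prob_space M by (rule P)
  have spM: "space M = Nsp" using sets_eq_imp_space_eq[OF setsM] by simp
  have sub: "sets (Nfilt u) \<subseteq> sets M" for u using Nfilt_subset_Nfinf setsM by simp
  have Xint: "integrable M (\<lambda>w. X w u)" if "0 \<le> u" for u using mart that by (auto simp: is_Nmart_def)
  have Xad: "(\<lambda>w. X w u) \<in> borel_measurable (Nfilt u)" if "0 \<le> u" for u using mart that by (auto simp: is_Nmart_def)
  have mt: "(\<integral>w. indicator D w * X w u \<partial>M) = (\<integral>w. indicator D w * X w t \<partial>M)"
    if "D \<in> sets (Nfilt u)" "0 \<le> u" "u \<le> t" for D u
    using mart that unfolding is_Nmart_def set_lebesgue_integral_def by fastforce
  have Iint: "integrable M (\<lambda>w. indicator D w * X w u)" if "D \<in> sets M" "0 \<le> u" for D u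
    using integrable_mult_indicator[OF that(1) Xint[OF that(2)]] by simp
  have t0: "0 \<le> t" using st by simp
  \<comment> \<open>With n + 1 steps the mesh makes sense for n = 0, and the last grid point is
    exactly t.\<close>
  define p where "p n i = s + real i * ((t - s) / real (Suc n))" for n i :: nat
  have p0: "s \<le> p n i" for n i using st by (simp add: p_def)
  have pt: "p n i \<le> t" if "i \<le> Suc n" for n i
  proof -
    have "real i * (t - s) \<le> real (Suc n) * (t - s)" using that st by (intro mult_right_mono) auto
    then show ?thesis by (simp add: p_def field_simps)
  qed
  have pn: "p n (Suc n) = t" for n by (simp add: p_def)
  have pmono: "p n i \<le> p n j" if "i \<le> j" for n i j
    using that st unfolding p_def by (intro add_left_mono mult_right_mono) auto
  define I where "I n w = (LEAST i. \<rho> w \<le> p n i)" for n w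
  have I1: "\<rho> w \<le> p n (I n w)" "I n w \<le> Suc n" if "w \<in> Nsp" for n w
    unfolding I_def using \<rho>[OF that] pn[of n] by (auto intro: LeastI[of "\<lambda>i. \<rho> w \<le> p n i" "Suc n"] Least_le)
  have I2: "p n (I n w) \<le> \<rho> w + (t - s) / real (Suc n)" if w: "w \<in> Nsp" for n w
  proof (cases "I n w")
    case 0
    have "0 \<le> (t - s) / real (Suc n)" using st by simp
    then have "s \<le> \<rho> w + (t - s) / real (Suc n)" using \<rho>[OF w] by linarith
    then show ?thesis unfolding 0 by (simp add: p_def)
  next
    case (Suc i)
    then have "\<not> \<rho> w \<le> p n i" using not_less_Least[of i "\<lambda>i. \<rho> w \<le> p n i"] by (simp add: I_def)
    moreover have "p n (Suc i) = p n i + (t - s) / real (Suc n)" by (simp add: p_def distrib_right add_divide_distrib)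
    ultimately show ?thesis using Suc by simp
  qed
  define C where "C n i = {w\<in>Nsp. I n w = i}" for n i
  have Csets: "C n i \<in> sets (Nfilt (p n i))" if "i \<le> Suc n" for n i
  proof -
    have "C n i = {w\<in>Nsp. \<rho> w \<le> p n i} - (\<Union>j<i. {w\<in>Nsp. \<rho> w \<le> p n j})" (is "_ = ?r")
    proof (intro set_eqI iffI)
      fix w assume w: "w \<in> C n i"
      then have "\<rho> w \<le> p n i" using I1(1)[of w n] by (simp add: C_def)
      moreover have "\<not> \<rho> w \<le> p n j" if "j < i" for j
        using w that not_less_Least[of j "\<lambda>i. \<rho> w \<le> p n i"] unfolding C_def I_def by blast
      ultimately show "w \<in> ?r" using w by (auto simp: C_def)
    next
      fix w assume w: "w \<in> ?r"
      then have "\<rho> w \<le> p n i" "\<And>j. \<rho> w \<le> p n j \<Longrightarrow> i \<le> j" by (auto intro: leI)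
      then have "I n w = i" unfolding I_def by (rule Least_equality)
      then show "w \<in> C n i" using w by (simp add: C_def)
    qed
    moreover have "{w\<in>Nsp. \<rho> w \<le> p n j} \<in> sets (Nfilt (p n i))" if "j \<le> i" for j
      using stop[OF p0 pt[of j n]] Nfilt_mono[OF pmono[OF that, of n]] that \<open>i \<le> Suc n\<close> by auto
    ultimately show ?thesis by auto
  qed
  define Z where "Z w = X w t" for w
  define g where "g n w = (\<Sum>i\<le>Suc n. indicator (C n i) w * X w (p n i))" for n w
  have part: "(\<Sum>i\<le>Suc n. indicator (C n i) w * f i) = f (I n w)" if "w \<in> Nsp" for n w and f :: "nat \<Rightarrow> real"
  proof -
    have "(\<Sum>i\<le>Suc n. indicator (C n i) w * f i) = (\<Sum>i\<le>Suc n. if i = I n w then f i else 0)"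
      using that by (intro sum.cong) (auto simp: C_def)
    also have "\<dots> = f (I n w)" using I1(2)[OF that, of n] by simp
    finally show ?thesis .
  qed
  have geq: "g n w = X w (p n (I n w))" if "w \<in> Nsp" for n w unfolding g_def using part[OF that] .
  have p0': "0 \<le> p n i" for n i using p0[of n i] st by simp
  have CM: "C n i \<in> sets M" if "i \<le> Suc n" for n i using Csets[OF that] sub by blast
  have gint: "integrable M (g n)" for n
    unfolding g_def by (intro Bochner_Integration.integrable_sum Iint CM p0') simp
  have dom: "(\<integral>w. indicator {w. K \<le> \<bar>g n w\<bar>} w * \<bar>g n w\<bar> \<partial>M) \<le> (\<integral>w. indicator {w. K \<le> \<bar>g n w\<bar>} w * \<bar>Z w\<bar> \<partial>M)"
    if K: "0 \<le> K" for n K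
  proof -
    \<comment> \<open>The event |g n| \<ge> K is split by sign and by grid value: there |g n| is X
      or -X on an event known at the grid time, where X may be replaced by its value at t. For K = 0
      the two signs overlap only where X vanishes, and the contributions cancel.\<close>
    define U V where "U i = C n i \<inter> {w\<in>Nsp. K \<le> X w (p n i)}" and "V i = C n i \<inter> {w\<in>Nsp. X w (p n i) \<le> - K}" for i
    have UV: "U i \<in> sets (Nfilt (p n i))" "V i \<in> sets (Nfilt (p n i))" if "i \<le> Suc n" for i
    proof -
      note [measurable] = Xad[OF p0', of n i]
      have "{w\<in>space (Nfilt (p n i)). K \<le> X w (p n i)} \<in> sets (Nfilt (p n i))"
        "{w\<in>space (Nfilt (p n i)). X w (p n i) \<le> -K} \<in> sets (Nfilt (p n i))" by measurable
      then show "U i \<in> sets (Nfilt (p n i))" "V i \<in> sets (Nfilt (p n i))"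
        using Csets[OF that] by (auto simp: U_def V_def)
    qed
    have UVM: "U i \<in> sets M" "V i \<in> sets M" if "i \<le> Suc n" for i using UV[OF that] sub by blast+
    have rep: "(\<Sum>i\<le>Suc n. indicator (U i) w * f i - indicator (V i) w * f i) =
        (if K \<le> g n w then f (I n w) else 0) - (if g n w \<le> -K then f (I n w) else 0)"
      if "w \<in> Nsp" for w and f :: "nat \<Rightarrow> real"
    proof -
      have "(\<Sum>i\<le>Suc n. indicator (U i) w * f i - indicator (V i) w * f i) =
        (\<Sum>i\<le>Suc n. indicator (C n i) w * ((if K \<le> X w (p n i) then f i else 0) - (if X w (p n i) \<le> -K then f i else 0)))"
        using that by (intro sum.cong) (auto simp: U_def V_def split: split_indicator)
      also have "\<dots> = (if K \<le> X w (p n (I n w)) then f (I n w) else 0) - (if X w (p n (I n w)) \<le> -K then f (I n w) else 0)"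
        by (rule part[OF that])
      finally show ?thesis unfolding geq[OF that] .
    qed
    have "(\<integral>w. indicator {w. K \<le> \<bar>g n w\<bar>} w * \<bar>g n w\<bar> \<partial>M) =
        (\<integral>w. (\<Sum>i\<le>Suc n. indicator (U i) w * X w (p n i) - indicator (V i) w * X w (p n i)) \<partial>M)"
    proof (intro Bochner_Integration.integral_cong refl)
      fix w assume "w \<in> space M"
      then show "indicator {w. K \<le> \<bar>g n w\<bar>} w * \<bar>g n w\<bar> =
          (\<Sum>i\<le>Suc n. indicator (U i) w * X w (p n i) - indicator (V i) w * X w (p n i))"
        using K by (subst rep) (auto simp: spM geq[symmetric] split: split_indicator)
    qed
    also have "\<dots> = (\<Sum>i\<le>Suc n. (\<integral>w. indicator (U i) w * X w (p n i) \<partial>M) - (\<integral>w. indicator (V i) w * X w (p n i) \<partial>M))"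
    proof (subst Bochner_Integration.integral_sum)
      show "integrable M (\<lambda>w. indicator (U i) w * X w (p n i) - indicator (V i) w * X w (p n i))" if "i \<in> {..Suc n}" for i
        using that by (intro Bochner_Integration.integrable_diff Iint UVM p0') auto
    qed (intro sum.cong refl Bochner_Integration.integral_diff Iint UVM p0'; simp)
    also have "\<dots> = (\<Sum>i\<le>Suc n. (\<integral>w. indicator (U i) w * Z w \<partial>M) - (\<integral>w. indicator (V i) w * Z w \<partial>M))"
      unfolding Z_def by (intro sum.cong refl arg_cong2[where f="(-)"] mt UV p0' pt) auto
    also have "\<dots> = (\<integral>w. (\<Sum>i\<le>Suc n. indicator (U i) w * Z w - indicator (V i) w * Z w) \<partial>M)"
      unfolding Z_def
    proof (subst Bochner_Integration.integral_sum)
      show "integrable M (\<lambda>w. indicator (U i) w * X w t - indicator (V i) w * X w t)" if "i \<in> {..Suc n}" for i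
        using that by (intro Bochner_Integration.integrable_diff Iint UVM t0) auto
    qed (intro sum.cong refl Bochner_Integration.integral_diff[symmetric] Iint UVM t0; simp)
    also have "\<dots> \<le> (\<integral>w. indicator {w. K \<le> \<bar>g n w\<bar>} w * \<bar>Z w\<bar> \<partial>M)"
    proof (rule integral_mono)
      show "integrable M (\<lambda>w. \<Sum>i\<le>Suc n. indicator (U i) w * Z w - indicator (V i) w * Z w)"
        unfolding Z_def by (intro Bochner_Integration.integrable_sum Bochner_Integration.integrable_diff Iint UVM t0) auto
      have [measurable]: "g n \<in> borel_measurable M" "Z \<in> borel_measurable M"
        using gint[of n] Xint[OF t0] by (auto simp: Z_def[abs_def])
      have "integrable M Z" using Xint[OF t0] by (simp add: Z_def[abs_def])
      then show "integrable M (\<lambda>w. indicator {w. K \<le> \<bar>g n w\<bar>} w * \<bar>Z w\<bar>)"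
        by (rule Bochner_Integration.integrable_bound) (auto split: split_indicator)
      fix w assume "w \<in> space M"
      then show "(\<Sum>i\<le>Suc n. indicator (U i) w * Z w - indicator (V i) w * Z w) \<le> indicator {w. K \<le> \<bar>g n w\<bar>} w * \<bar>Z w\<bar>"
        by (subst rep) (auto simp: spM split: split_indicator)
    qed
    finally show ?thesis .
  qed
  have lim: "AE w in M. (\<lambda>n. g n w) \<longlonglongrightarrow> X w (\<rho> w)"
    using rc AE_space
  proof eventually_elim
    case (elim w)
    then have w: "w \<in> Nsp" by (simp add: spM)
    have r0: "0 \<le> \<rho> w" using \<rho>[OF w] st by simp
    have pc: "(\<lambda>n. p n (I n w)) \<longlonglongrightarrow> \<rho> w"
    proof (rule tendsto_sandwich)
      show "\<forall>\<^sub>F n in sequentially. \<rho> w \<le> p n (I n w)" using I1[OF w] by simp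
      show "\<forall>\<^sub>F n in sequentially. p n (I n w) \<le> \<rho> w + (t - s) * inverse (real (Suc n))"
        using I2[OF w] by (simp add: divide_inverse)
      show "(\<lambda>n. \<rho> w + (t - s) * inverse (real (Suc n))) \<longlonglongrightarrow> \<rho> w"
        using tendsto_add[OF tendsto_const tendsto_mult[OF tendsto_const LIMSEQ_inverse_real_of_nat], of "\<rho> w" "t - s"] by simp
    qed simp
    \<comment> \<open>Rounded times may coincide with \<open>\<rho> w\<close>, so the limit is taken
      in the closed half-line and not only along strictly larger times.\<close>
    have "at (\<rho> w) within {\<rho> w..} = at_right (\<rho> w)"
      unfolding at_within_def by (rule arg_cong[where f="\<lambda>S. inf (nhds (\<rho> w)) (principal S)"]) auto
    then have "continuous (at (\<rho> w) within {\<rho> w..}) (X w)"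
      using elim r0 by (simp add: continuous_within)
    then have "((\<lambda>n. X w (p n (I n w))) \<longlongrightarrow> X w (\<rho> w)) sequentially"
      using continuous_within_sequentially[of "\<rho> w" "{\<rho> w..}" "X w"] I1[OF w] pc by (auto simp: o_def)
    then show ?case by (simp add: geq[OF w])
  qed
  have AM: "A \<in> sets M" using A sub by blast
  have c: "(\<integral>w. indicator A w * g n w \<partial>M) = (\<integral>w. indicator A w * X w s \<partial>M)" for n
  proof -
    have AC: "A \<inter> C n i \<in> sets (Nfilt (p n i))" if "i \<le> Suc n" for i
      using Csets[OF that] A Nfilt_mono[OF p0[of n i]] by blast
    have "(\<integral>w. indicator A w * g n w \<partial>M) = (\<integral>w. (\<Sum>i\<le>Suc n. indicator (A \<inter> C n i) w * X w (p n i)) \<partial>M)"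
      unfolding g_def by (intro Bochner_Integration.integral_cong refl) (simp only: sum_distrib_left indicator_inter_arith mult.assoc)
    also have "\<dots> = (\<Sum>i\<le>Suc n. (\<integral>w. indicator (A \<inter> C n i) w * X w (p n i) \<partial>M))"
      using AC sub by (intro Bochner_Integration.integral_sum Iint p0') auto
    also have "\<dots> = (\<Sum>i\<le>Suc n. (\<integral>w. indicator (A \<inter> C n i) w * X w t \<partial>M))"
      by (intro sum.cong refl mt AC p0' pt) auto
    also have "\<dots> = (\<integral>w. (\<Sum>i\<le>Suc n. indicator (A \<inter> C n i) w * X w t) \<partial>M)"
      using AC sub by (intro Bochner_Integration.integral_sum[symmetric] Iint t0) auto
    also have "\<dots> = (\<integral>w. indicator A w * X w t \<partial>M)"
    proof (intro Bochner_Integration.integral_cong refl)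
      fix w assume "w \<in> space M"
      have "(\<Sum>i\<le>Suc n. indicator (A \<inter> C n i) w * X w t) = indicator A w * (\<Sum>i\<le>Suc n. indicator (C n i) w * X w t)"
        by (simp only: sum_distrib_left indicator_inter_arith mult.assoc)
      then show "(\<Sum>i\<le>Suc n. indicator (A \<inter> C n i) w * X w t) = indicator A w * X w t"
        using part[of w n "\<lambda>_. X w t"] \<open>w \<in> space M\<close> by (simp add: spM)
    qed
    also have "\<dots> = (\<integral>w. indicator A w * X w s \<partial>M)" using mt[OF A] st by simp
    finally show ?thesis .
  qed
  have "integrable M Z" using Xint[OF t0] by (simp add: Z_def[abs_def])
  from uniformly_integrable_limit[OF this gint m\<rho> lim dom AM c]
  show "integrable M (\<lambda>w. X w (\<rho> w))"
    "(\<integral>w. indicator A w * X w (\<rho> w) \<partial>M) = (\<integral>w. indicator A w * X w s \<partial>M)" by auto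
qed

section \<open>The counting kernel and localisation\<close>

text \<open>The random measure dN. Moving \<open>count_space w\<close> to the Borel sets gives it
  the sigma-algebra of \<open>ymeas\<close>, so that one argument serves both sides of the
  compensator formula.\<close>

definition cmeas :: "real set \<Rightarrow> real measure" where
  "cmeas w = distr (count_space w) borel (\<lambda>x. x)"

lemma sets_cmeas [simp]: "sets (cmeas w) = sets borel"
  by (simp add: cmeas_def)

lemma space_cmeas [simp]: "space (cmeas w) = UNIV"
  by (simp add: cmeas_def)

lemma emeasure_cmeas: "S \<in> sets borel \<Longrightarrow> emeasure (cmeas w) S = emeasure (count_space w) (w \<inter> S)"
  unfolding cmeas_def by (subst emeasure_distr) (auto simp: Int_commute)

lemma emeasure_cmeas_finite:
  "S \<in> sets borel \<Longrightarrow> finite (w \<inter> S) \<Longrightarrow> emeasure (cmeas w) S = ennreal (real (card (w \<inter> S)))"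
  by (simp add: emeasure_cmeas ennreal_of_nat_eq_real_of_nat)

lemma Nsp_Int_Iic: "w \<in> Nsp \<Longrightarrow> w \<inter> {..a} = w \<inter> {0..a}"
  using NspD[of w] by (force intro: less_imp_le)

lemma emeasure_cmeas_Iic: "w \<in> Nsp \<Longrightarrow> emeasure (cmeas w) {..a} = ennreal (Ncnt w a)"
  by (subst emeasure_cmeas_finite) (auto simp: Nsp_Int_Iic Nsp_finite Ncnt_def)

text \<open>The cut at T keeps the mass finite, which the complement step of the induction over
  half-lines requires.\<close>

lemma cmeas_Int_Iic_measurable:
  assumes "b \<in> sets borel"
  shows "(\<lambda>w. emeasure (cmeas w) (b \<inter> {..T})) \<in> borel_measurable Nfinf"
proof -
  have "Int_stable (range (atMost :: real \<Rightarrow> real set))" by (auto simp: Int_stable_def)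
  moreover have "range (atMost :: real \<Rightarrow> real set) \<subseteq> Pow UNIV" by simp
  moreover have "b \<in> sigma_sets UNIV (range atMost)" using assms by (simp add: borel_eq_atMost)
  ultimately show ?thesis
  proof (induction rule: sigma_sets_induct_disjoint)
    case (basic A)
    then obtain a where a: "A = {..a}" by auto
    have eq: "emeasure (cmeas w) (A \<inter> {..T}) = ennreal (Ncnt w (min a T))" if "w \<in> space Nfinf" for w
    proof -
      have "A \<inter> {..T} = {..min a T}" using a by auto
      then show ?thesis using that emeasure_cmeas_Iic[of w "min a T"] by simp
    qed
    show ?case by (rule iffD2[OF measurable_cong[OF eq]]) measurable
  next
    case (compl A)
    then have A: "A \<in> sets borel" by (simp add: borel_eq_atMost)
    have eq: "emeasure (cmeas w) ((UNIV - A) \<inter> {..T}) = ennreal (Ncnt w T) - emeasure (cmeas w) (A \<inter> {..T})"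
      if "w \<in> space Nfinf" for w
    proof -
      have w: "w \<in> Nsp" using that by simp
      have "(UNIV - A) \<inter> {..T} = {..T} - A \<inter> {..T}" by auto
      moreover have "emeasure (cmeas w) (A \<inter> {..T}) \<le> emeasure (cmeas w) {..T}"
        by (rule emeasure_mono) auto
      then have "emeasure (cmeas w) (A \<inter> {..T}) \<noteq> \<infinity>"
        by (auto simp: emeasure_cmeas_Iic[OF w] top_unique)
      ultimately show ?thesis
        using A by (simp add: emeasure_Diff emeasure_cmeas_Iic[OF w])
    qed
    note [measurable] = compl(2)
    show ?case by (rule iffD2[OF measurable_cong[OF eq]]) measurable
  next
    case (union A)
    have A: "range A \<subseteq> sets borel" using union(2) by (simp add: borel_eq_atMost)
    have "emeasure (cmeas w) (\<Union> (range A) \<inter> {..T}) = (\<Sum>i. emeasure (cmeas w) (A i \<inter> {..T}))" for w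
      using A union(1) by (subst suminf_emeasure) (auto simp: disjoint_family_on_def)
    then show ?case using union(3) by simp
  qed auto
qed

lemma cmeas_pair_measurable:
  assumes "B \<in> sets (Nfinf \<Otimes>\<^sub>M borel)"
  shows "(\<lambda>w. emeasure (cmeas w) (Pair w -` B)) \<in> borel_measurable Nfinf"
proof -
  have fin: "(\<lambda>w. emeasure (cmeas w) (Pair w -` B \<inter> {..T})) \<in> borel_measurable Nfinf" for T
  proof -
    have "B \<in> sigma_sets (space Nfinf \<times> space borel) {a \<times> b |a b. a \<in> sets Nfinf \<and> b \<in> sets (borel :: real measure)}"
      using assms by (simp only: sets_pair_measure)
    with Int_stable_pair_measure_generator pair_measure_closed show ?thesis
    proof (induction rule: sigma_sets_induct_disjoint)
      case (basic A)
      then obtain a b where ab: "A = a \<times> b" "a \<in> sets Nfinf" "b \<in> sets borel" by auto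
      have "emeasure (cmeas w) (Pair w -` A \<inter> {..T}) = indicator a w * emeasure (cmeas w) (b \<inter> {..T})" for w
        using ab by (auto split: split_indicator)
      moreover note [measurable] = cmeas_Int_Iic_measurable[OF ab(3), of T] ab(2)
      ultimately show ?case by simp
    next
      case (compl A)
      have A: "A \<in> sets (Nfinf \<Otimes>\<^sub>M borel)" using compl(1) by (simp only: sets_pair_measure)
      have eq: "emeasure (cmeas w) (Pair w -` (space Nfinf \<times> space borel - A) \<inter> {..T}) =
          ennreal (Ncnt w T) - emeasure (cmeas w) (Pair w -` A \<inter> {..T})" if "w \<in> space Nfinf" for w
      proof -
        have w: "w \<in> Nsp" using that by simp
        have "Pair w -` (space Nfinf \<times> space borel - A) \<inter> {..T} = {..T} - Pair w -` A \<inter> {..T}" using w by auto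
        moreover have "emeasure (cmeas w) (Pair w -` A \<inter> {..T}) \<le> emeasure (cmeas w) {..T}"
          by (rule emeasure_mono) auto
        then have "emeasure (cmeas w) (Pair w -` A \<inter> {..T}) \<noteq> \<infinity>"
          by (auto simp: emeasure_cmeas_Iic[OF w] top_unique)
        ultimately show ?thesis
          using sets_Pair1[OF A, of w] by (simp add: emeasure_Diff emeasure_cmeas_Iic[OF w])
      qed
      note [measurable] = compl(2)
      show ?case by (rule iffD2[OF measurable_cong[OF eq]]) measurable
    next
      case (union A)
      have A: "Pair w -` A i \<in> sets borel" for w i
        using union(2) by (intro sets_Pair1[of _ Nfinf]) (auto simp: sets_pair_measure)
      have "emeasure (cmeas w) (Pair w -` \<Union> (range A) \<inter> {..T}) = (\<Sum>i. emeasure (cmeas w) (Pair w -` A i \<inter> {..T}))" for w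
      proof (subst suminf_emeasure)
        show "disjoint_family (\<lambda>i. Pair w -` A i \<inter> {..T})"
          using union(1) unfolding disjoint_family_on_def by blast
      qed (use A in \<open>auto intro!: arg_cong[where f="emeasure _"]\<close>)
      then show ?case using union(3) by simp
    qed auto
  qed
  have "emeasure (cmeas w) (Pair w -` B) = (SUP n. emeasure (cmeas w) (Pair w -` B \<inter> {..real n}))" for w
  proof -
    have "Pair w -` B = (\<Union>n. Pair w -` B \<inter> {..real n})" using real_arch_simple by auto
    then show ?thesis
      using sets_Pair1[OF assms, of w] by (subst SUP_emeasure_incseq) (auto simp: incseq_def intro: order.trans)
  qed
  then show ?thesis using fin by simp
qed

lemma (in rate) ymeas_pair_measurable:
  assumes [measurable]: "B \<in> sets (Nfinf \<Otimes>\<^sub>M borel)"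
  shows "(\<lambda>w. emeasure (ymeas ydot w) (Pair w -` B)) \<in> borel_measurable Nfinf"
proof -
  have "(\<lambda>(w, s). ydens ydot w s * indicator B (w, s)) \<in> borel_measurable (Nfinf \<Otimes>\<^sub>M borel)" by measurable
  moreover have "sets (Nfinf \<Otimes>\<^sub>M borel) = sets (Nfinf \<Otimes>\<^sub>M lborel)" by (rule sets_pair_measure_cong) auto
  ultimately have "(\<lambda>(w, s). ydens ydot w s * indicator B (w, s)) \<in> borel_measurable (Nfinf \<Otimes>\<^sub>M lborel)"
    by (simp cong: measurable_cong_sets)
  then have "(\<lambda>w. \<integral>\<^sup>+s. ydens ydot w s * indicator B (w, s) \<partial>lborel) \<in> borel_measurable Nfinf"
    by (rule lborel.borel_measurable_nn_integral)
  moreover have "emeasure (ymeas ydot w) (Pair w -` B) = (\<integral>\<^sup>+s. ydens ydot w s * indicator B (w, s) \<partial>lborel)"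
    if "w \<in> space Nfinf" for w
    using that sets_Pair1[OF assms, of w] by (subst emeasure_ymeas) (auto simp: indicator_def)
  ultimately show ?thesis by (subst measurable_cong)
qed

text \<open>By right-continuity a count below a at time u stays below a up to some rational q > u,
  which makes the sublevel set a countable union of rectangles.\<close>

lemma Ncnt_jointly [measurable]: "(\<lambda>(w, u). Ncnt w u) \<in> borel_measurable (Nfinf \<Otimes>\<^sub>M borel)"
proof (rule borel_measurableI_less)
  fix a :: real
  have "{x \<in> space (Nfinf \<Otimes>\<^sub>M borel). (case x of (w, u) \<Rightarrow> Ncnt w u) < a} =
     (\<Union>q\<in>\<rat>. {w\<in>space Nfinf. Ncnt w q < a} \<times> {..<q})" (is "?l = ?r")
  proof (intro set_eqI iffI)
    fix x assume "x \<in> ?l"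
    then obtain w u where x: "x = (w, u)" "w \<in> Nsp" "Ncnt w u < a" by (auto simp: space_pair_measure)
    obtain e where e: "0 < e" "w \<inter> {u<..u+e} = {}" using Nsp_gap_right[OF x(2)] by blast
    obtain q where q: "q \<in> \<rat>" "u < q" "q < u + e" using Rats_dense_in_real[of u "u+e"] e by auto
    have "\<not> Ncnt w u < Ncnt w q" using Ncnt_less_iff[OF x(2), of u q] q e(2) by auto
    then have "Ncnt w q < a" using x(3) by linarith
    then show "x \<in> ?r" using x q by auto
  next
    fix x assume "x \<in> ?r"
    then obtain w u q where x: "x = (w, u)" "w \<in> Nsp" "Ncnt w q < a" "u < q" by auto
    then show "x \<in> ?l" using Ncnt_mono[OF x(2), of u q] by (auto simp: space_pair_measure)
  qed
  moreover have "?r \<in> sets (Nfinf \<Otimes>\<^sub>M borel)"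
    by (intro sets.countable_UN' countable_rat image_subsetI pair_measureI) measurable
  ultimately show "{x \<in> space (Nfinf \<Otimes>\<^sub>M borel). (case x of (w, u) \<Rightarrow> Ncnt w u) < a} \<in> sets (Nfinf \<Otimes>\<^sub>M borel)"
    by simp
qed

lemma (in rate) ypath_jointly [measurable]: "(\<lambda>(w, u). ypath ydot w u) \<in> borel_measurable (Nfinf \<Otimes>\<^sub>M borel)"
proof -
  have "(\<lambda>p. ypath ydot (fst p) (max 0 (snd p))) \<in> borel_measurable (Nfinf \<Otimes>\<^sub>M borel)"
    using measurable_compose[OF Npred_jointly ypath_predictable] by (simp add: case_prod_beta')
  moreover have "ypath ydot w (max 0 u) = ypath ydot w u" for w u
    by (cases "0 \<le> u") (auto simp: ypath_nonpos)
  ultimately show ?thesis by (simp add: case_prod_beta')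
qed

section \<open>Localisation by stopping times and jump times\<close>

lemma Nstopping_measurable:
  assumes "is_Nstopping \<tau>" shows "\<tau> \<in> borel_measurable Nfinf"
proof (rule borel_measurableI_le)
  fix a :: ereal
  have pos: "0 \<le> \<tau> w" if "w \<in> Nsp" for w using assms that by (auto simp: is_Nstopping_def)
  consider "a < 0" | t where "a = ereal t" "0 \<le> t" | "a = \<infinity>" by (cases a) force+
  then show "{w \<in> space Nfinf. \<tau> w \<le> a} \<in> sets Nfinf"
  proof cases
    case 1
    then have "{w \<in> space Nfinf. \<tau> w \<le> a} = {}" using pos by (force dest: order.strict_trans2)
    then show ?thesis by (simp only: sets.empty_sets)
  next
    case 2
    then show ?thesis using assms Nfilt_subset_Nfinf by (auto simp: is_Nstopping_def)
  next
    case 3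
    then show ?thesis using sets.top[of Nfinf] by simp
  qed
qed

text \<open>The interval \<open>(-\<infinity>, \<tau> \<and> T\<^sub>m]\<close>, where \<open>T\<^sub>m\<close> is the \<open>m\<close>-th jump time.\<close>

definition stop_set :: "(real set \<Rightarrow> ereal) \<Rightarrow> nat \<Rightarrow> real set \<Rightarrow> real set" where
  "stop_set \<tau> m w = {u. ereal u \<le> \<tau> w \<and> (\<forall>v<u. Ncnt w v < real m)}"

lemma stop_set_measurable:
  assumes "is_Nstopping \<tau>"
  shows "{(w, u). w \<in> Nsp \<and> u \<in> stop_set \<tau> m w} \<in> sets (Nfinf \<Otimes>\<^sub>M borel)"
proof -
  note [measurable] = Nstopping_measurable[OF assms]
  have "(\<exists>v<u. real m \<le> Ncnt w v) \<longleftrightarrow> (\<exists>q\<in>\<rat>. q < u \<and> real m \<le> Ncnt w q)" if "w \<in> Nsp" for w u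
  proof
    assume "\<exists>v<u. real m \<le> Ncnt w v"
    then obtain v where v: "v < u" "real m \<le> Ncnt w v" by auto
    obtain q where q: "q \<in> \<rat>" "v < q" "q < u" using Rats_dense_in_real[OF v(1)] by auto
    then show "\<exists>q\<in>\<rat>. q < u \<and> real m \<le> Ncnt w q" using v Ncnt_mono[OF that, of v q] by (intro bexI[of _ q]) auto
  qed auto
  then have "w \<in> Nsp \<Longrightarrow> (\<forall>v<u. Ncnt w v < real m) \<longleftrightarrow> \<not> (\<exists>q\<in>\<rat>. q < u \<and> real m \<le> Ncnt w q)" for w u
    by (metis not_le)
  then have "{(w, u). w \<in> Nsp \<and> u \<in> stop_set \<tau> m w} =
      {p\<in>space (Nfinf \<Otimes>\<^sub>M borel). ereal (snd p) \<le> \<tau> (fst p)} - (\<Union>q\<in>\<rat>. {w\<in>space Nfinf. real m \<le> Ncnt w q} \<times> {q<..})"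
    by (auto simp: stop_set_def space_pair_measure)
  moreover have "(\<Union>q\<in>\<rat>. {w\<in>space Nfinf. real m \<le> Ncnt w q} \<times> {q<..}) \<in> sets (Nfinf \<Otimes>\<^sub>M borel)"
    by (intro sets.countable_UN' countable_rat image_subsetI pair_measureI) measurable
  ultimately show ?thesis by simp
qed

lemma stop_set_sets:
  assumes "is_Nstopping \<tau>" "w \<in> Nsp" shows "stop_set \<tau> m w \<in> sets borel"
  using sets_Pair1[OF stop_set_measurable[OF assms(1), of m], of w] assms(2) by (simp add: vimage_def)

text \<open>Points are simple, so the path jumps by at most one at u, and integrality leaves room
  for that jump below m.\<close>

lemma Ncnt_le_stop_set:
  assumes w: "w \<in> Nsp" and u: "\<And>v. v < u \<Longrightarrow> Ncnt w v < real m"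
  shows "Ncnt w u \<le> real m"
proof -
  obtain e where e: "0 < e" "w \<inter> {u-e..<u} = {}" using Nsp_gap_left[OF w] by blast
  have "w \<inter> {u-e<..u} \<subseteq> {u}" using e(2) by force
  then have "card (w \<inter> {u-e<..u}) \<le> card {u}" by (intro card_mono) auto
  then have "Ncnt w u - Ncnt w (u-e) \<le> 1" using Ncnt_diff[OF w, of "u-e" u] e(1) by simp
  moreover have "Ncnt w (u-e) < real m" using u e(1) by simp
  then have "Ncnt w (u-e) + 1 \<le> real m" by (simp add: Ncnt_def)
  ultimately show ?thesis by simp
qed

text \<open>No point of N beyond the m-th one lies in the set. This deterministic bound is the
  source of finiteness in the compensator formula.\<close>

lemma cmeas_stop_set_le:
  assumes "is_Nstopping \<tau>" and w: "w \<in> Nsp"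
  shows "emeasure (cmeas w) (stop_set \<tau> m w) \<le> ennreal (real m)"
proof -
  have fin: "emeasure (cmeas w) (stop_set \<tau> m w \<inter> {..real n}) \<le> ennreal (real m)" for n
  proof -
    have f: "finite (w \<inter> (stop_set \<tau> m w \<inter> {..real n}))"
      by (rule finite_subset[of _ "w \<inter> {..real n}"]) (use Nsp_finite[OF w, of "real n"] Nsp_Int_Iic[OF w, of "real n"] in auto)
    have "real (card (w \<inter> (stop_set \<tau> m w \<inter> {..real n}))) \<le> real m"
    proof (cases "w \<inter> (stop_set \<tau> m w \<inter> {..real n}) = {}")
      case False
      define u where "u = Max (w \<inter> (stop_set \<tau> m w \<inter> {..real n}))"
      have u: "u \<in> stop_set \<tau> m w" using Max_in[OF f False] by (auto simp: u_def)
      have "w \<inter> (stop_set \<tau> m w \<inter> {..real n}) \<subseteq> w \<inter> {0..u}"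
      proof
        fix x assume x: "x \<in> w \<inter> (stop_set \<tau> m w \<inter> {..real n})"
        then have "x \<le> u" "0 < x" using Max_ge[OF f x] NspD[OF w, of x] by (auto simp: u_def)
        then show "x \<in> w \<inter> {0..u}" using x by auto
      qed
      then have "real (card (w \<inter> (stop_set \<tau> m w \<inter> {..real n}))) \<le> Ncnt w u"
        unfolding Ncnt_def by (simp add: card_mono Nsp_finite[OF w])
      also have "\<dots> \<le> real m" using u by (intro Ncnt_le_stop_set[OF w]) (auto simp: stop_set_def)
      finally show ?thesis .
    next
      case True
      show ?thesis unfolding True by simp
    qed
    then show ?thesis using f stop_set_sets[OF assms] by (subst emeasure_cmeas_finite) auto
  qed
  have "stop_set \<tau> m w = (\<Union>n. stop_set \<tau> m w \<inter> {..real n})" using real_arch_simple by auto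
  then have "emeasure (cmeas w) (stop_set \<tau> m w) = (SUP n. emeasure (cmeas w) (stop_set \<tau> m w \<inter> {..real n}))"
    using stop_set_sets[OF assms] by (subst SUP_emeasure_incseq) (auto simp: incseq_def intro: order.trans)
  then show ?thesis using fin by (auto intro: SUP_least)
qed

text \<open>r is the m-th jump time clipped to [s,t], an infimum that is attained because counting
  paths are right-continuous. The equivalence is what gets used: it exhibits r as a stopping time
  however it is selected.\<close>

lemma jump_time_exists:
  assumes w: "w \<in> Nsp" and st: "s \<le> t"
  shows "\<exists>r. s \<le> r \<and> r \<le> t \<and> (\<forall>v\<ge>s. r \<le> v \<longleftrightarrow> real m \<le> Ncnt w v \<or> t \<le> v)"
proof -
  define S where "S = {v. s \<le> v \<and> (real m \<le> Ncnt w v \<or> t \<le> v)}"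
  have tS: "t \<in> S" using st by (simp add: S_def)
  have bdd: "bdd_below S" by (rule bdd_belowI[of _ s]) (auto simp: S_def)
  define r where "r = Inf S"
  have rs: "s \<le> r" unfolding r_def using tS by (intro cInf_greatest) (auto simp: S_def)
  have rt: "r \<le> t" unfolding r_def using tS bdd by (rule cInf_lower)
  have up: "v' \<in> S" if "v \<in> S" "v \<le> v'" for v v' using that Ncnt_mono[OF w that(2)] by (auto simp: S_def)
  have rS: "r \<in> S"
  proof -
    obtain e where e: "0 < e" "w \<inter> {r<..r+e} = {}" using Nsp_gap_right[OF w] by blast
    obtain v where v: "v \<in> S" "v < r + e"
      using cInf_lessD[of S "r + e"] tS e(1) by (auto simp: r_def)
    have "r \<le> v" unfolding r_def using v(1) bdd by (rule cInf_lower)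
    moreover have "\<not> (\<exists>x\<in>w. r < x \<and> x \<le> v)" using e(2) v(2) by auto
    ultimately have "Ncnt w v \<le> Ncnt w r" using Ncnt_less_iff[OF w, of r v] by auto
    show ?thesis
    proof (cases "t \<le> r")
      case True then show ?thesis using rs by (simp add: S_def)
    next
      case False
      show ?thesis
      proof (cases "real m \<le> Ncnt w v")
        case True
        then show ?thesis using \<open>Ncnt w v \<le> Ncnt w r\<close> rs by (simp add: S_def)
      next
        case nv: False
        then have tv: "t \<le> v" using v by (simp add: S_def)
        obtain v2 where v2: "v2 \<in> S" "v2 < t" using cInf_lessD[of S t] tS False by (auto simp: r_def)
        then have "real m \<le> Ncnt w v2" by (simp add: S_def)
        also have "\<dots> \<le> Ncnt w v" using Ncnt_mono[OF w] v2 tv by simp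
        finally show ?thesis using nv by simp
      qed
    qed
  qed
  have "r \<le> v \<longleftrightarrow> v \<in> S" if "s \<le> v" for v
    using up[OF rS] cInf_lower[OF _ bdd, of v] by (auto simp: r_def)
  then show ?thesis using rs rt by (intro exI[of _ r]) (auto simp: S_def)
qed

section \<open>The compensator formula\<close>

lemma tendsto_at_right_Ncnt:
  assumes "w \<in> Nsp" shows "((\<lambda>v. Ncnt w v) \<longlongrightarrow> Ncnt w u) (at_right u)"
proof (rule tendsto_eventually)
  obtain e where e: "0 < e" "w \<inter> {u<..u+e} = {}" using Nsp_gap_right[OF assms] by blast
  have "Ncnt w v = Ncnt w u" if "u < v" "v < u + e" for v
  proof -
    have "\<not> (\<exists>x\<in>w. u < x \<and> x \<le> v)" using e(2) that by auto
    then show ?thesis using Ncnt_less_iff[OF assms, of u v] Ncnt_mono[OF assms, of u v] that by auto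
  qed
  then show "\<forall>\<^sub>F v in at_right u. Ncnt w v = Ncnt w u"
    using e(1) unfolding eventually_at_right_field by (intro exI[of _ "u + e"]) auto
qed

lemma emeasure_cmeas_Ioc:
  "w \<in> Nsp \<Longrightarrow> a \<le> b \<Longrightarrow> emeasure (cmeas w) {a<..b} = ennreal (Ncnt w b - Ncnt w a)"
  by (simp add: emeasure_cmeas_finite Nsp_finite_Ioc Ncnt_diff)

text \<open>The increment of the stopped process between s and r becomes the mass of one interval.
  Its left end is the minimum of s and \<open>\<tau>\<close>: if \<open>\<tau> w < s\<close>, the
  process has already stopped, and a = b gives the empty interval.\<close>

lemma stop_set_Ioc:
  assumes w: "w \<in> Nsp" and \<tau>: "0 \<le> \<tau> w" and s: "0 \<le> s"
    and r: "s \<le> r" "r \<le> t" "\<And>v. s \<le> v \<Longrightarrow> r \<le> v \<longleftrightarrow> real m \<le> Ncnt w v \<or> t \<le> v"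
  obtains a b where "a \<le> b" "{s<..t} \<inter> stop_set \<tau> m w = {a<..b}"
    "\<And>X. stopped X \<tau> w s = X w a" "\<And>X. stopped X \<tau> w r = X w b"
proof -
  have core: "(\<forall>v<u. Ncnt w v < real m) \<longleftrightarrow> u \<le> r" if u: "s < u" "u \<le> t" for u
  proof
    assume a: "\<forall>v<u. Ncnt w v < real m"
    show "u \<le> r"
    proof (rule ccontr)
      assume "\<not> u \<le> r"
      then have "Ncnt w r < real m" using a by simp
      then show False using r(3)[of r] r(1) u \<open>\<not> u \<le> r\<close> by auto
    qed
  next
    assume ur: "u \<le> r"
    show "\<forall>v<u. Ncnt w v < real m"
    proof (intro allI impI)
      fix v assume v: "v < u"
      then have "Ncnt w (max s v) < real m" using r(3)[of "max s v"] ur u by (auto simp: not_le)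
      then show "Ncnt w v < real m" using Ncnt_mono[OF w, of v "max s v"] by simp
    qed
  qed
  show ?thesis
  proof (cases "\<tau> w")
    case (real k)
    have "{s<..t} \<inter> stop_set \<tau> m w = {min k s<..min k r}"
    proof -
      have "u \<in> stop_set \<tau> m w \<longleftrightarrow> u \<le> k \<and> u \<le> r" if "s < u" "u \<le> t" for u
        using core[OF that] real by (simp add: stop_set_def)
      then show ?thesis using r(1,2) by (auto simp: min_def split: if_splits)
    qed
    then show ?thesis using r(1) real
      by (intro that[of "min k s" "min k r"]) (auto simp: stopped_def min_def)
  next
    case PInf
    have "{s<..t} \<inter> stop_set \<tau> m w = {s<..r}"
    proof -
      have "u \<in> stop_set \<tau> m w \<longleftrightarrow> u \<le> r" if "s < u" "u \<le> t" for u
        using core[OF that] PInf by (simp add: stop_set_def)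
      then show ?thesis using r(1,2) by auto
    qed
    then show ?thesis using r(1) PInf by (intro that[of s r]) (auto simp: stopped_def)
  qed (use \<tau> in auto)
qed

locale rate_law = rate ydot + prob_space M for ydot and M :: "real set measure" +
  assumes setsM [measurable_cong]: "sets M = sets Nfinf"
    and goodM: "AE w in M. ygood ydot w"
    and loc: "is_Nlocmart M (\<lambda>w t. Ncnt w t - ypath ydot w t)"
begin

lemma spaceM [simp]: "space M = Nsp"
  using sets_eq_imp_space_eq[OF setsM] by simp

text \<open>Optional stopping at the clipped m-th jump time makes the increment of the stopped
  martingale integrate to zero over A, and almost surely this increment is the dN-mass minus the
  dy-mass of the random interval. As the dN-mass is at most m, the dy-mass is a difference of
  integrable functions, and the two means separate.\<close>

lemma rect_compensator:
  assumes \<tau>: "is_Nstopping \<tau>" and mart: "is_Nmart M (stopped (\<lambda>w t. Ncnt w t - ypath ydot w t) \<tau>)"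
    and st: "0 \<le> s" "s \<le> t" and A: "A \<in> sets (Nfilt s)"
  shows "(\<integral>\<^sup>+w. indicator A w * emeasure (cmeas w) ({s<..t} \<inter> stop_set \<tau> m w) \<partial>M) =
    (\<integral>\<^sup>+w. indicator A w * emeasure (ymeas ydot w) ({s<..t} \<inter> stop_set \<tau> m w) \<partial>M)"
proof -
  define X where "X w t = Ncnt w t - ypath ydot w t" for w t
  define S where "S = stopped X \<tau>"
  have martS: "is_Nmart M S" using mart by (simp add: S_def X_def[abs_def])
  have "\<forall>w\<in>Nsp. \<exists>r. s \<le> r \<and> r \<le> t \<and> (\<forall>v\<ge>s. r \<le> v \<longleftrightarrow> real m \<le> Ncnt w v \<or> t \<le> v)"
    using jump_time_exists st by blast
  from bchoice[OF this] obtain \<rho> where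
    "\<forall>w\<in>Nsp. s \<le> \<rho> w \<and> \<rho> w \<le> t \<and> (\<forall>v\<ge>s. \<rho> w \<le> v \<longleftrightarrow> real m \<le> Ncnt w v \<or> t \<le> v)" by blast
  then have \<rho>: "w \<in> Nsp \<Longrightarrow> s \<le> \<rho> w" "w \<in> Nsp \<Longrightarrow> \<rho> w \<le> t"
    and \<rho>_iff: "w \<in> Nsp \<Longrightarrow> s \<le> v \<Longrightarrow> \<rho> w \<le> v \<longleftrightarrow> real m \<le> Ncnt w v \<or> t \<le> v" for w v
    by simp_all
  \<comment> \<open>\<open>\<rho>\<close> is produced by the axiom of choice; its measurability
    rests on \<open>\<rho>_iff\<close> alone.\<close>
  have stop: "{w\<in>Nsp. \<rho> w \<le> u} \<in> sets (Nfilt u)" if "s \<le> u" "u \<le> t" for u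
  proof -
    note [measurable] = Ncnt_measurable_Nfilt[OF order.refl, of u]
    have "{w\<in>Nsp. \<rho> w \<le> u} = {w\<in>space (Nfilt u). real m \<le> Ncnt w u \<or> t \<le> u}"
      using \<rho>_iff[OF _ that(1)] by auto
    also have "\<dots> \<in> sets (Nfilt u)" by measurable
    finally show ?thesis .
  qed
  have [measurable]: "\<rho> \<in> borel_measurable Nfinf"
  proof (rule borel_measurableI_le)
    fix a
    show "{w\<in>space Nfinf. \<rho> w \<le> a} \<in> sets Nfinf"
    proof (cases "s \<le> a")
      case True
      have "{w\<in>space Nfinf. \<rho> w \<le> a} = {w\<in>space Nfinf. real m \<le> Ncnt w a \<or> t \<le> a}"
        using \<rho>_iff[OF _ True] by auto
      also have "\<dots> \<in> sets Nfinf" by measurable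
      finally show ?thesis .
    next
      case False
      then have "{w\<in>space Nfinf. \<rho> w \<le> a} = {}" using order.trans[OF \<rho>(1), of _ a] by auto
      then show ?thesis by (simp only: sets.empty_sets)
    qed
  qed
  note [measurable] = Nstopping_measurable[OF \<tau>]
  have XM: "(\<lambda>w. X w (f w)) \<in> borel_measurable Nfinf" if [measurable]: "f \<in> borel_measurable Nfinf" for f
    unfolding X_def by measurable
  have S\<rho>: "(\<lambda>w. S w (\<rho> w)) \<in> borel_measurable M"
  proof -
    note [measurable] = XM[of \<rho>] XM[of "\<lambda>w. real_of_ereal (\<tau> w)"]
    have "(\<lambda>w. S w (\<rho> w)) \<in> borel_measurable Nfinf" unfolding S_def stopped_def by measurable
    then show ?thesis unfolding measurable_cong_sets[OF setsM refl] .
  qed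
  \<comment> \<open>From \<open>\<tau>\<close> on the stopped path is constant; before
    \<open>\<tau>\<close> it is a counting path minus a continuous one. Continuity of y is known on
    good paths only, hence the exceptional null set.\<close>
  have rc: "AE w in M. \<forall>u\<ge>0. ((\<lambda>v. S w v) \<longlongrightarrow> S w u) (at_right u)"
    using goodM AE_space
  proof eventually_elim
    case (elim w)
    then interpret rate_path ydot w by unfold_locales auto
    have X: "(X w \<longlongrightarrow> X w u) (at_right u)" for u
      unfolding X_def using y_cont[of u, unfolded isCont_def]
      by (intro tendsto_diff tendsto_at_right_Ncnt wN) (auto intro: tendsto_within_subset)
    show ?case
    proof (intro allI impI)
      fix u :: real
      show "((\<lambda>v. S w v) \<longlongrightarrow> S w u) (at_right u)"
      proof (cases "\<tau> w \<le> ereal u")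
        case True
        have "S w v = S w u" if "u < v" for v
          using True order.trans[OF True, of "ereal v"] that by (simp add: S_def stopped_def)
        then show ?thesis by (intro tendsto_eventually) (auto simp: eventually_at_right_field intro: lt_ex gt_ex)
      next
        case False
        then obtain z where z: "ereal u < ereal z" "ereal z < \<tau> w" using ereal_dense2[of "ereal u" "\<tau> w"] by (auto simp: not_le)
        have "S w v = X w v" if "v < z" for v
          using z that order.strict_trans[of "ereal v" "ereal z" "\<tau> w"] by (auto simp: S_def stopped_def)
        moreover have "S w u = X w u" using False by (simp add: S_def stopped_def)
        ultimately show ?thesis
          using X[of u] z by (subst tendsto_cong[where g="X w"]) (auto simp: eventually_at_right_field)
      qed
    qed
  qed
  have P: "prob_space M" by unfold_locales
  have r1: "\<And>w. w \<in> Nsp \<Longrightarrow> s \<le> \<rho> w \<and> \<rho> w \<le> t" using \<rho> by simp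
  note os = optional_stopping[OF P setsM martS rc st r1 stop A S\<rho>]
  have intS: "integrable M (\<lambda>w. S w s)" using martS st by (auto simp: is_Nmart_def)
  have AM [measurable]: "A \<in> sets Nfinf" using A Nfilt_subset_Nfinf by blast
  define DD where "DD = {(w, u). w \<in> Nsp \<and> u \<in> stop_set \<tau> m w} \<inter> (Nsp \<times> {s<..t})"
  have DD: "DD \<in> sets (Nfinf \<Otimes>\<^sub>M borel)"
    unfolding DD_def using sets.top[of Nfinf] by (intro sets.Int stop_set_measurable \<tau> pair_measureI) auto
  define Cn Cy where "Cn w = emeasure (cmeas w) (Pair w -` DD)" and "Cy w = emeasure (ymeas ydot w) (Pair w -` DD)" for w
  have [measurable]: "Cn \<in> borel_measurable Nfinf" "Cy \<in> borel_measurable Nfinf"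
    unfolding Cn_def Cy_def by (intro cmeas_pair_measurable ymeas_pair_measurable DD)+
  have DDw: "Pair w -` DD = {s<..t} \<inter> stop_set \<tau> m w" if "w \<in> Nsp" for w using that by (auto simp: DD_def)
  have Cnm: "Cn w \<le> ennreal (real m)" if "w \<in> Nsp" for w
    unfolding Cn_def DDw[OF that] by (rule order.trans[OF emeasure_mono cmeas_stop_set_le[OF \<tau> that]])
      (use stop_set_sets[OF \<tau> that] in auto)
  have path: "AE w in M. S w (\<rho> w) - S w s = enn2real (Cn w) - enn2real (Cy w) \<and> Cy w < \<infinity>"
    using goodM AE_space
  proof eventually_elim
    case (elim w)
    then interpret rate_path ydot w by unfold_locales auto
    have "0 \<le> \<tau> w" using \<tau> wN by (auto simp: is_Nstopping_def)
    then obtain a b where ab: "a \<le> b" "{s<..t} \<inter> stop_set \<tau> m w = {a<..b}"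
      "\<And>X. stopped X \<tau> w s = X w a" "\<And>X. stopped X \<tau> w (\<rho> w) = X w b"
      using stop_set_Ioc[OF wN _ st(1) \<rho>(1)[OF wN] \<rho>(2)[OF wN] \<rho>_iff[OF wN], of \<tau>] by blast
    have "ycum ydot w b = ycum ydot w a + Cy w"
      using emeasure_ymeas_Ioc[OF wN ab(1)] by (simp add: Cy_def DDw[OF wN] ab(2))
    then have "ennreal (y b) = ennreal (y a) + Cy w" by (simp add: ennreal_ypath[OF wgood])
    moreover have "ennreal (y b) = ennreal (y a) + ennreal (y b - y a)"
      using ypath_mono[OF wgood ab(1)] ypath_nonneg[of ydot w a] by (subst ennreal_plus[symmetric]) auto
    ultimately have "Cy w = ennreal (y b - y a)" by (simp add: ennreal_add_left_cancel)
    moreover have "Cn w = ennreal (Ncnt w b - Ncnt w a)"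
      by (simp add: Cn_def DDw[OF wN] ab emeasure_cmeas_Ioc wN)
    moreover have "y a \<le> y b" "Ncnt w a \<le> Ncnt w b" using ab(1) ypath_mono[OF wgood] Ncnt_mono[OF wN] by auto
    ultimately show ?case by (simp add: S_def ab X_def)
  qed
  have iCn: "integrable M (\<lambda>w. enn2real (Cn w))"
  proof (rule integrable_const_bound[of _ "real m"])
    show "AE w in M. norm (enn2real (Cn w)) \<le> real m"
      using Cnm enn2real_mono[of "Cn _" "ennreal (real m)"] by (intro AE_I2) simp
  qed simp
  have "integrable M (\<lambda>w. enn2real (Cn w) - (S w (\<rho> w) - S w s))"
    using iCn os(1) intS by auto
  moreover have "AE w in M. enn2real (Cn w) - (S w (\<rho> w) - S w s) = enn2real (Cy w)"
    using path by eventually_elim simp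
  ultimately have iCy: "integrable M (\<lambda>w. enn2real (Cy w))"
    by (subst (asm) integrable_cong_AE) (use S\<rho> intS in auto)
  have iA: "integrable M (\<lambda>w. indicator A w * f w)" if "integrable M f" for f :: "_ \<Rightarrow> real"
    using integrable_mult_indicator[OF _ that, of A] AM setsM by simp
  have "0 = (\<integral>w. indicator A w * S w (\<rho> w) \<partial>M) - (\<integral>w. indicator A w * S w s \<partial>M)" using os(2) by simp
  also have "\<dots> = (\<integral>w. indicator A w * S w (\<rho> w) - indicator A w * S w s \<partial>M)"
    using iA[OF os(1)] iA[OF intS] by simp
  also have "\<dots> = (\<integral>w. indicator A w * enn2real (Cn w) - indicator A w * enn2real (Cy w) \<partial>M)"
  proof (rule integral_cong_AE)
    show "AE w in M. indicator A w * S w (\<rho> w) - indicator A w * S w s =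
        indicator A w * enn2real (Cn w) - indicator A w * enn2real (Cy w)"
      using path by eventually_elim (simp flip: right_diff_distrib)
  qed (use S\<rho> intS in auto)
  also have "\<dots> = (\<integral>w. indicator A w * enn2real (Cn w) \<partial>M) - (\<integral>w. indicator A w * enn2real (Cy w) \<partial>M)"
    using iA[OF iCn] iA[OF iCy] by simp
  finally have eq: "(\<integral>w. indicator A w * enn2real (Cn w) \<partial>M) = (\<integral>w. indicator A w * enn2real (Cy w) \<partial>M)" by simp
  have conv: "(\<integral>\<^sup>+w. indicator A w * C w \<partial>M) = ennreal (\<integral>w. indicator A w * enn2real (C w) \<partial>M)"
    if "AE w in M. C w < \<infinity>" "integrable M (\<lambda>w. enn2real (C w))" for C
  proof -
    have "(\<integral>\<^sup>+w. indicator A w * C w \<partial>M) = (\<integral>\<^sup>+w. ennreal (indicator A w * enn2real (C w)) \<partial>M)"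
      by (rule nn_integral_cong_AE, use that(1) in eventually_elim) (auto split: split_indicator)
    also have "\<dots> = ennreal (\<integral>w. indicator A w * enn2real (C w) \<partial>M)"
      by (rule nn_integral_eq_integral[OF iA[OF that(2)]]) auto
    finally show ?thesis .
  qed
  have "(\<integral>\<^sup>+w. indicator A w * Cn w \<partial>M) = (\<integral>\<^sup>+w. indicator A w * Cy w \<partial>M)"
  proof (subst (1 2) conv)
    show "AE w in M. Cn w < \<infinity>" using le_less_trans[OF Cnm] by (intro AE_I2) simp
    show "AE w in M. Cy w < \<infinity>" using path by eventually_elim simp
  qed (use eq iCn iCy in auto)
  moreover have "(\<integral>\<^sup>+w. indicator A w * Cn w \<partial>M) = (\<integral>\<^sup>+w. indicator A w * emeasure (cmeas w) ({s<..t} \<inter> stop_set \<tau> m w) \<partial>M)"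
    "(\<integral>\<^sup>+w. indicator A w * Cy w \<partial>M) = (\<integral>\<^sup>+w. indicator A w * emeasure (ymeas ydot w) ({s<..t} \<inter> stop_set \<tau> m w) \<partial>M)"
    unfolding Cn_def Cy_def by (intro nn_integral_cong; simp add: DDw)+
  ultimately show ?thesis by simp
qed

lemma
  assumes \<tau>: "is_Nstopping \<tau>" and A: "A \<in> sets Npred"
  shows cmeas_stop_measurable: "(\<lambda>w. emeasure (cmeas w) (Pair w -` A \<inter> stop_set \<tau> m w)) \<in> borel_measurable M"
    and ymeas_stop_measurable: "(\<lambda>w. emeasure (ymeas ydot w) (Pair w -` A \<inter> stop_set \<tau> m w)) \<in> borel_measurable M"
proof -
  define J where "J = {(w, u). w \<in> Nsp \<and> u \<in> stop_set \<tau> m w} \<inter> A"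
  have J: "J \<in> sets (Nfinf \<Otimes>\<^sub>M borel)"
    unfolding J_def by (intro sets.Int stop_set_measurable \<tau> Npred_sets_jointly A)
  have eq: "Pair w -` A \<inter> stop_set \<tau> m w = Pair w -` J" if "w \<in> space Nfinf" for w
    using that by (auto simp: J_def)
  show "(\<lambda>w. emeasure (cmeas w) (Pair w -` A \<inter> stop_set \<tau> m w)) \<in> borel_measurable M"
    "(\<lambda>w. emeasure (ymeas ydot w) (Pair w -` A \<inter> stop_set \<tau> m w)) \<in> borel_measurable M"
    unfolding measurable_cong_sets[OF setsM refl]
    by (rule iffD2[OF measurable_cong[OF arg_cong[OF eq]]], assumption,
      intro cmeas_pair_measurable ymeas_pair_measurable J)+
qed

text \<open>Both sides are measures in B, and the left one has mass at most m, so agreement on the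
  intersection-stable rectangles extends to \<open>Npred\<close>. The whole space is not a
  rectangle; the complement step needs it, so it is assembled separately from countably many
  disjoint ones.\<close>

lemma stopped_compensator:
  assumes \<tau>: "is_Nstopping \<tau>" and mart: "is_Nmart M (stopped (\<lambda>w t. Ncnt w t - ypath ydot w t) \<tau>)"
    and B: "B \<in> sets Npred"
  shows "(\<integral>\<^sup>+w. emeasure (cmeas w) (Pair w -` B \<inter> stop_set \<tau> m w) \<partial>M) =
    (\<integral>\<^sup>+w. emeasure (ymeas ydot w) (Pair w -` B \<inter> stop_set \<tau> m w) \<partial>M)"
proof -
  have SS: "stop_set \<tau> m w \<in> sets borel" if "w \<in> Nsp" for w using stop_set_sets[OF \<tau> that] .
  have sec: "Pair w -` A \<in> sets borel" if "A \<in> sets Npred" for w A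
    using sets_Pair1[OF Npred_sets_jointly[OF that]] .
  note mc = cmeas_stop_measurable[OF \<tau>] and my = ymeas_stop_measurable[OF \<tau>]
  have B': "B \<in> sigma_sets (Nsp \<times> {0..}) pred_rects" using B by (simp only: sets_Npred)
  have countable_union: "(\<integral>\<^sup>+w. emeasure (cmeas w) (Pair w -` (\<Union>i. A i) \<inter> stop_set \<tau> m w) \<partial>M) =
     (\<integral>\<^sup>+w. emeasure (ymeas ydot w) (Pair w -` (\<Union>i. A i) \<inter> stop_set \<tau> m w) \<partial>M)"
    if dis: "disjoint_family A" and A: "range A \<subseteq> sets Npred"
      and eq: "\<And>i. (\<integral>\<^sup>+w. emeasure (cmeas w) (Pair w -` A i \<inter> stop_set \<tau> m w) \<partial>M) =
       (\<integral>\<^sup>+w. emeasure (ymeas ydot w) (Pair w -` A i \<inter> stop_set \<tau> m w) \<partial>M)" for A :: "nat \<Rightarrow> _"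
  proof -
    have sums: "emeasure (\<kappa> w) (Pair w -` (\<Union>i. A i) \<inter> stop_set \<tau> m w) =
        (\<Sum>i. emeasure (\<kappa> w) (Pair w -` A i \<inter> stop_set \<tau> m w))"
      if "w \<in> space M" "sets (\<kappa> w) = sets borel" for w and \<kappa> :: "real set \<Rightarrow> real measure"
    proof (subst suminf_emeasure)
      show "disjoint_family (\<lambda>i. Pair w -` A i \<inter> stop_set \<tau> m w)"
        using dis unfolding disjoint_family_on_def by blast
      show "range (\<lambda>i. Pair w -` A i \<inter> stop_set \<tau> m w) \<subseteq> sets (\<kappa> w)"
        using that A by (auto intro!: sets.Int SS sec)
    qed (auto intro!: arg_cong[where f="emeasure _"])
    have AN: "A i \<in> sets Npred" for i using A by auto
    show ?thesis
      by (subst (1 2) nn_integral_cong[OF sums])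
        (simp_all add: nn_integral_suminf mc[OF AN] my[OF AN] eq)
  qed
  have basic_rect: "(\<integral>\<^sup>+w. emeasure (cmeas w) (Pair w -` R \<inter> stop_set \<tau> m w) \<partial>M) =
     (\<integral>\<^sup>+w. emeasure (ymeas ydot w) (Pair w -` R \<inter> stop_set \<tau> m w) \<partial>M)" if R: "R \<in> pred_rects" for R
  proof -
    consider A where "R = A \<times> {0}" | A s t where "R = A \<times> {s<..t}" "0 \<le> s" "s \<le> t" "A \<in> sets (Nfilt s)"
      using R by blast
    then show ?thesis
    proof cases
      case 1
      \<comment> \<open>Time 0 carries neither a point of N nor dy-mass.\<close>
      have sub: "Pair w -` R \<inter> stop_set \<tau> m w \<subseteq> {0}" for w using 1 by auto
      have "emeasure (cmeas w) (Pair w -` R \<inter> stop_set \<tau> m w) = 0" if "w \<in> Nsp" for w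
      proof -
        have "emeasure (cmeas w) {0} = 0" using NspD[OF that, of 0] by (subst emeasure_cmeas_finite) auto
        then show ?thesis using emeasure_mono[OF sub[of w], of "cmeas w"] by simp
      qed
      moreover have "emeasure (ymeas ydot w) (Pair w -` R \<inter> stop_set \<tau> m w) = 0" if "w \<in> Nsp" for w
        using emeasure_mono[OF sub[of w], of "ymeas ydot w"] emeasure_ymeas_sing[OF that] by simp
      ultimately show ?thesis by (intro nn_integral_cong) simp
    next
      case 2
      have "emeasure (\<kappa> w) (Pair w -` R \<inter> stop_set \<tau> m w) = indicator A w * emeasure (\<kappa> w) ({s<..t} \<inter> stop_set \<tau> m w)"
        for \<kappa> :: "real set \<Rightarrow> real measure" and w using 2 by (auto split: split_indicator)
      then show ?thesis using rect_compensator[OF \<tau> mart 2(2-4), of m] by simp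
    qed
  qed
  have whole: "(\<integral>\<^sup>+w. emeasure (cmeas w) (Pair w -` (Nsp \<times> {0..}) \<inter> stop_set \<tau> m w) \<partial>M) =
     (\<integral>\<^sup>+w. emeasure (ymeas ydot w) (Pair w -` (Nsp \<times> {0..}) \<inter> stop_set \<tau> m w) \<partial>M)"
  proof -
    define A where "A i = (case i of 0 \<Rightarrow> Nsp \<times> {0} | Suc n \<Rightarrow> Nsp \<times> {real n<..real n + 1})" for i
    have AR: "A i \<in> pred_rects" for i
    proof (cases i)
      case 0
      have "Nsp \<in> sets (Nfilt 0)" using sets.top[of "Nfilt 0"] by simp
      then show ?thesis unfolding A_def 0 by auto
    next
      case (Suc n)
      have "Nsp \<in> sets (Nfilt (real n))" using sets.top[of "Nfilt (real n)"] by simp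
      moreover have "0 \<le> real n" "real n \<le> real n + 1" by auto
      ultimately show ?thesis unfolding A_def Suc nat.case by blast
    qed
    have dis: "disjoint_family A"
    proof -
      have "i = j" if "(w, u) \<in> A i" "(w, u) \<in> A j" for i j w u
        using that unfolding A_def by (cases i; cases j) auto
      then show ?thesis unfolding disjoint_family_on_def by (metis disjoint_iff surj_pair)
    qed
    have un: "(\<Union>i. A i) = Nsp \<times> {0..}"
    proof (intro set_eqI iffI)
      fix x assume "x \<in> Nsp \<times> {0::real..}"
      then obtain w u where x: "x = (w, u)" "w \<in> Nsp" "0 \<le> u" by auto
      show "x \<in> (\<Union>i. A i)"
      proof (cases "u = 0")
        case True then show ?thesis using x by (intro UN_I[of 0]) (auto simp: A_def)
      next
        case False
        define n where "n = nat (\<lceil>u\<rceil> - 1)"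
        have "real n < u" "u \<le> real n + 1" using x False by (auto simp: n_def) linarith+
        then show ?thesis using x by (intro UN_I[of "Suc n"]) (auto simp: A_def)
      qed
    next
      fix x assume "x \<in> (\<Union>i. A i)"
      then obtain i where "x \<in> A i" by blast
      then show "x \<in> Nsp \<times> {0..}" by (cases i) (auto simp: A_def)
    qed
    have "range A \<subseteq> sets Npred" using AR unfolding sets_Npred by (auto intro: sigma_sets.Basic)
    from countable_union[OF dis this basic_rect[OF AR]] show ?thesis unfolding un .
  qed
  from Int_stable_pred_rects pred_rects_subset B' show ?thesis
  proof (induction rule: sigma_sets_induct_disjoint)
    case (compl A)
    have A: "A \<in> sets Npred" using compl(1) by (simp only: sets_Npred)
    have nA: "Nsp \<times> {0..} - A \<in> sets Npred" using sets.compl_sets[OF A] by simp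
    have split: "emeasure (\<kappa> w) (Pair w -` (Nsp \<times> {0..}) \<inter> stop_set \<tau> m w) =
      emeasure (\<kappa> w) (Pair w -` A \<inter> stop_set \<tau> m w) + emeasure (\<kappa> w) (Pair w -` (Nsp \<times> {0..} - A) \<inter> stop_set \<tau> m w)"
      if "w \<in> space M" "sets (\<kappa> w) = sets borel" for w and \<kappa> :: "real set \<Rightarrow> real measure"
      using that sec[OF A, of w] sec[OF nA, of w] SS[of w] sets.sets_into_space[OF A]
      by (subst plus_emeasure) (auto intro!: arg_cong[where f="emeasure _"])
    let ?c = "\<lambda>A. \<integral>\<^sup>+w. emeasure (cmeas w) (Pair w -` A \<inter> stop_set \<tau> m w) \<partial>M"
    let ?y = "\<lambda>A. \<integral>\<^sup>+w. emeasure (ymeas ydot w) (Pair w -` A \<inter> stop_set \<tau> m w) \<partial>M"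
    have c: "?c (Nsp \<times> {0..}) = ?c A + ?c (Nsp \<times> {0..} - A)"
      by (subst nn_integral_cong[OF split]) (simp_all add: nn_integral_add mc[OF A] mc[OF nA])
    have y: "?y (Nsp \<times> {0..}) = ?y A + ?y (Nsp \<times> {0..} - A)"
      by (subst nn_integral_cong[OF split]) (simp_all add: nn_integral_add my[OF A] my[OF nA])
    have "?c A \<le> (\<integral>\<^sup>+w. ennreal (real m) \<partial>M)"
    proof (intro nn_integral_mono)
      fix w assume "w \<in> space M"
      then have w: "w \<in> Nsp" by simp
      show "emeasure (cmeas w) (Pair w -` A \<inter> stop_set \<tau> m w) \<le> ennreal (real m)"
        by (rule order.trans[OF emeasure_mono cmeas_stop_set_le[OF \<tau> w]]) (use SS[OF w] in auto)
    qed
    also have "\<dots> < \<infinity>" by (simp add: emeasure_space_1[unfolded spaceM])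
    finally have "?c A < \<infinity>" .
    \<comment> \<open>Finiteness is what permits the cancellation, and it comes from the
      localisation at the m-th jump.\<close>
    then have "?c A \<noteq> \<infinity>" by simp
    moreover have "?c A + ?c (Nsp \<times> {0..} - A) = ?c A + ?y (Nsp \<times> {0..} - A)"
      using c y whole compl(2) by simp
    ultimately show ?case by (simp only: ennreal_add_left_cancel) simp
  next
    case (union A)
    have "range A \<subseteq> sets Npred" using union(2) by (simp only: sets_Npred)
    then show ?case by (rule countable_union[OF union(1) _ union(3)])
  next
    case (basic A)
    then show ?case by (rule basic_rect)
  qed simp
qed

text \<open>Both sides increase along the localising sets, so monotone convergence removes the
  localisation without integrability. One index n drives both the localising times and the bound on
  the number of jumps.\<close>

lemma compensator:
  assumes B: "B \<in> sets Npred"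
  shows "(\<integral>\<^sup>+w. emeasure (cmeas w) (Pair w -` B) \<partial>M) = (\<integral>\<^sup>+w. emeasure (ymeas ydot w) (Pair w -` B) \<partial>M)"
proof -
  obtain \<tau> where \<tau>: "\<And>n. is_Nstopping (\<tau> n)" "\<And>n w. w \<in> Nsp \<Longrightarrow> \<tau> n w \<le> \<tau> (Suc n) w"
    "AE w in M. (\<lambda>n. \<tau> n w) \<longlonglongrightarrow> \<infinity>"
    "\<And>n. is_Nmart M (stopped (\<lambda>w t. Ncnt w t - ypath ydot w t) (\<tau> n))"
    using loc unfolding is_Nlocmart_def by blast
  define D where "D n w = stop_set (\<tau> n) n w" for n :: nat and w
  have SS: "D n w \<in> sets borel" if "w \<in> Nsp" for w n unfolding D_def using stop_set_sets[OF \<tau>(1) that] .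
  have sec: "Pair w -` B \<in> sets borel" for w using sets_Pair1[OF Npred_sets_jointly[OF B]] .
  have inc: "incseq (\<lambda>n. D n w)" if "w \<in> Nsp" for w
  proof (rule incseq_SucI)
    show "D n w \<subseteq> D (Suc n) w" for n
      unfolding D_def stop_set_def using \<tau>(2)[OF that, of n] by (auto intro: order.trans less_trans)
  qed
  have meas: "(\<lambda>w. emeasure (cmeas w) (Pair w -` B \<inter> D n w)) \<in> borel_measurable M"
     "(\<lambda>w. emeasure (ymeas ydot w) (Pair w -` B \<inter> D n w)) \<in> borel_measurable M" for n
    unfolding D_def by (intro cmeas_stop_measurable ymeas_stop_measurable \<tau> B)+
  have lim: "(\<integral>\<^sup>+w. emeasure (\<kappa> w) (Pair w -` B) \<partial>M) = (SUP n. \<integral>\<^sup>+w. emeasure (\<kappa> w) (Pair w -` B \<inter> D n w) \<partial>M)"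
    if \<kappa>: "\<And>w. sets (\<kappa> w) = sets borel" and m: "\<And>n. (\<lambda>w. emeasure (\<kappa> w) (Pair w -` B \<inter> D n w)) \<in> borel_measurable M"
    for \<kappa> :: "real set \<Rightarrow> real measure"
  proof -
    have "(\<integral>\<^sup>+w. emeasure (\<kappa> w) (Pair w -` B) \<partial>M) = (\<integral>\<^sup>+w. (SUP n. emeasure (\<kappa> w) (Pair w -` B \<inter> D n w)) \<partial>M)"
    proof (rule nn_integral_cong_AE, use \<tau>(3) AE_space in eventually_elim)
      case (elim w)
      then have w: "w \<in> Nsp" by simp
      have "\<exists>n. u \<in> D n w" for u
      proof -
        have "\<forall>\<^sub>F n in sequentially. ereal u < \<tau> n w" using elim(1) by (auto simp: order_tendsto_iff)
        moreover have "\<forall>\<^sub>F n in sequentially. Ncnt w u < real n"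
          using filterlim_real_sequentially by (simp add: filterlim_at_top_dense)
        ultimately have "\<forall>\<^sub>F n in sequentially. u \<in> D n w"
          by eventually_elim (auto simp: D_def stop_set_def intro: less_imp_le le_less_trans[OF Ncnt_mono[OF w]])
        then show ?thesis by (auto simp: eventually_sequentially)
      qed
      then have "Pair w -` B = (\<Union>n. Pair w -` B \<inter> D n w)" by auto
      moreover have "incseq (\<lambda>n. Pair w -` B \<inter> D n w)" using inc[OF w] by (auto simp: incseq_def)
      ultimately show ?case using SS[OF w] sec \<kappa>
        by (subst SUP_emeasure_incseq) auto
    qed
    also have "\<dots> = (SUP n. \<integral>\<^sup>+w. emeasure (\<kappa> w) (Pair w -` B \<inter> D n w) \<partial>M)"
    proof (rule nn_integral_monotone_convergence_SUP_AE)
      show "AE w in M. emeasure (\<kappa> w) (Pair w -` B \<inter> D i w) \<le> emeasure (\<kappa> w) (Pair w -` B \<inter> D (Suc i) w)" for i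
        using inc SS sec \<kappa> by (intro AE_I2 emeasure_mono) (auto simp: incseq_Suc_iff)
    qed (rule m)
    finally show ?thesis .
  qed
  show ?thesis
    by (subst (1 2) lim) (use meas in \<open>auto simp: D_def stopped_compensator[OF \<tau>(1) \<tau>(4) B]\<close>)
qed

end

section \<open>The hitting equation and its uniqueness\<close>

text \<open>Picard's estimate: two solutions differ by at most 1, and each use of the equation
  integrates the bound once more over [0,b], which gives b^n / n! for every n. Restricting the
  integral to S only lowers it.\<close>

lemma hitting_equation_unique:
  fixes p1 p2 :: "real \<Rightarrow> real"
  assumes [measurable]: "p1 \<in> borel_measurable borel" "p2 \<in> borel_measurable borel" "S \<in> sets borel"
    and b1: "\<And>v. 0 \<le> p1 v" "\<And>v. p1 v \<le> 1" and b2: "\<And>v. 0 \<le> p2 v" "\<And>v. p2 v \<le> 1"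
    and eq1: "\<And>b. 0 \<le> b \<Longrightarrow> ennreal (1 - p1 b) = (\<integral>\<^sup>+v\<in>{0..<b} \<inter> S. ennreal (p1 v) \<partial>lborel)"
    and eq2: "\<And>b. 0 \<le> b \<Longrightarrow> ennreal (1 - p2 b) = (\<integral>\<^sup>+v\<in>{0..<b} \<inter> S. ennreal (p2 v) \<partial>lborel)"
    and b: "0 \<le> b"
  shows "p1 b = p2 b"
proof -
  have int: "integrable lborel (\<lambda>v. indicator ({0..<b} \<inter> S) v * p v)"
    and rep: "1 - p b = (\<integral>v. indicator ({0..<b} \<inter> S) v * p v \<partial>lborel)"
    if [measurable]: "p \<in> borel_measurable borel" and p: "\<And>v. 0 \<le> p v" "\<And>v. p v \<le> 1"
      and eq: "ennreal (1 - p b) = (\<integral>\<^sup>+v\<in>{0..<b} \<inter> S. ennreal (p v) \<partial>lborel)" for p b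
  proof -
    have e: "(\<integral>\<^sup>+v. ennreal (indicator ({0..<b} \<inter> S) v * p v) \<partial>lborel) = ennreal (1 - p b)"
      unfolding eq by (intro nn_integral_cong) (auto split: split_indicator)
    show "integrable lborel (\<lambda>v. indicator ({0..<b} \<inter> S) v * p v)"
      by (rule integrableI_nonneg) (use p e in auto)
    show "1 - p b = (\<integral>v. indicator ({0..<b} \<inter> S) v * p v \<partial>lborel)"
      by (subst integral_eq_nn_integral) (use p e in auto)
  qed
  have bound: "\<bar>p1 b - p2 b\<bar> \<le> b ^ n / fact n" if "0 \<le> b" for n b
    using that
  proof (induction n arbitrary: b)
    case 0
    then show ?case using b1[of b] b2[of b] by auto
  next
    case (Suc n)
    note int1 = int[OF assms(1) b1 eq1[OF Suc.prems]] and rep1 = rep[OF assms(1) b1 eq1[OF Suc.prems]]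
      and int2 = int[OF assms(2) b2 eq2[OF Suc.prems]] and rep2 = rep[OF assms(2) b2 eq2[OF Suc.prems]]
    have "p1 b - p2 b = (1 - p2 b) - (1 - p1 b)" by simp
    also have "\<dots> = (\<integral>v. indicator ({0..<b} \<inter> S) v * p2 v - indicator ({0..<b} \<inter> S) v * p1 v \<partial>lborel)"
      unfolding rep1 rep2 using int1 int2 by simp
    finally have "\<bar>p1 b - p2 b\<bar> \<le> (\<integral>v. \<bar>indicator ({0..<b} \<inter> S) v * p2 v - indicator ({0..<b} \<inter> S) v * p1 v\<bar> \<partial>lborel)"
      using integral_norm_bound[of lborel "\<lambda>v. indicator ({0..<b} \<inter> S) v * p2 v - indicator ({0..<b} \<inter> S) v * p1 v"]
      by simp
    also have "\<dots> \<le> (\<integral>v. (v ^ n * indicator {0..b} v) / fact n \<partial>lborel)"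
    proof (rule integral_mono)
      have "set_integrable lborel {0..b} (\<lambda>v. v ^ n)"
        by (intro borel_integrable_atLeastAtMost' continuous_intros)
      then show "integrable lborel (\<lambda>v. (v ^ n * indicator {0..b} v) / fact n)"
        by (intro integrable_divide) (simp add: set_integrable_def mult.commute)
      show "\<bar>indicator ({0..<b} \<inter> S) v * p2 v - indicator ({0..<b} \<inter> S) v * p1 v\<bar> \<le> (v ^ n * indicator {0..b} v) / fact n" for v
        using Suc.IH[of v] by (auto split: split_indicator simp: abs_minus_commute)
    qed (use int1 int2 in auto)
    also have "\<dots> = (\<integral>v. v ^ n * indicator {0..b} v \<partial>lborel) / fact n" by simp
    also have "\<dots> = b ^ Suc n / fact (Suc n)"
      unfolding integral_power[OF Suc.prems] by (simp only: fact_Suc divide_divide_eq_left) simp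
    finally show ?case .
  qed
  have "(\<lambda>n. inverse (fact n) * b ^ n) \<longlonglongrightarrow> 0"
    by (rule summable_LIMSEQ_zero[OF summable_exp])
  then have "\<bar>p1 b - p2 b\<bar> \<le> 0"
    by (rule LIMSEQ_le_const) (use bound[OF b] in \<open>auto simp: field_simps\<close>)
  then show ?thesis by simp
qed

section \<open>Void probabilities determine the law\<close>

lemma void_Int: "void U \<inter> void V = void (U \<union> V)"
  by (auto simp: void_def)

lemma void_mono: "U \<subseteq> V \<Longrightarrow> void V \<subseteq> void U"
  by (auto simp: void_def)

lemma void_empty: "void {} = Nsp"
  by (auto simp: void_def)

text \<open>A point of U below v already lies below some rational q < v, so the void events are
  left-continuous in v. The joint measurability obtained in this way is what lets expectation and
  the integral over v be exchanged.\<close>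

lemma void_jointly:
  assumes "open U"
  shows "{(w, v). w \<in> void (U \<inter> {..<v})} \<in> sets (Nfinf \<Otimes>\<^sub>M borel)"
proof -
  have "{(w, v). w \<in> void (U \<inter> {..<v})} = Nsp \<times> UNIV - (\<Union>q\<in>\<rat>. (Nsp - void (U \<inter> {..<q})) \<times> {q<..})" (is "?l = ?r")
  proof (intro set_eqI iffI)
    fix x assume "x \<in> ?l"
    then obtain w v where "x = (w, v)" "w \<in> void (U \<inter> {..<v})" by auto
    then show "x \<in> ?r" by (fastforce simp: void_def)
  next
    fix x assume x: "x \<in> ?r"
    then obtain w v where wv: "x = (w, v)" "w \<in> Nsp" by auto
    have "w \<inter> (U \<inter> {..<v}) = {}"
    proof (rule ccontr)
      assume "w \<inter> (U \<inter> {..<v}) \<noteq> {}"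
      then obtain z where z: "z \<in> w" "z \<in> U" "z < v" by auto
      obtain q where q: "q \<in> \<rat>" "z < q" "q < v" using Rats_dense_in_real[OF z(3)] by auto
      then show False using x wv z by (auto simp: void_def)
    qed
    then show "x \<in> ?l" using wv by (simp add: void_def)
  qed
  moreover have "?r \<in> sets (Nfinf \<Otimes>\<^sub>M borel)"
    using sets.top[of Nfinf] assms
    by (intro sets.Diff sets.countable_UN' countable_rat image_subsetI pair_measureI void_measurable) auto
  ultimately show ?thesis by simp
qed

text \<open>For each open U the equation has one solution as a function of b, and for bounded U a
  large b makes the cut disappear. The void events left are stable under intersection and generate
  the sigma-algebra.\<close>

lemma measure_eq_if_hitting_equation:
  assumes P: "prob_space M1" "prob_space M2" and sets: "sets M1 = sets Nfinf" "sets M2 = sets Nfinf"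
    and eq: "\<And>M U b. M \<in> {M1, M2} \<Longrightarrow> open U \<Longrightarrow> 0 \<le> b \<Longrightarrow>
      ennreal (1 - measure M (void (U \<inter> {..<b}))) =
      (\<integral>\<^sup>+v\<in>{0..<b} \<inter> U. ennreal (measure M (void (U \<inter> {..<v}))) \<partial>lborel)"
  shows "M1 = M2"
proof -
  interpret M1: prob_space M1 by fact
  interpret M2: prob_space M2 by fact
  have sp: "space M1 = Nsp" "space M2 = Nsp" using sets_eq_imp_space_eq[OF sets(1)] sets_eq_imp_space_eq[OF sets(2)] by auto
  have meas: "(\<lambda>v. measure M (void (U \<inter> {..<v}))) \<in> borel_measurable borel"
    if "prob_space M" "sets M = sets Nfinf" "open U" for M and U :: "real set"
  proof -
    interpret prob_space M by fact
    have "mono (\<lambda>v. - measure M (void (U \<inter> {..<v})))"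
    proof (rule monoI)
      fix u v :: real assume "u \<le> v"
      then have "void (U \<inter> {..<v}) \<subseteq> void (U \<inter> {..<u})" by (intro void_mono) auto
      moreover have "void (U \<inter> {..<u}) \<in> sets M" using that(2,3) by (simp add: void_measurable open_Int)
      ultimately show "- measure M (void (U \<inter> {..<u})) \<le> - measure M (void (U \<inter> {..<v}))"
        using finite_measure_mono by simp
    qed
    then have "(\<lambda>v. - measure M (void (U \<inter> {..<v}))) \<in> borel_measurable borel"
      by (rule borel_measurable_mono)
    then show ?thesis by simp
  qed
  have core: "measure M1 (void U) = measure M2 (void U)" if U: "open U" "bdd_above U" for U
  proof -
    obtain c where c: "\<And>x. x \<in> U \<Longrightarrow> x \<le> c" using U(2) by (auto simp: bdd_above_def)
    \<comment> \<open>One more than the bound of U, since the cut \<open>{..<b}\<close> is strict;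
      the maximum keeps b nonnegative when U lies to the left of 0.\<close>
    define b where "b = max 0 (c + 1)"
    have "U \<inter> {..<b} = U" using c by (force simp: b_def)
    moreover have "measure M1 (void (U \<inter> {..<b})) = measure M2 (void (U \<inter> {..<b}))"
      by (rule hitting_equation_unique[where S=U and b=b, OF meas[OF P(1) sets(1) U(1)] meas[OF P(2) sets(2) U(1)]])
        (use U(1) eq[of M1 U] eq[of M2 U] in \<open>simp_all add: b_def\<close>)
    ultimately show ?thesis by simp
  qed
  let ?E = "{void U | U. open U \<and> bdd_above (U :: real set)}"
  show ?thesis
  proof (rule measure_eqI_generator_eq[where E="?E" and \<Omega>=Nsp and A="\<lambda>_. Nsp"])
    show "Int_stable ?E"
    proof (rule Int_stableI)
      fix a b assume "a \<in> ?E" "b \<in> ?E"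
      then obtain U V where "a = void U" "b = void V" "open U" "open V" "bdd_above U" "bdd_above V" by auto
      then show "a \<inter> b \<in> ?E" by (intro CollectI exI[of _ "U \<union> V"]) (auto simp: void_Int)
    qed
    show "emeasure M1 X = emeasure M2 X" if "X \<in> ?E" for X
      using that core by (auto simp: M1.emeasure_eq_measure M2.emeasure_eq_measure)
    have "Nsp \<in> ?E" using void_empty by (intro CollectI exI[of _ "{}"]) simp
    then show "range (\<lambda>_ :: nat. Nsp) \<subseteq> ?E" by blast
    show "emeasure M1 Nsp \<noteq> \<infinity>" using M1.emeasure_finite by simp
    show "?E \<subseteq> Pow Nsp" by (auto simp: void_def)
    show "sets M1 = sigma_sets Nsp ?E" "sets M2 = sigma_sets Nsp ?E"
      using sets by (simp_all only: sets_Nfinf_void)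
  qed simp
qed

section \<open>Both sides of the compensator formula on the first-entry set\<close>

context rate_path
begin

text \<open>The only point of N that can lie in the section is the earliest one with level in U, and
  by monotonicity its level is below b as soon as some point has a level in U below b.\<close>

lemma emeasure_first_entry_cmeas:
  assumes U: "open U"
  shows "emeasure (cmeas w) (Pair w -` first_entry U b) = indicator {w. Ymap ydot w \<notin> void (U \<inter> {..<b})} w"
proof -
  have sec: "Pair w -` first_entry U b \<in> sets borel"
    using sets_Pair1[OF Npred_sets_jointly[OF first_entry_Npred[OF U]]] .
  have ymono: "x < u \<longleftrightarrow> y x < y u" if "x \<in> w" "u \<in> w" for x u
    using y_less_iff[of x u] NspD[OF wN that(1)] NspD[OF wN that(2)] by simp
  have mem: "u \<in> w \<inter> Pair w -` first_entry U b \<longleftrightarrow> u \<in> w \<and> y u \<in> U \<and> y u < b \<and> \<not> (\<exists>x\<in>w. x < u \<and> y x \<in> U)" for u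
    using first_entry_iff[OF U, of u b] NspD[OF wN, of u] by auto
  have void: "Ymap ydot w \<in> void (U \<inter> {..<b}) \<longleftrightarrow> \<not> (\<exists>x\<in>w. y x \<in> U \<and> y x < b)"
    using Ymap_Nsp by (auto simp: void_def Ymap_image)
  show ?thesis
  proof (cases "\<exists>x\<in>w. y x \<in> U \<and> y x < b")
    case False
    then have "w \<inter> Pair w -` first_entry U b = {}" using mem by blast
    then show ?thesis using sec False void by (simp add: emeasure_cmeas)
  next
    case True
    then obtain x where x: "x \<in> w" "y x \<in> U" "y x < b" by auto
    \<comment> \<open>An earliest point exists because only finitely many candidates precede the
      witness x.\<close>
    define F where "F = {z \<in> w \<inter> {0..x}. y z \<in> U}"
    have F: "finite F" "x \<in> F"
      using x NspD[OF wN x(1)] by (auto simp: F_def intro: finite_subset[OF _ Nsp_finite[OF wN, of x]])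
    define u where "u = Min F"
    have "u \<in> F" unfolding u_def using F by (intro Min_in) auto
    then have u: "u \<in> w" "u \<le> x" "y u \<in> U" by (auto simp: F_def)
    have nou: "\<not> (\<exists>z\<in>w. z < u \<and> y z \<in> U)"
    proof
      assume "\<exists>z\<in>w. z < u \<and> y z \<in> U"
      then obtain z where z: "z \<in> w" "z < u" "y z \<in> U" by auto
      then have "z \<in> F" using u NspD[OF wN z(1)] by (auto simp: F_def)
      then show False using z(2) Min_le[OF F(1), of z] by (simp add: u_def)
    qed
    have "y u < b" using ypath_mono[OF wgood u(2)] x(3) by simp
    have "w \<inter> Pair w -` first_entry U b = {u}"
    proof (intro set_eqI iffI)
      fix z assume "z \<in> w \<inter> Pair w -` first_entry U b"
      then have "z \<in> w" "y z \<in> U" "\<not> (\<exists>x\<in>w. x < z \<and> y x \<in> U)" using mem by auto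
      then show "z \<in> {u}" using u nou by (cases z u rule: linorder_cases) auto
    next
      fix z assume "z \<in> {u}"
      then show "z \<in> w \<inter> Pair w -` first_entry U b" using mem u nou \<open>y u < b\<close> by auto
    qed
    then show ?thesis using sec True void u(1) by (simp add: emeasure_cmeas)
  qed
qed

text \<open>Strict monotonicity turns "no earlier point with level in U" into "no point of Y in U
  below y u". Up to negative times, which have no dy-mass, the section is thus a preimage under y,
  and y carries dy to Lebesgue measure.\<close>

lemma emeasure_first_entry_ymeas:
  assumes U: "open U"
  shows "emeasure (ymeas ydot w) (Pair w -` first_entry U b) =
    emeasure lborel ({0..<b} \<inter> U \<inter> {v. Ymap ydot w \<in> void (U \<inter> {..<v})})"
proof -
  define V where "V = {..<b} \<inter> U \<inter> {v. Ymap ydot w \<in> void (U \<inter> {..<v})}"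
  have V: "V \<in> sets borel"
  proof -
    have "Pair (Ymap ydot w) -` {(w, v). w \<in> void (U \<inter> {..<v})} \<in> sets borel"
      by (rule sets_Pair1[OF void_jointly[OF U]])
    moreover have "Pair (Ymap ydot w) -` {(w, v). w \<in> void (U \<inter> {..<v})} = {v. Ymap ydot w \<in> void (U \<inter> {..<v})}" by auto
    ultimately show ?thesis using U by (simp add: V_def)
  qed
  have sec: "Pair w -` first_entry U b \<in> sets borel"
    using sets_Pair1[OF Npred_sets_jointly[OF first_entry_Npred[OF U]]] .
  have yV: "y -` V \<in> sets borel"
    using V borel_measurable_mono[of y] ypath_mono[OF wgood] measurable_sets[of y borel borel V] by (simp add: mono_def)
  have eq: "u \<in> Pair w -` first_entry U b \<longleftrightarrow> u \<in> y -` V" if "0 \<le> u" for u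
  proof -
    have "x < u \<longleftrightarrow> y x < y u" if "x \<in> w" for x
      using y_less_iff[of x u] NspD[OF wN that] \<open>0 \<le> u\<close> by simp
    then have "(\<exists>x\<in>w. x < u \<and> y x \<in> U) \<longleftrightarrow> y ` w \<inter> (U \<inter> {..<y u}) \<noteq> {}" by auto
    then show ?thesis using first_entry_iff[OF U, of u b] that Ymap_Nsp
      by (auto simp: V_def void_def Ymap_image)
  qed
  have "emeasure (ymeas ydot w) (Pair w -` first_entry U b) = emeasure (ymeas ydot w) (y -` V)"
    unfolding emeasure_ymeas[OF wN sec] emeasure_ymeas[OF wN yV]
    using eq by (intro nn_integral_cong) (auto simp: ydens_def split: split_indicator)
  also have "\<dots> = emeasure lborel ({0..} \<inter> V)" by (rule emeasure_ymeas_vimage[OF V])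
  also have "{0..} \<inter> V = {0..<b} \<inter> U \<inter> {v. Ymap ydot w \<in> void (U \<inter> {..<v})}" by (auto simp: V_def)
  finally show ?thesis .
qed

end

context rate_law
begin

lemma Ymap_measurable_M: "Ymap ydot \<in> measurable M Nfinf"
  using Ymap_measurable unfolding measurable_cong_sets[OF setsM refl] .

lemma prob_space_distr_Ymap: "prob_space (distr M Nfinf (Ymap ydot))"
  by (rule prob_space_distr[OF Ymap_measurable_M])

text \<open>The compensator formula on the first-entry set equates the probability that Y meets U
  below b with the mean Lebesgue measure of the levels in U below b that have no earlier visit
  beneath them. Fubini brings the void probability inside the integral.\<close>

lemma hitting_equation:
  assumes U: "open U"
  defines "M' \<equiv> distr M Nfinf (Ymap ydot)"
  shows "ennreal (1 - measure M' (void (U \<inter> {..<b}))) =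
    (\<integral>\<^sup>+v\<in>{0..<b} \<inter> U. ennreal (measure M' (void (U \<inter> {..<v}))) \<partial>lborel)"
proof -
  interpret M': prob_space M' unfolding M'_def by (rule prob_space_distr_Ymap)
  interpret pair_sigma_finite M' lborel ..
  have sM': "sets M' = sets Nfinf" "space M' = Nsp" by (simp_all add: M'_def)
  have vm: "void (U \<inter> {..<v}) \<in> sets M'" for v using U by (simp add: sM' void_measurable open_Int)
  define J where "J = {(w, v). w \<in> void (U \<inter> {..<v})}"
  have J: "J \<in> sets (Nfinf \<Otimes>\<^sub>M borel)" unfolding J_def by (rule void_jointly[OF U])
  have "sets (Nfinf \<Otimes>\<^sub>M (borel :: real measure)) = sets (M' \<Otimes>\<^sub>M lborel)" by (rule sets_pair_measure_cong) (auto simp: sM')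
  then have [measurable]: "J \<in> sets (M' \<Otimes>\<^sub>M lborel)" using J by simp
  have [measurable]: "U \<in> sets lborel" using U by simp
  define f :: "real set \<Rightarrow> real \<Rightarrow> ennreal" where "f w v = indicator ({0..<b} \<inter> U) v * indicator J (w, v)" for w v
  have fm [measurable]: "(\<lambda>(w, v). f w v) \<in> borel_measurable (M' \<Otimes>\<^sub>M lborel)" unfolding f_def by measurable
  have "ennreal (1 - measure M' (void (U \<inter> {..<b}))) = emeasure M' (space M' - void (U \<inter> {..<b}))"
    using M'.prob_compl[OF vm] by (simp add: M'.emeasure_eq_measure)
  also have "\<dots> = emeasure M {w\<in>space M. Ymap ydot w \<notin> void (U \<inter> {..<b})}"
  proof -
    have "Ymap ydot -` (Nsp - void (U \<inter> {..<b})) \<inter> space M = {w\<in>space M. Ymap ydot w \<notin> void (U \<inter> {..<b})}"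
      using measurable_space[OF Ymap_measurable] by auto
    moreover have "Nsp - void (U \<inter> {..<b}) \<in> sets Nfinf" using vm[of b] sets.compl_sets[of _ Nfinf] by (simp add: sM')
    ultimately show ?thesis unfolding sM'(2) unfolding M'_def by (subst emeasure_distr[OF Ymap_measurable_M]) auto
  qed
  also have "\<dots> = (\<integral>\<^sup>+w. indicator {w. Ymap ydot w \<notin> void (U \<inter> {..<b})} w \<partial>M)"
  proof -
    have "{w\<in>space M. Ymap ydot w \<notin> void (U \<inter> {..<b})} = space M - (Ymap ydot -` void (U \<inter> {..<b}) \<inter> space M)" by auto
    then have "{w\<in>space M. Ymap ydot w \<notin> void (U \<inter> {..<b})} \<in> sets M"
      using measurable_sets[OF Ymap_measurable_M, of "void (U \<inter> {..<b})"] vm[of b] by (simp only: sets.compl_sets sM')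
    then have "emeasure M {w\<in>space M. Ymap ydot w \<notin> void (U \<inter> {..<b})} =
        (\<integral>\<^sup>+w. indicator {w\<in>space M. Ymap ydot w \<notin> void (U \<inter> {..<b})} w \<partial>M)" by simp
    also have "\<dots> = (\<integral>\<^sup>+w. indicator {w. Ymap ydot w \<notin> void (U \<inter> {..<b})} w \<partial>M)"
      by (intro nn_integral_cong) (auto split: split_indicator)
    finally show ?thesis .
  qed
  also have "\<dots> = (\<integral>\<^sup>+w. emeasure (cmeas w) (Pair w -` first_entry U b) \<partial>M)"
  proof (rule nn_integral_cong_AE, use goodM AE_space in eventually_elim)
    case (elim w)
    then interpret rate_path ydot w by unfold_locales auto
    show ?case by (rule emeasure_first_entry_cmeas[OF U, symmetric])
  qed
  also have "\<dots> = (\<integral>\<^sup>+w. emeasure (ymeas ydot w) (Pair w -` first_entry U b) \<partial>M)"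
    by (rule compensator[OF first_entry_Npred[OF U]])
  also have "\<dots> = (\<integral>\<^sup>+w. (\<integral>\<^sup>+v. f (Ymap ydot w) v \<partial>lborel) \<partial>M)"
  proof (rule nn_integral_cong_AE, use goodM AE_space in eventually_elim)
    case (elim w)
    then interpret rate_path ydot w by unfold_locales auto
    have V: "{v. Ymap ydot w \<in> void (U \<inter> {..<v})} \<in> sets borel"
      using sets_Pair1[OF J, of "Ymap ydot w"] by (simp add: J_def vimage_def)
    have "f (Ymap ydot w) v = indicator ({0..<b} \<inter> U \<inter> {v. Ymap ydot w \<in> void (U \<inter> {..<v})}) v" for v
      by (auto simp: f_def J_def split: split_indicator)
    then have "(\<integral>\<^sup>+v. f (Ymap ydot w) v \<partial>lborel) = emeasure lborel ({0..<b} \<inter> U \<inter> {v. Ymap ydot w \<in> void (U \<inter> {..<v})})"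
      using V U by simp
    then show ?case using emeasure_first_entry_ymeas[OF U, of b] by simp
  qed
  also have "\<dots> = (\<integral>\<^sup>+w. (\<integral>\<^sup>+v. f w v \<partial>lborel) \<partial>M')"
  proof -
    have "(\<lambda>w. \<integral>\<^sup>+v. f w v \<partial>lborel) \<in> borel_measurable M'"
      by (rule lborel.borel_measurable_nn_integral[OF fm])
    then show ?thesis unfolding M'_def by (subst nn_integral_distr[OF Ymap_measurable_M]) simp_all
  qed
  also have "\<dots> = (\<integral>\<^sup>+v. (\<integral>\<^sup>+w. f w v \<partial>M') \<partial>lborel)"
    by (rule Fubini'[OF fm, symmetric])
  also have "\<dots> = (\<integral>\<^sup>+v\<in>{0..<b} \<inter> U. ennreal (measure M' (void (U \<inter> {..<v}))) \<partial>lborel)"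
  proof (rule nn_integral_cong)
    fix v
    have "(\<integral>\<^sup>+w. f w v \<partial>M') = indicator ({0..<b} \<inter> U) v * (\<integral>\<^sup>+w. indicator (void (U \<inter> {..<v})) w \<partial>M')"
      unfolding f_def using vm[of v] by (subst nn_integral_cmult[symmetric]) (simp_all add: J_def indicator_def)
    also have "\<dots> = ennreal (measure M' (void (U \<inter> {..<v}))) * indicator ({0..<b} \<inter> U) v"
      using vm[of v] by (simp add: M'.emeasure_eq_measure mult.commute)
    finally show "(\<integral>\<^sup>+w. f w v \<partial>M') = ennreal (measure M' (void (U \<inter> {..<v}))) * indicator ({0..<b} \<inter> U) v" .
  qed
  finally show ?thesis .
qed

end

section \<open>The unit rate case and the conclusion\<close>

lemma is_Nmart_cong:
  assumes setsM: "sets M = sets Nfinf" and eq: "\<And>w t. w \<in> Nsp \<Longrightarrow> 0 \<le> t \<Longrightarrow> X w t = Y w t"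
    and X: "is_Nmart M X"
  shows "is_Nmart M Y"
proof -
  have spM: "space M = Nsp" using sets_eq_imp_space_eq[OF setsM] by simp
  have i: "integrable M (\<lambda>w. Y w t) = integrable M (\<lambda>w. X w t)" if "0 \<le> t" for t
    using eq that by (intro Bochner_Integration.integrable_cong) (auto simp: spM)
  have b: "(\<lambda>w. Y w t) \<in> borel_measurable (Nfilt t) \<longleftrightarrow> (\<lambda>w. X w t) \<in> borel_measurable (Nfilt t)" if "0 \<le> t" for t
    using eq that by (intro measurable_cong) auto
  have l: "(LINT w:A|M. Y w t) = (LINT w:A|M. X w t)" if "0 \<le> t" for A t
    unfolding set_lebesgue_integral_def using eq that by (intro Bochner_Integration.integral_cong) (auto simp: spM)
  show ?thesis using X unfolding is_Nmart_def by (auto simp: i b l)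
qed

text \<open>The unit rate law is stated with compensator t, whereas \<open>ypath\<close> for rate 1
  is \<open>max 0 t\<close>; the two agree at nonnegative times only, which is all that the local
  martingale property sees.\<close>

lemma is_Nlocmart_cong:
  assumes setsM: "sets M = sets Nfinf" and eq: "\<And>w t. w \<in> Nsp \<Longrightarrow> 0 \<le> t \<Longrightarrow> X w t = Y w t"
    and X: "is_Nlocmart M X"
  shows "is_Nlocmart M Y"
proof -
  obtain \<tau> where \<tau>: "\<forall>n. is_Nstopping (\<tau> n)" "\<forall>n. \<forall>w\<in>Nsp. \<tau> n w \<le> \<tau> (Suc n) w"
    "AE w in M. (\<lambda>n. \<tau> n w) \<longlonglongrightarrow> \<infinity>" "\<forall>n. is_Nmart M (stopped X (\<tau> n))"
    using X unfolding is_Nlocmart_def by blast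
  have "is_Nmart M (stopped Y (\<tau> n))" for n
  proof (rule is_Nmart_cong[OF setsM _ \<tau>(4)[rule_format]])
    fix w t assume "w \<in> Nsp" "0 \<le> (t :: real)"
    \<comment> \<open>The stopped process is evaluated at the stopping time itself, which must also
      be nonnegative for the agreement to apply.\<close>
    moreover have "0 \<le> \<tau> n w" using \<tau>(1) \<open>w \<in> Nsp\<close> by (auto simp: is_Nstopping_def)
    ultimately show "stopped X (\<tau> n) w t = stopped Y (\<tau> n) w t"
      using eq by (auto simp: stopped_def real_of_ereal_pos)
  qed
  then show ?thesis using \<tau>(1-3) unfolding is_Nlocmart_def by blast
qed

lemma ypath_unit: "ypath (\<lambda>_ _. 1) w t = max 0 t"
  by (simp add: ypath_def emeasure_lborel_Icc_eq)

lemma ygood_unit: "ygood (\<lambda>_ _. 1) w"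
proof -
  have "ypath (\<lambda>_ _. 1) w = (\<lambda>t. max 0 t)" by (rule ext) (rule ypath_unit)
  moreover have "filterlim (\<lambda>t :: real. max 0 t) at_top at_top"
    by (rule filterlim_at_top_mono[OF filterlim_ident]) simp
  ultimately show ?thesis by (auto simp: ygood_def emeasure_lborel_Icc_eq)
qed

lemma rate_unit: "rate (\<lambda>_ _. 1)"
  by unfold_locales auto

lemma Ymap_unit: assumes "w \<in> Nsp" shows "Ymap (\<lambda>_ _. 1) w = w"
proof -
  interpret rate "\<lambda>_ _. 1" by (rule rate_unit)
  interpret rate_path "\<lambda>_ _. 1" w by unfold_locales (use assms ygood_unit in auto)
  have "y ` w = (\<lambda>t. t) ` w"
  proof (intro image_cong refl)
    show "y x = x" if "x \<in> w" for x using NspD[OF assms that] by (simp add: ypath_unit)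
  qed
  then show ?thesis by (simp add: Ymap_image)
qed

lemma rate_law_unit:
  assumes "is_pi_law (\<lambda>w t. t) Q"
  shows "rate_law (\<lambda>_ _. 1) Q"
proof -
  have Q: "prob_space Q" "sets Q = sets Nfinf" "is_Nlocmart Q (\<lambda>w t. Ncnt w t - t)"
    using assms by (auto simp: is_pi_law_def)
  have "is_Nlocmart Q (\<lambda>w t. Ncnt w t - ypath (\<lambda>_ _. 1) w t)"
    by (rule is_Nlocmart_cong[OF Q(2) _ Q(3)]) (simp add: ypath_unit)
  then show ?thesis
    using Q ygood_unit by (intro rate_law.intro rate_unit rate_law_axioms.intro) auto
qed

lemma distr_Ymap_unit:
  assumes "sets Q = sets Nfinf"
  shows "distr Q Nfinf (Ymap (\<lambda>_ _. 1)) = Q"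
proof -
  have "space Q = Nsp" using sets_eq_imp_space_eq[OF assms] by simp
  then have "distr Q Nfinf (Ymap (\<lambda>_ _. 1)) = distr Q Q (\<lambda>w. w)"
    using Ymap_unit by (intro distr_cong) (auto simp: assms)
  then show ?thesis by simp
qed

text \<open>Watanabe's characterisation of the Poisson process, in its time-changed form.\<close>

lemma distr_Ymap_eq:
  assumes "is_pi_law (\<lambda>w t. t) Q" "rate_law ydot P"
  shows "distr P Nfinf (Ymap ydot) = Q"
proof -
  interpret P: rate_law ydot P by fact
  interpret Q: rate_law "\<lambda>_ _. 1" Q by (rule rate_law_unit) fact
  have Q: "distr Q Nfinf (Ymap (\<lambda>_ _. 1)) = Q" by (rule distr_Ymap_unit[OF Q.setsM])
  show ?thesis
  proof (rule measure_eq_if_hitting_equation)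
    show "prob_space (distr P Nfinf (Ymap ydot))" by (rule P.prob_space_distr_Ymap)
    show "prob_space Q" by unfold_locales
    show "ennreal (1 - measure M (void (U \<inter> {..<b}))) =
      (\<integral>\<^sup>+v\<in>{0..<b} \<inter> U. ennreal (measure M (void (U \<inter> {..<v}))) \<partial>lborel)"
      if "M \<in> {distr P Nfinf (Ymap ydot), Q}" "open U" "0 \<le> b" for M U b
      using that P.hitting_equation[OF that(2)] Q.hitting_equation[OF that(2)] unfolding Q by auto
  qed (simp_all add: Q.setsM)
qed

theorem mainTheorem6:
  fixes Pois P :: "real set measure" and ydot :: "real set \<Rightarrow> real \<Rightarrow> real"
  assumes "is_pi_law (\<lambda>w t. t) Pois"
    and "Ppp Pois ydot"
    and "is_pi_law (ypath ydot) P"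
    and "equiv_measures P Pois"
  shows "equiv_measures (distr Pois Nfinf (Ymap ydot)) Pois"
proof -
  have sets: "sets Pois = sets Nfinf" "sets P = sets Nfinf" using assms(1,3) by (auto simp: is_pi_law_def)
  have null: "null_sets P = null_sets Pois"
    using assms(4) by (auto simp: equiv_measures_def absolutely_continuous_def)
  \<comment> \<open>Goodness is given under \<open>Pois\<close>, while the compensator formula is
    used under \<open>P\<close>; equivalence transfers it.\<close>
  have "AE w in P. ygood ydot w"
    using assms(2,4) absolutely_continuous_AE[of P Pois] sets by (auto simp: Ppp_def equiv_measures_def)
  then have "rate_law ydot P"
    using assms(2,3) by (intro rate_law.intro rate.intro rate_law_axioms.intro) (auto simp: Ppp_def is_pi_law_def)
  then interpret rate_law ydot P .
  have eq: "distr P Nfinf (Ymap ydot) = Pois" by (rule distr_Ymap_eq) fact+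
  have meas: "Ymap ydot \<in> measurable Pois Nfinf"
    using Ymap_measurable unfolding measurable_cong_sets[OF sets(1) refl] .
  have sp: "space Pois = space P" using sets by (intro sets_eq_imp_space_eq) simp
  \<comment> \<open>Null sets of an image measure are read off from preimages, so they depend on the
    original measure only through its null sets.\<close>
  have "null_sets (distr Pois Nfinf (Ymap ydot)) = null_sets (distr P Nfinf (Ymap ydot))"
    by (intro set_eqI) (simp only: null_sets_distr_iff[OF meas] null_sets_distr_iff[OF Ymap_measurable_M] null sp)
  then show ?thesis
    by (simp add: equiv_measures_def absolutely_continuous_def eq sets)
qed

end
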